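(* Let $(i,j)$ be real numbers with $0<i\le j<1$ and $i+j=1$, and let $\mathcal{C}$ be a $C^{(2)}$ non-degenerate planar curve. Then $\dim\big(\mathbf{Bad}(i,j)\cap\mathcal{C}\big)\ge 1$, where $\dim$ denotes Hausdorff dimension.
   Context: For real numbers $i,j$ with $0\le i,j\le1$ and $i+j=1$, $\mathbf{Bad}(i,j)$ is the set of points $(x,y)\in\mathbb{R}^2$ for which there exists a constant $c(x,y)>0$ such that $\max\{\|qx\|^{1/i},\|qy\|^{1/j}\}>c(x,y)\,q^{-1}$ for all $q\in\mathbb{N}$, where $\|\cdot\|$ is distance to the nearest integer. A planar curve $\mathcal{C}$ is $C^{(2)}$ non-degenerate if $\mathcal{C}=\{(x,f(x)):x\in I\}$ for an interval $I\subset\mathbb{R}$ and $f\in C^{(2)}(I)$ with $f''(x)\neq0$ for at least one $x\in I$. *)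

theory Defs
  imports "HOL-Analysis.Analysis"
begin

definition dist_int :: "real \<Rightarrow> real" where
  "dist_int x = \<bar>x - of_int (round x)\<bar>"

definition wpow :: "real \<Rightarrow> real \<Rightarrow> real" where
  "wpow t i = (if i = 0 then 0 else t powr (1 / i))"

definition Bad :: "real \<Rightarrow> real \<Rightarrow> (real \<times> real) set" where
  "Bad i j = {(x, y). \<exists>c > 0. \<forall>q::nat. q \<ge> 1 \<longrightarrow>
      max (wpow (dist_int (real q * x)) i) (wpow (dist_int (real q * y)) j) > c / real q}"

definition C2_nondegenerate_curve :: "(real \<times> real) set \<Rightarrow> bool" where
  "C2_nondegenerate_curve C \<longleftrightarrow>
     (\<exists>I f f' f''. is_interval I \<and> interior I \<noteq> {} \<and>
        C = {(x, f x) | x. x \<in> I} \<and>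
        (\<forall>x\<in>I. (f has_real_derivative f' x) (at x within I)) \<and>
        (\<forall>x\<in>I. (f' has_real_derivative f'' x) (at x within I)) \<and>
        continuous_on I f'' \<and>
        (\<exists>x\<in>I. f'' x \<noteq> 0))"

definition hausdorff_content :: "real \<Rightarrow> real \<Rightarrow> 'a::metric_space set \<Rightarrow> ennreal" where
  "hausdorff_content s \<delta> A =
     (INF U \<in> {U :: nat \<Rightarrow> 'a set. A \<subseteq> (\<Union>k. U k) \<and>
                 (\<forall>k. bounded (U k) \<and> diameter (U k) \<le> \<delta>)}.
        (\<Sum>k. ennreal (diameter (U k) powr s)))"

definition hausdorff_measure :: "real \<Rightarrow> 'a::metric_space set \<Rightarrow> ennreal" where
  "hausdorff_measure s A = (SUP \<delta> \<in> {0<..}. hausdorff_content s \<delta> A)"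

definition hausdorff_dim :: "'a::metric_space set \<Rightarrow> ereal" where
  "hausdorff_dim A = Inf {ereal s | s. s \<ge> 0 \<and> hausdorff_measure s A = 0}"

end

theory Submission
  imports Defs
begin

text \<open>
  A point \<open>(x, f x)\<close> fails to be in \<open>Bad i j\<close> because of rational points \<open>(p/q, t/q)\<close>. By the pigeonhole
  principle each of them lies on a line \<open>A X + B Y + C = 0\<close> with \<open>|A| \<le> q^i\<close>, \<open>|B| \<le> q^j\<close>, so that
  \<open>F x = A x + B f x + C\<close> is \<open>O(c/q)\<close> wherever \<open>x\<close> is close to that rational point. The danger is sorted
  by the size \<open>\<mu>\<close> of \<open>F' x = A + B f' x\<close>.

  If \<open>\<mu>\<close> is tiny, any three such lines with comparable \<open>B\<close> over an interval of length about \<open>1/|B|\<close> have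
  vanishing determinant, hence pass through a common point, and only near three spots can
  the tangent of the curve almost pass through it. If \<open>\<mu>\<close> is not much below \<open>q^j\<close>, all rational points
  concerning an interval of length about \<open>1/(q \<mu>)\<close> lie on one line and endanger a short subinterval.
  If \<open>\<mu>\<close> is about \<open>q^j/R^l\<close> with \<open>l\<close> large, the lines are counted on an interval that is \<open>R^l\<close> times longer:
  that interval has survived so far, hence by transference it sees no short lines, which leaves only
  \<open>O(R^(2 l/3))\<close> lines. All removals together have small \<open>s\<close>-dimensional weight for \<open>5/6 \<le> s < 1\<close>, and a greedy
  walk down the \<open>R\<close>-adic tree avoids them together with any cover of small \<open>s\<close>-dimensional weight.
\<close>

section \<open>Avoiding sets of small weight in the R-adic tree\<close>

text \<open>Why some lines are charged far in advance: a spot endangered by a line of slope \<mu> is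
  removed at the level \<open>m\<close> with \<open>R^m\<close> about \<open>q \<mu>\<close>. For a
  fixed ratio \<open>R^l\<close> of \<open>q^j\<close> to \<mu>, a cell of level
  \<open>m - 1\<close> meets one such spot, but \<open>l\<close> can be as large as
  \<open>m\<close>, so charging every \<open>l\<close> to that cell would give an unbounded total.
  Charged \<open>l\<close> levels closer to the root, the number of spots is outweighed by the
  factor \<open>R^(- s l)\<close> and the sum over \<open>l\<close> converges;
  \<open>s \<ge> 5/6\<close> leaves the ratio \<open>R^(-1/6)\<close>. The price is that the cost of
  a node can be bounded only if none of its ancestors was removed, which is the premise of
  \<open>bound\<close> in \<open>radic_path\<close>. On the exponents: a slope below
  \<open>e^4\<close>, divided by \<open>g \<ge> 100 e\<close>, locates tangency at scale
  \<open>e^3\<close>, one level below an interval of scale \<open>e^2\<close>. The normalisation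
  \<open>e^14\<close> satisfies 14 = 3 * 4 + 2, so that \<open>e^12\<close> is at most the cube of a
  transversal slope. The exponent 24 lets a spot fit into one cell after division by
  \<open>e^14\<close> and a loss of \<open>R^4\<close>.\<close>

text \<open>The node \<open>(m, v)\<close> stands for the \<open>v\<close>-th cell of level
  \<open>m\<close>, weighted by the \<open>s\<close>-th power of its relative length. As a measure,
  the weight is countably subadditive, which infinite sets of nodes require.\<close>

definition node_measure :: "nat \<Rightarrow> real \<Rightarrow> (nat \<times> nat) measure" where
  "node_measure R s = density (count_space UNIV) (\<lambda>z. ennreal (real R powr (- (s * real (fst z)))))"

lemma sets_node_measure [simp]: "sets (node_measure R s) = UNIV"
  by (simp add: node_measure_def)

lemma emeasure_node_level:
  assumes "finite V"
  shows "emeasure (node_measure R s) ({m} \<times> V) = ennreal (real (card V) * real R powr (- (s * real m)))"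
proof -
  have "emeasure (node_measure R s) ({m} \<times> V) =
      (\<integral>\<^sup>+ z. ennreal (real R powr (- (s * real m))) * indicator ({m} \<times> V) z \<partial>count_space UNIV)"
    unfolding node_measure_def
    by (subst emeasure_density) (auto intro!: nn_integral_cong simp: indicator_def)
  also have "\<dots> = ennreal (real R powr (- (s * real m))) * of_nat (card V)"
    using assms by (simp add: nn_integral_cmult_indicator card_cartesian_product)
  finally show ?thesis
    by (simp add: ennreal_mult' ennreal_of_nat_eq_real_of_nat mult.commute)
qed

lemma div_power_Suc:
  fixes k R :: nat
  assumes "n \<le> m"
  shows "k div R ^ (Suc m - n) = (k div R) div R ^ (m - n)"
  using assms by (simp add: Suc_diff_le div_mult2_eq)

lemma div_div_power:
  fixes v R :: nat
  assumes "Suc n \<le> m"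
  shows "v div R ^ (m - n) = v div R ^ (m - Suc n) div R"
proof -
  have "R ^ (m - n) = R ^ (m - Suc n) * R"
    using assms by (metis Suc_diff_Suc Suc_le_eq power_Suc2)
  thus ?thesis
    by (simp only: div_mult2_eq)
qed

lemma ancestor_div:
  fixes k :: "nat \<Rightarrow> nat" and R :: nat
  assumes k: "\<And>n. k (Suc n) div R = k n" and "n \<le> m"
  shows "k m div R ^ (m - n) = k n"
  using \<open>n \<le> m\<close>
proof (induction m)
  case (Suc m)
  thus ?case
    using div_power_Suc[of n m "k (Suc m)" R] k[of m] by (cases "n = Suc m") auto
qed auto

lemma div_pow_div_pow:
  fixes k R :: nat
  assumes "n' \<le> m" "m \<le> n"
  shows "k div R ^ (n - m) div R ^ (m - n') = k div R ^ (n - n')"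
proof -
  have "R ^ (n - m) * R ^ (m - n') = R ^ (n - n')"
    using assms by (simp flip: power_add)
  thus ?thesis
    by (simp flip: div_mult2_eq)
qed

text \<open>The invariant along the path: the not yet avoided removed nodes below the current node
  have total weight at most \<open>d\<close> times the weight of that node. A child of least weight preserves it.\<close>

lemma radic_path:
  fixes R :: nat and s d :: real and Rem :: "nat \<Rightarrow> nat \<Rightarrow> (nat \<times> nat) set"
  assumes R: "R \<ge> 1" and d: "0 \<le> d" "d < 1" and Rs: "2 * real R powr s \<le> real R"
    and bound: "\<And>n k. (\<And>n' m. n' < m \<Longrightarrow> m \<le> n \<Longrightarrow> (m, k div R ^ (n - m)) \<notin> Rem n' (k div R ^ (n - n')))
      \<Longrightarrow> emeasure (node_measure R s) (Rem n k) \<le> ennreal (d * real R powr (- (s * real n)))"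
  obtains k where "k 0 = 0" "\<And>n. k (Suc n) div R = k n" "\<And>n m. n < m \<Longrightarrow> (m, k m) \<notin> Rem n (k n)"
proof -
  define M where "M = node_measure R s"
  define desc where "desc n k = {(m, v). n \<le> m \<and> v div R ^ (m - n) = k}" for n k :: nat
  define S where "S n k = (\<Union>n'<n. Rem n' (k div R ^ (n - n')))" for n k
  \<comment> \<open>\<open>bound\<close> applies only to nodes without removed ancestors, so this
    has to be part of the invariant.\<close>
  define legal where "legal n k \<longleftrightarrow> (\<forall>n' m. n' < m \<longrightarrow> m \<le> n \<longrightarrow>
      (m, k div R ^ (n - m)) \<notin> Rem n' (k div R ^ (n - n')))" for n k
  define P where "P n k \<longleftrightarrow> emeasure M (S n k \<inter> desc n k) \<le> ennreal (d * real R powr (- (s * real n)))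
      \<and> legal n k \<and> (n = 0 \<longrightarrow> k = 0)" for n k
  have [simp]: "sets M = UNIV"
    by (simp add: M_def)
  have Rpos: "0 < real R"
    using R by simp
  have step: "\<exists>k'. P (Suc n) k' \<and> k' div R = k" if Pk: "P n k" for n k
  proof -
    define T where "T = (S n k \<inter> desc n k) \<union> Rem n k"
    define D where "D t = T \<inter> desc (Suc n) (R * k + t)" for t
    have "emeasure M (Rem n k) \<le> ennreal (d * real R powr (- (s * real n)))"
      unfolding M_def by (rule bound) (use Pk in \<open>auto simp: P_def legal_def\<close>)
    moreover have "emeasure M T \<le> emeasure M (S n k \<inter> desc n k) + emeasure M (Rem n k)"
      unfolding T_def by (rule emeasure_subadditive) auto
    ultimately have "emeasure M T \<le> ennreal (d * real R powr (- (s * real n))) +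
        ennreal (d * real R powr (- (s * real n)))"
      using Pk unfolding P_def by (meson add_mono order_trans)
    hence MT: "emeasure M T \<le> ennreal (2 * (d * real R powr (- (s * real n))))"
      using d by (simp flip: ennreal_plus)
    have disj: "disjoint_family_on D {..<R}"
      unfolding disjoint_family_on_def D_def desc_def by auto
    have "(\<Sum>t<R. emeasure M (D t)) = emeasure M (\<Union>t<R. D t)"
      by (rule sum_emeasure) (use disj in auto)
    also have "\<dots> \<le> emeasure M T"
      by (rule emeasure_mono) (auto simp: D_def)
    finally have sumD: "(\<Sum>t<R. emeasure M (D t)) \<le> ennreal (2 * (d * real R powr (- (s * real n))))"
      using MT by order
    obtain t where t: "t < R" "\<And>t'. t' < R \<Longrightarrow> emeasure M (D t) \<le> emeasure M (D t')"
    proof -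
      have ne: "finite ((\<lambda>t. emeasure M (D t)) ` {..<R})" "(\<lambda>t. emeasure M (D t)) ` {..<R} \<noteq> {}"
        using R by (auto simp: lessThan_empty_iff)
      from Min_in[OF ne] obtain t where "t < R" "emeasure M (D t) = Min ((\<lambda>t. emeasure M (D t)) ` {..<R})"
        by auto
      with ne that show thesis
        by (metis Min_le imageI lessThan_iff)
    qed
    have "of_nat R * emeasure M (D t) \<le> (\<Sum>t<R. emeasure M (D t))"
      using sum_bounded_below[of "{..<R}" "emeasure M (D t)" "\<lambda>t. emeasure M (D t)"] t by simp
    hence "ennreal (real R) * emeasure M (D t) \<le> ennreal (2 * (d * real R powr (- (s * real n))))"
      using sumD by (simp add: ennreal_of_nat_eq_real_of_nat)
    \<comment> \<open>Adding \<open>Rem n k\<close> may double the weight. Passing to the best of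
      \<open>R\<close> children divides it by \<open>R\<close>, while the weight of a node drops
      only by \<open>R^s\<close>; \<open>Rs\<close> compares the two.\<close>
    moreover have "2 * (d * real R powr (- (s * real n))) \<le> real R * (d * real R powr (- (s * real (Suc n))))"
    proof -
      have "real R powr (- (s * real n)) = real R powr s * real R powr (- (s * real (Suc n)))"
        by (simp add: powr_add [symmetric] algebra_simps)
      hence "2 * (d * real R powr (- (s * real n))) = (2 * real R powr s) * (d * real R powr (- (s * real (Suc n))))"
        by simp
      also have "\<dots> \<le> real R * (d * real R powr (- (s * real (Suc n))))"
        by (rule mult_right_mono[OF Rs]) (use d in auto)
      finally show ?thesis .
    qed
    ultimately have "ennreal (real R) * emeasure M (D t) \<le>
        ennreal (real R * (d * real R powr (- (s * real (Suc n)))))"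
      using ennreal_leI order_trans by blast
    also have "\<dots> = ennreal (real R) * ennreal (d * real R powr (- (s * real (Suc n))))"
      using d by (intro ennreal_mult) auto
    finally have MD: "emeasure M (D t) \<le> ennreal (d * real R powr (- (s * real (Suc n))))"
      using Rpos by (subst (asm) ennreal_mult_le_mult_iff) auto
    define k' where "k' = R * k + t"
    have k': "k' div R = k"
      using t(1) by (simp add: k'_def)
    have anc: "k' div R ^ (Suc n - m) = k div R ^ (n - m)" if "m \<le> n" for m
      using div_power_Suc[OF that, of k' R] k' by simp
    have Ssub: "S (Suc n) k' \<inter> desc (Suc n) k' \<subseteq> D t"
    proof
      fix z assume z: "z \<in> S (Suc n) k' \<inter> desc (Suc n) k'"
      then obtain m v where mv: "z = (m, v)" "Suc n \<le> m" "v div R ^ (m - Suc n) = k'"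
        by (auto simp: desc_def)
      have "z \<in> desc n k"
        using mv div_div_power[of n m v R] k' by (auto simp: desc_def)
      moreover from z obtain n' where n': "n' < Suc n" "z \<in> Rem n' (k' div R ^ (Suc n - n'))"
        by (auto simp: S_def)
      hence "z \<in> Rem n' (k div R ^ (n - n'))"
        using anc[of n'] by simp
      hence "z \<in> S n k \<union> Rem n k"
        using n' by (cases "n' = n") (auto simp: S_def)
      ultimately show "z \<in> D t"
        using z by (auto simp: D_def T_def k'_def)
    qed
    have "emeasure M (S (Suc n) k' \<inter> desc (Suc n) k') \<le> emeasure M (D t)"
      by (rule emeasure_mono[OF Ssub]) auto
    with MD have MS: "emeasure M (S (Suc n) k' \<inter> desc (Suc n) k') \<le> ennreal (d * real R powr (- (s * real (Suc n))))"
      by order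
    \<comment> \<open>If the new node itself were removed, it would alone exceed the allowance,
      since \<open>d < 1\<close>.\<close>
    have nS: "(Suc n, k') \<notin> S (Suc n) k'"
    proof
      assume "(Suc n, k') \<in> S (Suc n) k'"
      hence "{Suc n} \<times> {k'} \<subseteq> S (Suc n) k' \<inter> desc (Suc n) k'"
        by (auto simp: desc_def)
      hence "emeasure M ({Suc n} \<times> {k'}) \<le> emeasure M (S (Suc n) k' \<inter> desc (Suc n) k')"
        by (rule emeasure_mono) auto
      also have "emeasure M ({Suc n} \<times> {k'}) = ennreal (real R powr (- (s * real (Suc n))))"
        unfolding M_def by (subst emeasure_node_level) auto
      finally have "ennreal (real R powr (- (s * real (Suc n)))) \<le> ennreal (d * real R powr (- (s * real (Suc n))))"
        using MS by order
      hence "real R powr (- (s * real (Suc n))) \<le> d * real R powr (- (s * real (Suc n)))"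
        using d by (subst (asm) ennreal_le_iff) auto
      thus False
        using d Rpos by (simp add: mult_le_cancel_right1)
    qed
    have "legal (Suc n) k'"
      unfolding legal_def
    proof (intro allI impI)
      fix n' m assume h: "n' < m" "m \<le> Suc n"
      show "(m, k' div R ^ (Suc n - m)) \<notin> Rem n' (k' div R ^ (Suc n - n'))"
      proof (cases "m = Suc n")
        case True
        with nS h show ?thesis
          by (auto simp: S_def)
      next
        case False
        with h have "m \<le> n" "n' \<le> n"
          by auto
        thus ?thesis
          using Pk h anc[of m] anc[of n'] by (auto simp: P_def legal_def)
      qed
    qed
    with MS k' show ?thesis
      by (auto simp: P_def)
  qed
  have P0: "P 0 0"
    by (auto simp: P_def S_def legal_def)
  obtain k where k: "\<And>n. P n (k n)" "\<And>n. k (Suc n) div R = k n"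
    using dependent_nat_choice[of P "\<lambda>n x y. y div R = x"] P0 step by blast
  note anc = ancestor_div[of k R, OF k(2)]
  show thesis
  proof (rule that)
    show "k 0 = 0"
      using k(1)[of 0] by (simp add: P_def)
    show "(m, k m) \<notin> Rem n (k n)" if "n < m" for n m
    proof -
      have "legal m (k m)"
        using k(1)[of m] by (simp add: P_def)
      with that have "(m, k m div R ^ (m - m)) \<notin> Rem n (k m div R ^ (m - n))"
        unfolding legal_def by blast
      thus ?thesis
        using anc[of n m] that by simp
    qed
  qed (use k(2) in auto)
qed

section \<open>Cells as intervals, and the cost of removing small sets\<close>

definition cell :: "real \<Rightarrow> real \<Rightarrow> nat \<Rightarrow> nat \<Rightarrow> nat \<Rightarrow> real set" where
  "cell a h R m v = {a + h * real v / real R ^ m .. a + h * (real v + 1) / real R ^ m}"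

lemma cell_subset:
  assumes R: "R \<ge> 1" and h: "h \<ge> 0" and "n \<le> m" and k: "v div R ^ (m - n) = k"
  shows "cell a h R m v \<subseteq> cell a h R n k"
proof -
  define t where "t = v mod R ^ (m - n)"
  have v: "v = k * R ^ (m - n) + t" and t: "t < R ^ (m - n)"
    using R unfolding t_def k [symmetric] by (simp_all add: div_mult_mod_eq)
  have pw: "real R ^ m = real R ^ n * real R ^ (m - n)"
    using \<open>n \<le> m\<close> by (simp flip: power_add)
  have "real v + 1 \<le> (real k + 1) * real R ^ (m - n)"
    using t unfolding v by (simp add: algebra_simps) (metis Suc_leI of_nat_Suc of_nat_le_iff of_nat_power add.commute)
  moreover have "real k * real R ^ (m - n) \<le> real v"
    unfolding v by simp
  moreover have "real k / real R ^ n = real k * real R ^ (m - n) / real R ^ m"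
    "(real k + 1) / real R ^ n = (real k + 1) * real R ^ (m - n) / real R ^ m"
    using R by (simp_all add: pw)
  ultimately have "real k / real R ^ n \<le> real v / real R ^ m" "(real v + 1) / real R ^ m \<le> (real k + 1) / real R ^ n"
    by (simp_all only: divide_right_mono of_nat_0_le_iff zero_le_power)
  from mult_left_mono[OF this(1) h] mult_left_mono[OF this(2) h] show ?thesis
    by (auto simp: cell_def)
qed

text \<open>Cells are closed, so a set as long as a cell can touch three consecutive ones, counted
  from the least index touched.\<close>

lemma card_cells_meeting:
  assumes h: "h > 0" and R: "R \<ge> 1"
    and E: "\<And>x y. x \<in> E \<Longrightarrow> y \<in> E \<Longrightarrow> \<bar>x - y\<bar> \<le> h / real R ^ m"
  shows "finite {v. cell a h R m v \<inter> E \<noteq> {}} \<and> card {v. cell a h R m v \<inter> E \<noteq> {}} \<le> 3"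
proof -
  define w where "w = h / real R ^ m"
  have w: "w > 0"
    using h R by (simp add: w_def)
  let ?V = "{v. cell a h R m v \<inter> E \<noteq> {}}"
  have cell: "cell a h R m v = {a + w * real v .. a + w * (real v + 1)}" for v
    by (simp add: cell_def w_def)
  show ?thesis
  proof (cases "?V = {}")
    case False
    define v0 where "v0 = (LEAST v. v \<in> ?V)"
    have v0: "v0 \<in> ?V"
      unfolding v0_def using False by (metis LeastI_ex ex_in_conv)
    then obtain x where x: "x \<in> E" "x \<le> a + w * (real v0 + 1)"
      by (auto simp: cell)
    have "?V \<subseteq> {v0 .. v0 + 2}"
    proof
      fix v assume v: "v \<in> ?V"
      then obtain y where y: "y \<in> E" "a + w * real v \<le> y"
        by (auto simp: cell)
      have "w * real v \<le> w * (real v0 + 2)"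
        using E[OF x(1) y(1)] x y unfolding w_def[symmetric] by (simp add: algebra_simps abs_le_iff)
      hence "real v \<le> real v0 + 2"
        using w by simp
      moreover have "v0 \<le> v"
        unfolding v0_def using v by (intro Least_le)
      ultimately show "v \<in> {v0 .. v0 + 2}"
        by simp
    qed
    from finite_subset[OF this] card_mono[OF _ this] show ?thesis
      by simp
  qed (metis card.empty finite.emptyI zero_le)
qed

text \<open>The common accounting device for tangential spots, transversal spots and pieces of a
  Hausdorff cover: each set no longer than a cell of level \<open>m\<close> costs at most three
  nodes.\<close>

lemma emeasure_cells_meeting:
  assumes "h > 0" "R \<ge> 1" "finite W"
    and E: "\<And>b x y. b \<in> W \<Longrightarrow> x \<in> E b \<Longrightarrow> y \<in> E b \<Longrightarrow> \<bar>x - y\<bar> \<le> h / real R ^ m"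
    and Z: "Z \<subseteq> {m} \<times> {v. cell a h R m v \<inter> (\<Union>b\<in>W. E b) \<noteq> {}}"
    and w: "real (card W) \<le> w"
  shows "emeasure (node_measure R s) Z \<le> ennreal (3 * w * real R powr (- (s * real m)))"
proof -
  let ?V = "\<lambda>b. {v. cell a h R m v \<inter> E b \<noteq> {}}"
  have V: "finite (?V b) \<and> card (?V b) \<le> 3" if "b \<in> W" for b
    using card_cells_meeting[of h R "E b" m a] assms that by auto
  have "card (\<Union>b\<in>W. ?V b) \<le> (\<Sum>b\<in>W. card (?V b))"
    by (rule card_UN_le[OF \<open>finite W\<close>])
  also have "\<dots> \<le> card W * 3"
    using V by (intro order_trans[OF sum_bounded_above[of W _ 3]]) auto
  finally have "real (card (\<Union>b\<in>W. ?V b)) \<le> 3 * real (card W)"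
    by linarith
  hence cd: "real (card (\<Union>b\<in>W. ?V b)) \<le> 3 * w"
    using w by linarith
  have "emeasure (node_measure R s) Z \<le> emeasure (node_measure R s) ({m} \<times> (\<Union>b\<in>W. ?V b))"
  proof (rule emeasure_mono)
    show "Z \<subseteq> {m} \<times> (\<Union>b\<in>W. ?V b)"
      using Z by (fastforce simp del: Int_UN_distrib)
  qed simp
  also have "\<dots> = ennreal (real (card (\<Union>b\<in>W. ?V b)) * real R powr (- (s * real m)))"
    by (rule emeasure_node_level) (use V \<open>finite W\<close> in auto)
  also have "\<dots> \<le> ennreal (3 * w * real R powr (- (s * real m)))"
    by (intro ennreal_leI mult_right_mono cd) auto
  finally show ?thesis .
qed

lemma hausdorff_measure_zero_cover:
  fixes A :: "'a::metric_space set"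
  assumes "hausdorff_measure s A = 0" "d > 0" "e > 0"
  obtains U :: "nat \<Rightarrow> 'a set" where "A \<subseteq> (\<Union>k. U k)" "\<And>k. bounded (U k)" "\<And>k. diameter (U k) \<le> d"
    "(\<Sum>k. ennreal (diameter (U k) powr s)) < ennreal e"
proof -
  have "hausdorff_content s d A \<le> hausdorff_measure s A"
    unfolding hausdorff_measure_def by (rule SUP_upper) (use assms in auto)
  hence "hausdorff_content s d A < ennreal e"
    using assms by simp
  thus thesis
    unfolding hausdorff_content_def INF_less_iff by (auto intro: that)
qed

section \<open>Lines and rational points\<close>

lemma attached_line:
  fixes q :: nat and p r :: int and i j :: real
  assumes "q \<ge> 1" "0 < i" "0 < j" "i + j = 1"
  obtains A B C :: int where "A \<noteq> 0 \<or> B \<noteq> 0" "\<bar>of_int A\<bar> \<le> real q powr i" "\<bar>of_int B\<bar> \<le> real q powr j"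
    "A * p + B * r + C * int q = 0"
proof -
  define X where "X = nat \<lfloor>real q powr i\<rfloor>"
  define Y where "Y = nat \<lfloor>real q powr j\<rfloor>"
  have X: "real X \<le> real q powr i" "real q powr i < real X + 1"
    and Y: "real Y \<le> real q powr j" "real q powr j < real Y + 1"
    by (auto simp: X_def Y_def)
  have "real q = real q powr i * real q powr j"
    using assms by (simp flip: powr_add)
  also have "\<dots> < (real X + 1) * (real Y + 1)"
    using X Y assms by (intro mult_strict_mono) auto
  finally have "real q < real ((X + 1) * (Y + 1))"
    by (simp add: algebra_simps)
  hence gt: "q < (X + 1) * (Y + 1)"
    using of_nat_less_iff by blast
  \<comment> \<open>More than \<open>q^i q^j = q\<close> coefficient pairs compete for
    \<open>q\<close> residues of \<open>A p + B r\<close>; the difference of two colliding pairs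
    gives the line.\<close>
  define S where "S = {0..int X} \<times> {0..int Y}"
  define F where "F z = (fst z * p + snd z * r) mod int q" for z
  have "card S = (X + 1) * (Y + 1)"
    by (simp add: S_def card_cartesian_product nat_add_distrib)
  moreover have "F ` S \<subseteq> {0..<int q}"
    using assms by (auto simp: F_def)
  hence "card (F ` S) \<le> q"
    using card_mono[of "{0..<int q}" "F ` S"] by simp
  ultimately have "\<not> inj_on F S"
    using gt by (metis card_image leD)
  then obtain z w where zw: "z \<in> S" "w \<in> S" "z \<noteq> w" "F z = F w"
    by (auto simp: inj_on_def)
  define A where "A = fst z - fst w"
  define B where "B = snd z - snd w"
  have "int q dvd A * p + B * r"
    using zw(4) unfolding F_def A_def B_def mod_eq_dvd_iff by (simp add: algebra_simps)
  then obtain C where C: "A * p + B * r = int q * C"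
    by (elim dvdE)
  have "\<bar>A\<bar> \<le> int X" "\<bar>B\<bar> \<le> int Y"
    using zw by (auto simp: A_def B_def S_def)
  hence "\<bar>real_of_int A\<bar> \<le> real X" "\<bar>real_of_int B\<bar> \<le> real Y"
    by linarith+
  moreover have "A \<noteq> 0 \<or> B \<noteq> 0"
    using zw(3) by (auto simp: A_def B_def prod_eq_iff)
  ultimately show thesis
    using X Y C by (intro that[of A B "-C"]) (auto simp: algebra_simps)
qed

text \<open>Dirichlet's theorem with a side congruence. The window for \<open>q x - p\<close> has
  length \<open>b = |B|\<close> instead of 1, which multiplies the number of candidates by
  \<open>b\<close> and pays for the \<open>b\<close> residue classes, at the price of the factor
  \<open>|B|\<close> in the error.\<close>

lemma dirichlet_congruence:
  fixes A B C :: int and N :: nat and x :: real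
  assumes "B \<noteq> 0" "N \<ge> 1"
  obtains q p :: int where "q \<noteq> 0 \<or> p \<noteq> 0" "\<bar>q\<bar> \<le> int N"
    "\<bar>of_int q * x - of_int p\<bar> < \<bar>of_int B\<bar> / real N" "B dvd A * p + C * q"
proof -
  define b where "b = nat \<bar>B\<bar>"
  have b: "b \<ge> 1" "int b = \<bar>B\<bar>"
    using assms by (auto simp: b_def)
  have rb: "real b = \<bar>real_of_int B\<bar>"
    using b(2) by (metis of_int_abs of_int_of_nat_eq)
  \<comment> \<open>for each \<open>q\<close>, the numbers \<open>q x - p\<close> take one value in each unit interval below \<open>b\<close>\<close>
  define P where "P z = \<lfloor>of_int (fst z) * x\<rfloor> - snd z" for z :: "int \<times> int"
  define u where "u z = of_int (fst z) * x - of_int (P z)" for z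
  define S where "S = {0..int N} \<times> {0..<int b}"
  define F where "F z = ((A * P z + C * fst z) mod int b, \<lfloor>u z * real N / real b\<rfloor>)" for z
  have u: "0 \<le> u z \<and> u z < real b" if "z \<in> S" for z
  proof -
    have "u z = frac (of_int (fst z) * x) + of_int (snd z)"
      by (simp add: u_def P_def frac_def)
    moreover have "0 \<le> snd z" "snd z \<le> int b - 1"
      using that by (auto simp: S_def)
    hence "0 \<le> real_of_int (snd z)" "real_of_int (snd z) \<le> real b - 1"
      by linarith+
    ultimately show ?thesis
      using frac_ge_0[of "of_int (fst z) * x"] frac_lt_1[of "of_int (fst z) * x"] by linarith
  qed
  have "F ` S \<subseteq> {0..<int b} \<times> {0..<int N}"
  proof
    fix y assume "y \<in> F ` S"
    then obtain z where z: "z \<in> S" "y = F z"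
      by auto
    have "u z * real N / real b < real N"
      using u[OF z(1)] b assms by (simp add: field_simps)
    moreover have "0 \<le> u z * real N / real b"
      using u[OF z(1)] by simp
    ultimately show "y \<in> {0..<int b} \<times> {0..<int N}"
      using z b by (auto simp: F_def floor_less_iff)
  qed
  hence "card (F ` S) \<le> card ({0..<int b} \<times> {0..<int N})"
    by (rule card_mono[rotated]) auto
  also have "\<dots> < card S"
    using b by (simp add: S_def card_cartesian_product nat_add_distrib)
  finally have "\<not> inj_on F S"
    by (metis card_image less_irrefl)
  then obtain z w where zw: "z \<in> S" "w \<in> S" "z \<noteq> w" "F z = F w"
    by (auto simp: inj_on_def)
  define q where "q = fst z - fst w"
  define p where "p = P z - P w"
  have "int b dvd A * p + C * q"
    using zw(4) unfolding F_def q_def p_def prod.inject mod_eq_dvd_iff by (simp add: algebra_simps)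
  hence "B dvd A * p + C * q"
    using b by simp
  moreover have "\<bar>q\<bar> \<le> int N"
    using zw by (auto simp: q_def S_def)
  moreover have "q \<noteq> 0 \<or> p \<noteq> 0"
    using zw(3) by (auto simp: q_def p_def P_def prod_eq_iff)
  moreover have "\<bar>of_int q * x - of_int p\<bar> < \<bar>of_int B\<bar> / real N"
  proof -
    have "\<lfloor>u z * real N / real b\<rfloor> = \<lfloor>u w * real N / real b\<rfloor>"
      using zw(4) by (simp add: F_def)
    hence "\<bar>u z * real N / real b - u w * real N / real b\<bar> < 1"
      by linarith
    also have "u z * real N / real b - u w * real N / real b = (u z - u w) * (real N / real b)"
      by (simp add: left_diff_distrib diff_divide_distrib)
    also have "u z - u w = of_int q * x - of_int p"
      by (simp add: u_def q_def p_def algebra_simps)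
    finally have "\<bar>of_int q * x - of_int p\<bar> * (real N / real b) < 1"
      by (simp add: abs_mult)
    thus ?thesis
      using b assms rb by (simp add: field_simps)
  qed
  ultimately show thesis
    using that by blast
qed

text \<open>A short integer line yields a short rational point: the congruence modulo \<open>B\<close> forces the point onto
  the line, so that only \<open>x\<close> has to be approximated.\<close>

lemma transference_aux:
  fixes A B C :: int and N :: nat and \<alpha> \<beta> x y H K c :: real
  assumes ab: "0 < \<alpha>" "0 < \<beta>" "\<alpha> + \<beta> = 1" and H: "H \<ge> 1" and K: "K \<ge> 1"
    and B: "\<bar>of_int B\<bar> = H powr \<beta>" and A: "\<bar>of_int A\<bar> \<le> H powr \<alpha>"
    and N: "K * H \<le> real N" "real N \<le> 2 * K * H"
    and Kc: "K powr - \<alpha> \<le> c / 2" "K powr - \<beta> \<le> c / 2"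
    and F: "\<bar>of_int A * x + of_int B * y + of_int C\<bar> * H \<le> c / (8 * K\<^sup>2)"
  obtains q :: nat and p r :: int where "1 \<le> q" "q \<le> N"
    "\<bar>real q * x - of_int p\<bar> \<le> c * real N powr - \<alpha>" "\<bar>real q * y - of_int r\<bar> \<le> c * real N powr - \<beta>"
proof -
  define F where "F = \<bar>of_int A * x + of_int B * y + of_int C\<bar>"
  have c0: "0 \<le> c"
    using Kc(1) powr_ge_zero[of K "- \<alpha>"] by linarith
  have HN: "H \<le> real N"
    using N H K mult_right_mono[of 1 K H] by linarith
  hence N1: "real N \<ge> 1" "N \<ge> 1"
    using H by linarith+
  have Hb: "H powr \<beta> \<ge> 1"
    using H ab by (simp add: ge_one_powr_ge_zero)
  hence "B \<noteq> 0"
    using B by auto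
  have ratio: "(H / real N) powr t \<le> K powr - t" if "t > 0" for t
  proof -
    have "H / real N \<le> 1 / K"
      using N H K N1 by (simp add: field_simps)
    hence "(H / real N) powr t \<le> (1 / K) powr t"
      using that H N1 by (intro powr_mono2) auto
    thus ?thesis
      using K by (simp add: powr_minus_divide powr_divide)
  qed
  have split: "H powr t / real N \<le> K powr - t * real N powr - (1 - t)" if "t > 0" for t
  proof -
    have "H powr t / real N = (H / real N) powr t * (real N powr t / real N)"
      using H N1 by (simp add: powr_divide)
    also have "real N powr t / real N = real N powr - (1 - t)"
      using N1 by (simp add: powr_diff)
    finally show ?thesis
      using ratio[OF that] by (simp add: mult_right_mono)
  qed
  obtain q p :: int where qp: "q \<noteq> 0 \<or> p \<noteq> 0" "\<bar>q\<bar> \<le> int N"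
      "\<bar>of_int q * x - of_int p\<bar> < \<bar>of_int B\<bar> / real N" "B dvd A * p + C * q"
    using dirichlet_congruence[OF \<open>B \<noteq> 0\<close> N1(2)] by metis
  \<comment> \<open>\<open>q = 0\<close> would leave a nonzero integer \<open>p\<close> with
    \<open>|p| < H^\<beta> / N \<le> 1\<close>.\<close>
  have "H powr \<beta> \<le> H powr 1"
    using H ab by (intro powr_mono) auto
  hence "H powr \<beta> / real N \<le> 1"
    using H HN N1 by (simp add: field_simps)
  hence "q \<noteq> 0"
    using qp(1,3) B by (cases "q = 0") auto
  obtain r where r: "A * p + C * q = B * r"
    using qp(4) by (elim dvdE)
  have xb: "\<bar>of_int q * x - of_int p\<bar> \<le> c * real N powr - \<alpha>"
  proof -
    have "\<bar>of_int q * x - of_int p\<bar> \<le> K powr - \<beta> * real N powr - (1 - \<beta>)"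
      using less_imp_le[OF qp(3)] split[OF ab(2)] unfolding B by (rule order_trans)
    also have "\<dots> \<le> c / 2 * real N powr - (1 - \<beta>)"
      by (rule mult_right_mono[OF Kc(2)]) auto
    also have "\<dots> \<le> c * real N powr - (1 - \<beta>)"
      by (rule mult_right_mono) (use c0 in auto)
    also have "1 - \<beta> = \<alpha>"
      using ab by simp
    finally show ?thesis .
  qed
  have yb: "\<bar>of_int q * y + of_int r\<bar> \<le> c * real N powr - \<beta>"
  proof -
    \<comment> \<open>The point \<open>(p/q, -r/q)\<close> lies on the line, so the error in
      \<open>y\<close> is controlled by \<open>F\<close> and the error in \<open>x\<close>.\<close>
    have "real_of_int A * of_int p + of_int C * of_int q = of_int B * of_int r"
      using r by (metis of_int_add of_int_mult)
    hence "of_int B * (of_int q * y + of_int r) =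
        of_int q * (of_int A * x + of_int B * y + of_int C) - of_int A * (of_int q * x - of_int p)"
      by (simp add: algebra_simps)
    hence "H powr \<beta> * \<bar>of_int q * y + of_int r\<bar> \<le>
        \<bar>of_int q\<bar> * F + \<bar>of_int A\<bar> * \<bar>of_int q * x - of_int p\<bar>"
      unfolding F_def B[symmetric] abs_mult[symmetric] by (simp add: abs_triangle_ineq4)
    also have "\<dots> \<le> real N * F + H powr \<alpha> * (H powr \<beta> / real N)"
    proof (intro add_mono mult_mono A)
      show "\<bar>real_of_int q\<bar> \<le> real N"
        using qp(2) by linarith
    qed (use qp(3) B in \<open>auto simp: F_def\<close>)
    also have "H powr \<alpha> * (H powr \<beta> / real N) = H powr \<beta> * (H powr \<alpha> / real N)"
      by simp
    finally have "H powr \<beta> * \<bar>of_int q * y + of_int r\<bar> \<le> H powr \<beta> * (real N * F / H powr \<beta> + H powr \<alpha> / real N)"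
      using Hb by (simp add: distrib_left)
    hence "\<bar>of_int q * y + of_int r\<bar> \<le> real N * F / H powr \<beta> + H powr \<alpha> / real N"
      using Hb by (subst (asm) mult_le_cancel_left_pos) auto
    also have "H powr \<alpha> / real N \<le> c / 2 * real N powr - \<beta>"
    proof -
      have "H powr \<alpha> / real N \<le> K powr - \<alpha> * real N powr - (1 - \<alpha>)"
        by (rule split[OF ab(1)])
      also have "\<dots> \<le> c / 2 * real N powr - (1 - \<alpha>)"
        by (rule mult_right_mono[OF Kc(1)]) auto
      also have "1 - \<alpha> = \<beta>"
        using ab by simp
      finally show ?thesis .
    qed
    \<comment> \<open>By \<open>N \<le> 2 K H\<close> this is at most
      \<open>4 K^2 F H N^-\<beta>\<close>, whence the \<open>8 K^2\<close> in the hypothesis on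
      \<open>F\<close>.\<close>
    also have "real N * F / H powr \<beta> \<le> c / 2 * real N powr - \<beta>"
    proof -
      have "real N / H \<le> 2 * K"
        using N H by (simp add: field_simps)
      hence "(real N / H) powr \<beta> \<le> (2 * K) powr \<beta>"
        using H ab by (intro powr_mono2) auto
      also have "\<dots> \<le> (2 * K) powr 1"
        using K ab by (intro powr_mono) auto
      finally have rb: "(real N / H) powr \<beta> \<le> 2 * K"
        using K by simp
      have "real N * F * (real N / H) powr \<beta> \<le> (2 * K * H) * F * (2 * K)"
        by (intro mult_mono N(2) rb) (use H K in \<open>auto simp: F_def\<close>)
      also have "\<dots> = 4 * K\<^sup>2 * (F * H)"
        by (simp add: power2_eq_square)
      also have "\<dots> \<le> 4 * K\<^sup>2 * (c / (8 * K\<^sup>2))"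
        by (rule mult_left_mono) (use F in \<open>auto simp: F_def\<close>)
      also have "\<dots> = c / 2"
        using K by simp
      finally have "real N * F * (real N powr \<beta> / H powr \<beta>) \<le> c / 2"
        using H by (simp add: powr_divide)
      thus ?thesis
        using N1 by (simp add: powr_minus field_simps)
    qed
    finally show ?thesis
      by simp
  qed
  show thesis
  proof (cases "q > 0")
    case True
    thus thesis
      using that[of "nat q" p "-r"] xb yb qp(2) by (auto simp: nat_le_iff)
  next
    case False
    hence "real (nat (-q)) = - of_int q"
      by simp
    moreover have "1 \<le> nat (- q)" "nat (- q) \<le> N"
      using False \<open>q \<noteq> 0\<close> qp(2) by auto
    ultimately show thesis
      using that[of "nat (-q)" "-p" r] xb yb by (simp add: abs_minus_commute algebra_simps)
  qed
qed

text \<open>\<open>H\<close> is the weighted height of the line, and \<open>N\<close> is about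
  \<open>K H\<close>. Whichever of \<open>A\<close>, \<open>B\<close> attains the height acts as
  leading coefficient in \<open>transference_aux\<close>, with weights and coordinates exchanged if
  necessary. The hypotheses on \<kappa> ensure \<open>N < Q\<close> and a value of the form small
  against \<open>1/H\<close>.\<close>

lemma transference:
  fixes A B C :: int and i j x y Q K c \<kappa> :: real
  assumes ij: "0 < i" "0 < j" "i + j = 1" and K: "K \<ge> 1"
    and Kc: "K powr - i \<le> c / 2" "K powr - j \<le> c / 2"
    and kap: "0 < \<kappa>" "2 * K * \<kappa> < 1" "\<kappa>\<^sup>2 \<le> c / (8 * K\<^sup>2)" and Q: "Q > 0"
    and nz: "A \<noteq> 0 \<or> B \<noteq> 0"
    and A: "\<bar>of_int A\<bar> \<le> \<kappa> * Q powr i" and B: "\<bar>of_int B\<bar> \<le> \<kappa> * Q powr j"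
    and F: "\<bar>of_int A * x + of_int B * y + of_int C\<bar> \<le> \<kappa> / Q"
  obtains q :: nat and p r :: int where "1 \<le> q" "real q < Q"
    "\<bar>real q * x - of_int p\<bar> \<le> c * real q powr - i" "\<bar>real q * y - of_int r\<bar> \<le> c * real q powr - j"
proof -
  define H where "H = max (\<bar>real_of_int A\<bar> powr (1 / i)) (\<bar>real_of_int B\<bar> powr (1 / j))"
  have kap1: "\<kappa> \<le> 1"
    using kap K mult_right_mono[of 1 "2 * K" \<kappa>] by linarith
  have root: "\<bar>real_of_int X\<bar> powr (1 / t) \<le> \<kappa> * Q" if "\<bar>real_of_int X\<bar> \<le> \<kappa> * Q powr t" "0 < t" "t < 1" for X t
  proof -
    have "\<bar>real_of_int X\<bar> powr (1 / t) \<le> (\<kappa> * Q powr t) powr (1 / t)"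
      using that by (intro powr_mono2) auto
    also have "\<dots> = \<kappa> powr (1 / t) * Q"
      using that kap Q by (simp add: powr_mult powr_powr)
    also have "\<kappa> powr (1 / t) \<le> \<kappa> powr 1"
      using that kap kap1 by (intro powr_mono') auto
    finally show ?thesis
      using kap Q by (simp add: mult_right_mono)
  qed
  have HQ: "H \<le> \<kappa> * Q"
    unfolding H_def using root[OF A] root[OF B] ij by simp
  have ge1: "\<bar>real_of_int X\<bar> powr (1 / t) \<ge> 1" if "X \<noteq> 0" "0 < t" for X t
    using that by (intro ge_one_powr_ge_zero) auto
  have H1: "H \<ge> 1"
    using nz ge1[of A i] ge1[of B j] ij unfolding H_def by linarith
  have unroot: "\<bar>real_of_int X\<bar> = (\<bar>real_of_int X\<bar> powr (1 / t)) powr t" if "0 < t" for X t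
    using that by (simp add: powr_powr)
  have AH: "\<bar>real_of_int A\<bar> \<le> H powr i" and BH: "\<bar>real_of_int B\<bar> \<le> H powr j"
    using ij unfolding H_def by (subst unroot; force intro: powr_mono2)+
  define N where "N = nat \<lceil>K * H\<rceil>"
  have KH: "K * H \<ge> 1"
    using K H1 mult_mono[of 1 K 1 H] by simp
  have N: "K * H \<le> real N" "real N \<le> 2 * K * H"
    unfolding N_def using KH by linarith+
  have "2 * K * H \<le> 2 * K * (\<kappa> * Q)"
    using HQ K by (intro mult_left_mono) auto
  also have "\<dots> < Q"
    using kap Q mult_strict_right_mono[of "2 * K * \<kappa>" 1 Q] by (simp add: mult.assoc)
  finally have NQ: "real N < Q"
    using N by linarith
  have "\<bar>of_int A * x + of_int B * y + of_int C\<bar> * H \<le> \<kappa> / Q * (\<kappa> * Q)"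
    by (intro mult_mono F HQ) (use H1 kap Q in auto)
  also have "\<dots> = \<kappa>\<^sup>2"
    using Q by (simp add: power2_eq_square)
  finally have FH: "\<bar>of_int A * x + of_int B * y + of_int C\<bar> * H \<le> c / (8 * K\<^sup>2)"
    using kap by linarith
  have "0 \<le> c"
    using Kc(1) powr_ge_zero[of K "- i"] by linarith
  note thesisI = that
  have fin: thesis if q: "1 \<le> q" "q \<le> N" "\<bar>real q * x - of_int p\<bar> \<le> c * real N powr - i"
      "\<bar>real q * y - of_int r\<bar> \<le> c * real N powr - j" for q p r
  proof (rule thesisI)
    have mono: "c * real N powr - t \<le> c * real q powr - t" if "t > 0" for t
      using q that \<open>0 \<le> c\<close> by (intro mult_left_mono powr_mono2') auto
    show "1 \<le> q" "real q < Q"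
      using q NQ by auto
    show "\<bar>real q * x - of_int p\<bar> \<le> c * real q powr - i" "\<bar>real q * y - of_int r\<bar> \<le> c * real q powr - j"
      using q mono[OF ij(1)] mono[OF ij(2)] by linarith+
  qed
  consider "\<bar>real_of_int B\<bar> = H powr j" | "\<bar>real_of_int A\<bar> = H powr i"
    using unroot[OF ij(1), of A] unroot[OF ij(2), of B] unfolding H_def by (metis max_def)
  thus thesis
  proof cases
    case 1
    show thesis
      by (rule transference_aux[OF ij H1 K 1 AH N Kc FH]) (rule fin)
  next
    case 2
    have FH': "\<bar>of_int B * y + of_int A * x + of_int C\<bar> * H \<le> c / (8 * K\<^sup>2)"
      using FH by (simp add: add.commute)
    have ji: "j + i = 1"
      using ij by simp
    show thesis
      by (rule transference_aux[OF ij(2,1) ji H1 K 2 BH N Kc(2,1) FH']) (rule fin)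
  qed
qed

text \<open>In homogeneous coordinates the common point is the cross product of two lines of
  different direction; if there are none, all lines are parallel and it is the point at infinity of
  that direction.\<close>

lemma concurrent_lines:
  fixes S :: "(int \<times> int \<times> int) set"
  assumes det: "\<And>A1 B1 C1 A2 B2 C2 A3 B3 C3. (A1, B1, C1) \<in> S \<Longrightarrow> (A2, B2, C2) \<in> S \<Longrightarrow> (A3, B3, C3) \<in> S \<Longrightarrow>
      A1 * (B2 * C3 - B3 * C2) - B1 * (A2 * C3 - A3 * C2) + C1 * (A2 * B3 - A3 * B2) = 0"
    and B: "\<And>A B C. (A, B, C) \<in> S \<Longrightarrow> B \<noteq> 0"
  obtains v1 v2 v3 :: real where "v1 \<noteq> 0 \<or> v2 \<noteq> 0 \<or> v3 \<noteq> 0"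
    "\<And>A B C. (A, B, C) \<in> S \<Longrightarrow> of_int A * v1 + of_int B * v2 + of_int C * v3 = 0"
proof (cases "\<exists>A1 B1 C1 A2 B2 C2. (A1, B1, C1) \<in> S \<and> (A2, B2, C2) \<in> S \<and> A1 * B2 - A2 * B1 \<noteq> 0")
  case True
  then obtain A1 B1 C1 A2 B2 C2 where S: "(A1, B1, C1) \<in> S" "(A2, B2, C2) \<in> S" and nz: "A1 * B2 - A2 * B1 \<noteq> 0"
    by blast
  show thesis
  proof (rule that)
    show "real_of_int (B1 * C2 - B2 * C1) \<noteq> 0 \<or> real_of_int (A2 * C1 - A1 * C2) \<noteq> 0 \<or> real_of_int (A1 * B2 - A2 * B1) \<noteq> 0"
      using nz by linarith
    fix A B C assume "(A, B, C) \<in> S"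
    from det[OF this S] have "A * (B1 * C2 - B2 * C1) + B * (A2 * C1 - A1 * C2) + C * (A1 * B2 - A2 * B1) = 0"
      by (simp add: algebra_simps)
    hence "real_of_int (A * (B1 * C2 - B2 * C1) + B * (A2 * C1 - A1 * C2) + C * (A1 * B2 - A2 * B1)) = 0"
      by simp
    thus "of_int A * real_of_int (B1 * C2 - B2 * C1) + of_int B * real_of_int (A2 * C1 - A1 * C2)
        + of_int C * real_of_int (A1 * B2 - A2 * B1) = 0"
      by (simp only: of_int_add of_int_mult)
  qed
next
  case False
  show thesis
  proof (cases "S = {}")
    case True
    thus thesis using that[of 1 0 0] by simp
  next
    case ne: False
    then obtain A1 B1 C1 where S1: "(A1, B1, C1) \<in> S"
      by auto
    show thesis
    proof (rule that)
      show "real_of_int B1 \<noteq> 0 \<or> - real_of_int A1 \<noteq> 0 \<or> (0::real) \<noteq> 0"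
        using B[OF S1] by simp
      fix A B C assume "(A, B, C) \<in> S"
      with False S1 have "A * B1 - A1 * B = 0"
        by metis
      hence "real_of_int (A * B1 - A1 * B) = 0"
        by simp
      thus "of_int A * real_of_int B1 + of_int B * - real_of_int A1 + of_int C * 0 = 0"
        by (simp add: algebra_simps)
    qed
  qed
qed

lemma card_floor_range: "real (card {\<lfloor>- Y\<rfloor>..\<lfloor>Y\<rfloor>}) \<le> 4 * Y" if "1 \<le> Y" for Y :: real
proof -
  have "real_of_int \<lfloor>Y\<rfloor> \<le> Y" "- Y - 1 \<le> real_of_int \<lfloor>- Y\<rfloor>"
    by linarith+
  hence "real_of_int (\<lfloor>Y\<rfloor> + 1 - \<lfloor>- Y\<rfloor>) \<le> 4 * Y"
    unfolding of_int_diff of_int_add of_int_1 using that by linarith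
  moreover have "0 \<le> \<lfloor>Y\<rfloor> + 1 - \<lfloor>- Y\<rfloor>"
    using that by linarith
  ultimately show ?thesis
    by simp
qed

lemma geometric_ennreal:
  assumes "0 \<le> c"
  shows "(\<Sum>t. ennreal (c * (1 / 2) ^ t)) = ennreal (2 * c)"
proof -
  have "(\<lambda>t. c * (1 / 2) ^ t) sums (c * (1 / (1 - 1 / 2)))"
    by (intro sums_mult geometric_sums) auto
  hence "(\<lambda>t. c * (1 / 2) ^ t) sums (2 * c)"
    by (simp add: mult.commute)
  thus ?thesis
    using assms by (intro sums_unique[symmetric] sums_ennreal[THEN iffD2]) auto
qed

section \<open>Dangerous lines on a short arc\<close>

text \<open>All scales are powers of \<open>e = 1 / R\<close>: the arc has length \<open>e^2\<close>, cells of level \<open>m\<close> have length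
  \<open>e^(m + 2)\<close>, the constant of \<open>Bad\<close> is (up to a power) \<open>e^24\<close>, and a line counts as tangential when its
  slope against the curve is below \<open>e^4\<close>. The number \<open>M\<close> is such that the transference principle loses
  at most a factor \<open>R^M\<close>.\<close>

locale short_arc =
  fixes i j s K g a :: real and R M :: nat and f f1 f2 :: "real \<Rightarrow> real"
  assumes ij: "0 < i" "i \<le> j" "i + j = 1"
    and s: "5 / 6 \<le> s"
    and R512: "512 \<le> R" and Kg: "100 * K \<le> g * real R" "0 < g" "g \<le> 1" "1 \<le> K"
    and Rs: "2 * real R powr s \<le> real R"
    and RM: "4 * (3 * (18 * real M + 390) + 18) \<le> real R powr (5 / 6)"
    and M: "25 \<le> i * real M"
    and f1: "\<And>x. x \<in> {a..a + 1 / real R ^ 2} \<Longrightarrow> (f has_real_derivative f1 x) (at x)"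
    and f2: "\<And>x. x \<in> {a..a + 1 / real R ^ 2} \<Longrightarrow> (f1 has_real_derivative f2 x) (at x)"
    and f1_bounds: "\<And>x. x \<in> {a..a + 1 / real R ^ 2} \<Longrightarrow> g \<le> \<bar>f1 x\<bar> \<and> \<bar>f1 x\<bar> \<le> K"
    and f2_bounds: "\<And>x. x \<in> {a..a + 1 / real R ^ 2} \<Longrightarrow> g \<le> \<bar>f2 x\<bar> \<and> \<bar>f2 x\<bar> \<le> K"
begin

definition e :: real where "e = 1 / real R"

definition I0 :: "real set" where "I0 = {a..a + e ^ 2}"

definition lin :: "int \<Rightarrow> int \<Rightarrow> int \<Rightarrow> real \<Rightarrow> real" where
  "lin A B C x = of_int A * x + of_int B * f x + of_int C"

definition slope :: "int \<Rightarrow> int \<Rightarrow> real \<Rightarrow> real" where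
  "slope A B x = of_int A + of_int B * f1 x"

definition near :: "real \<Rightarrow> nat \<Rightarrow> int \<Rightarrow> int \<Rightarrow> bool" where
  "near x q p t \<longleftrightarrow> x \<in> I0 \<and> 1 \<le> q \<and> \<bar>real q * x - of_int p\<bar> \<le> e ^ 24 * real q powr - i
     \<and> \<bar>real q * f x - of_int t\<bar> \<le> e ^ 24 * real q powr - j"

definition attached :: "real \<Rightarrow> nat \<Rightarrow> int \<Rightarrow> int \<Rightarrow> int \<Rightarrow> int \<Rightarrow> int \<Rightarrow> bool" where
  "attached x q p t A B C \<longleftrightarrow> near x q p t \<and> (A \<noteq> 0 \<or> B \<noteq> 0) \<and> \<bar>of_int A\<bar> \<le> real q powr i
     \<and> \<bar>of_int B\<bar> \<le> real q powr j \<and> A * p + B * t + C * int q = 0"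

text \<open>The last two conditions say that \<open>|B|\<close> lies in
  \<open>[R^n, R^(n+1))\<close>. Over a length \<open>e^(n+2)\<close> the slope then varies by less
  than \<open>K e\<close>, so the line stays almost parallel to the curve.\<close>

definition tangential :: "nat \<Rightarrow> real set" where
  "tangential n = {x. \<exists>q p t A B C. attached x q p t A B C \<and> \<bar>slope A B x\<bar> < e ^ 4
     \<and> 1 \<le> \<bar>of_int B\<bar> * e ^ n \<and> \<bar>of_int B\<bar> * e ^ Suc n < 1}"

text \<open>The level \<open>m\<close> is determined by \<open>q\<close> times the slope, and \<open>l\<close> by how far the slope is below its
  largest possible order \<open>q^j\<close>.\<close>

definition transversal :: "nat \<Rightarrow> nat \<Rightarrow> real \<Rightarrow> nat \<Rightarrow> int \<Rightarrow> int \<Rightarrow> int \<Rightarrow> int \<Rightarrow> int \<Rightarrow> bool" where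
  "transversal m l x q p t A B C \<longleftrightarrow> attached x q p t A B C \<and> e ^ 4 \<le> \<bar>slope A B x\<bar>
     \<and> e ^ 14 \<le> real q * \<bar>slope A B x\<bar> * e ^ m \<and> real q * \<bar>slope A B x\<bar> * e ^ Suc m < e ^ 14
     \<and> e * \<bar>slope A B x\<bar> \<le> real q powr j * e ^ l \<and> real q powr j * e ^ l < \<bar>slope A B x\<bar>"

section \<open>Elementary estimates on the arc\<close>

lemma e_pos: "0 < e" and e_le: "e \<le> 1 / 512" and e_R: "real R * e = 1"
  using R512 by (auto simp: e_def)

lemma e_pow_pos [simp]: "0 < e ^ n"
  using e_pos by simp

lemma e_nonneg [simp]: "0 \<le> e"
  using e_pos by simp

lemma e_pow_mono: "m \<le> n \<Longrightarrow> e ^ n \<le> e ^ m"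
  using e_pos e_le by (intro power_decreasing) auto

lemma e_pow_le: "e ^ Suc n \<le> e ^ n / 512"
  using mult_right_mono[OF e_le, of "e ^ n"] e_pos by simp

lemma K_e: "K * e \<le> g / 100" "K * e \<le> 1 / 100"
proof -
  have "100 * K * e \<le> g * real R * e"
    using Kg e_pos by (intro mult_right_mono) auto
  thus "K * e \<le> g / 100"
    using e_R by (simp add: mult.assoc)
  thus "K * e \<le> 1 / 100"
    using Kg by linarith
qed

lemma g_e: "100 * e \<le> g"
proof -
  have "1 * e \<le> K * e"
    using Kg by (intro mult_right_mono) auto
  thus ?thesis
    using K_e(1) by linarith
qed

lemma j_lt: "j < 1" "0 < j" "i < 1" "i \<le> 1 / 2"
  using ij by auto

lemma I0_eq: "I0 = {a..a + 1 / real R ^ 2}"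
  by (simp add: I0_def e_def power_one_over)

lemma between_I0: "x \<in> I0 \<Longrightarrow> y \<in> I0 \<Longrightarrow> min x y \<le> z \<Longrightarrow> z \<le> max x y \<Longrightarrow> z \<in> I0"
  by (auto simp: I0_def min_def max_def split: if_splits)

lemma mean_value:
  assumes "x \<in> I0" "y \<in> I0" and h: "\<And>z. z \<in> I0 \<Longrightarrow> (h has_real_derivative h' z) (at z)"
  obtains z where "min x y \<le> z" "z \<le> max x y" "z \<in> I0" "h x - h y = h' z * (x - y)"
proof -
  consider "x = y" | "x < y" | "y < x"
    by linarith
  thus thesis
  proof cases
    case 1
    thus thesis using that[of x] assms by auto
  next
    case 2
    obtain z where z: "x < z" "z < y" "h y - h x = (y - x) * h' z"
      using MVT2[OF 2, of h h'] h assms between_I0 2 by (metis max.absorb2 min.absorb1 less_imp_le)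
    thus thesis
      using that[of z] 2 between_I0[OF assms(1,2), of z] by (auto simp: algebra_simps)
  next
    case 3
    obtain z where z: "y < z" "z < x" "h x - h y = (x - y) * h' z"
      using MVT2[OF 3, of h h'] h assms between_I0 3 by (metis max.absorb1 min.absorb2 less_imp_le)
    thus thesis
      using that[of z] 3 between_I0[OF assms(1,2), of z] by (auto simp: algebra_simps)
  qed
qed

lemma lin_deriv: "x \<in> I0 \<Longrightarrow> (lin A B C has_real_derivative slope A B x) (at x)"
  unfolding lin_def slope_def using f1[of x]
  by (auto intro!: derivative_eq_intros simp: I0_eq)

lemma slope_diff:
  assumes "x \<in> I0" "y \<in> I0"
  shows "\<bar>slope A B x - slope A B y\<bar> \<le> K * \<bar>of_int B\<bar> * \<bar>x - y\<bar>"
proof -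
  obtain z where z: "z \<in> I0" "f1 x - f1 y = f2 z * (x - y)"
    using mean_value[OF assms, of f1 f2] f2 unfolding I0_eq by metis
  have "slope A B x - slope A B y = of_int B * (f2 z * (x - y))"
    unfolding z(2)[symmetric] slope_def by (simp add: algebra_simps)
  hence "\<bar>slope A B x - slope A B y\<bar> = \<bar>f2 z\<bar> * (\<bar>of_int B\<bar> * \<bar>x - y\<bar>)"
    by (simp add: abs_mult)
  also have "\<dots> \<le> K * (\<bar>of_int B\<bar> * \<bar>x - y\<bar>)"
    using f2_bounds[of z] z(1) by (intro mult_right_mono) (auto simp: I0_eq)
  finally show ?thesis
    by (simp add: mult.assoc)
qed

lemma slope_comparable:
  assumes "x \<in> I0" "y \<in> I0" "\<bar>x - y\<bar> \<le> h" "K * \<bar>of_int B\<bar> * h \<le> \<bar>slope A B x\<bar> / 8"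
  shows "7 / 8 * \<bar>slope A B x\<bar> \<le> \<bar>slope A B y\<bar>" "\<bar>slope A B y\<bar> \<le> 9 / 8 * \<bar>slope A B x\<bar>"
proof -
  have "K * \<bar>of_int B\<bar> * \<bar>x - y\<bar> \<le> K * \<bar>of_int B\<bar> * h"
    using assms Kg by (intro mult_left_mono) auto
  with slope_diff[OF assms(1,2), of A B] assms(4)
  have "\<bar>slope A B x - slope A B y\<bar> \<le> \<bar>slope A B x\<bar> / 8"
    by linarith
  thus "7 / 8 * \<bar>slope A B x\<bar> \<le> \<bar>slope A B y\<bar>" "\<bar>slope A B y\<bar> \<le> 9 / 8 * \<bar>slope A B x\<bar>"
    by linarith+
qed

text \<open>Where the slope varies by at most an eighth, \<open>lin\<close> is bi-Lipschitz with
  constant about \<open>|slope A B x|\<close>; the lower bound turns two small values into a small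
  distance.\<close>

lemma lin_separation:
  assumes I: "x \<in> I0" "x1 \<in> I0" "x2 \<in> I0" and h: "\<bar>x - x1\<bar> \<le> h" "\<bar>x - x2\<bar> \<le> h"
    and B: "K * \<bar>of_int B\<bar> * h \<le> \<bar>slope A B x\<bar> / 8"
  shows "7 / 8 * \<bar>slope A B x\<bar> * \<bar>x1 - x2\<bar> \<le> \<bar>lin A B C x1\<bar> + \<bar>lin A B C x2\<bar>"
    and "\<bar>lin A B C x1 - lin A B C x2\<bar> \<le> 9 / 8 * \<bar>slope A B x\<bar> * \<bar>x1 - x2\<bar>"
proof -
  obtain z where z: "min x1 x2 \<le> z" "z \<le> max x1 x2" "z \<in> I0"
      "lin A B C x1 - lin A B C x2 = slope A B z * (x1 - x2)"
    using mean_value[OF I(2,3) lin_deriv, of A B C] by metis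
  have "\<bar>x - z\<bar> \<le> h"
    using h z by (auto simp: min_def max_def split: if_splits)
  note sl = slope_comparable[OF I(1) z(3) this B]
  have eq: "\<bar>lin A B C x1 - lin A B C x2\<bar> = \<bar>slope A B z\<bar> * \<bar>x1 - x2\<bar>"
    by (simp add: z(4) abs_mult)
  show "7 / 8 * \<bar>slope A B x\<bar> * \<bar>x1 - x2\<bar> \<le> \<bar>lin A B C x1\<bar> + \<bar>lin A B C x2\<bar>"
    using mult_right_mono[OF sl(1), of "\<bar>x1 - x2\<bar>"] eq by linarith
  show "\<bar>lin A B C x1 - lin A B C x2\<bar> \<le> 9 / 8 * \<bar>slope A B x\<bar> * \<bar>x1 - x2\<bar>"
    using mult_right_mono[OF sl(2), of "\<bar>x1 - x2\<bar>"] eq by linarith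
qed

lemma lin_at_point:
  assumes "A * p + B * t + C * int q = 0"
  shows "real q * lin A B C x = of_int A * (real q * x - of_int p) + of_int B * (real q * f x - of_int t)"
proof -
  have "real_of_int A * of_int p + of_int B * of_int t + of_int C * real q = 0"
    using arg_cong[OF assms, of real_of_int] by simp
  thus ?thesis
    by (simp add: lin_def algebra_simps)
qed

lemma attachedD:
  assumes "attached x q p t A B C"
  shows "x \<in> I0" "1 \<le> real q" "real q > 0" "\<bar>of_int A\<bar> \<le> real q powr i" "\<bar>of_int B\<bar> \<le> real q powr j"
    "real q powr i \<le> real q powr j" "real q powr j \<le> real q" "real q powr i * real q powr j = real q"
    "real q * \<bar>lin A B C x\<bar> \<le> 2 * e ^ 24"
proof -
  have n: "near x q p t" and q: "1 \<le> real q" and AB: "\<bar>of_int A\<bar> \<le> real q powr i" "\<bar>of_int B\<bar> \<le> real q powr j"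
    using assms by (auto simp: attached_def near_def)
  show "x \<in> I0" "1 \<le> real q" "real q > 0" "\<bar>of_int A\<bar> \<le> real q powr i" "\<bar>of_int B\<bar> \<le> real q powr j"
    using n q AB by (auto simp: near_def)
  show "real q powr i \<le> real q powr j"
    using q ij by (intro powr_mono) auto
  show "real q powr j \<le> real q"
    using powr_mono[of j 1 "real q"] q j_lt by simp
  show "real q powr i * real q powr j = real q"
    using q ij by (simp flip: powr_add)
  have "real q * \<bar>lin A B C x\<bar> = \<bar>real q * lin A B C x\<bar>"
    by (simp add: abs_mult)
  also have "\<dots> \<le> \<bar>of_int A\<bar> * \<bar>real q * x - of_int p\<bar> + \<bar>of_int B\<bar> * \<bar>real q * f x - of_int t\<bar>"
    unfolding lin_at_point[of A p B t C q x, OF assms[unfolded attached_def, THEN conjunct2, THEN conjunct2, THEN conjunct2, THEN conjunct2]]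
    by (metis abs_mult abs_triangle_ineq)
  also have "\<dots> \<le> real q powr i * (e ^ 24 * real q powr - i) + real q powr j * (e ^ 24 * real q powr - j)"
    using n AB by (intro add_mono mult_mono) (auto simp: near_def)
  also have "\<dots> = 2 * e ^ 24"
    using q by (simp add: powr_minus field_simps)
  finally show "real q * \<bar>lin A B C x\<bar> \<le> 2 * e ^ 24" .
qed

section \<open>Transversal lines seen from one level up\<close>

lemma transversalD:
  assumes "transversal m l x q p t A B C"
  shows "attached x q p t A B C" "e ^ 4 \<le> \<bar>slope A B x\<bar>" "0 < \<bar>slope A B x\<bar>"
    "e ^ 14 \<le> real q * \<bar>slope A B x\<bar> * e ^ m" "real q * \<bar>slope A B x\<bar> * e ^ Suc m < e ^ 14"
    "e * \<bar>slope A B x\<bar> \<le> real q powr j * e ^ l" "real q powr j * e ^ l < \<bar>slope A B x\<bar>"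
  using assms less_le_trans[OF e_pow_pos[of 4]] by (auto simp: transversal_def)

text \<open>The pair \<open>(m, l)\<close> determines \<open>q^(1+j)\<close> up to a factor
  \<open>R^2\<close>: it fixes \<open>q \<mu>\<close> up to a factor \<open>R\<close>, and \<mu>
  against \<open>q^j\<close> up to another.\<close>

lemma transversal_ratio:
  assumes 1: "transversal m l x1 q1 p1 t1 A1 B1 C1" and 2: "transversal m l x2 q2 p2 t2 A2 B2 C2"
  shows "real q2 * e ^ 2 \<le> real q1"
proof (rule ccontr)
  note d1 = transversalD[OF 1] and d2 = transversalD[OF 2]
  note a1 = attachedD[OF d1(1)] and a2 = attachedD[OF d2(1)]
  define P where "P = e ^ l * e ^ m"
  have P: "P > 0"
    by (simp add: P_def)
  assume "\<not> ?thesis"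
  hence lt: "real q1 < real q2 * e ^ 2"
    by simp
  also have "\<dots> \<le> real q2"
    using e_pow_mono[of 0 2] by (simp add: mult_left_le)
  finally have "real q1 powr j \<le> real q2 powr j"
    using j_lt by (intro powr_mono2) auto
  hence "real q1 * real q1 powr j \<le> (real q2 * e ^ 2) * real q2 powr j"
    using lt by (intro mult_mono) auto
  hence "real q1 * real q1 powr j * P \<le> (real q2 * e ^ 2) * real q2 powr j * P"
    using P by (intro mult_right_mono) auto
  also have "\<dots> = e * (real q2 * (real q2 powr j * e ^ l) * e ^ Suc m)"
    by (simp add: P_def power2_eq_square)
  also have "\<dots> \<le> e * (real q2 * \<bar>slope A2 B2 x2\<bar> * e ^ Suc m)"
    using d2(7) e_pos by (intro mult_left_mono mult_right_mono) auto
  also have "\<dots> < e * e ^ 14"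
    using d2(5) e_pos by simp
  also have "\<dots> \<le> e * (real q1 * \<bar>slope A1 B1 x1\<bar> * e ^ m)"
    using d1(4) e_pos by (intro mult_left_mono) auto
  also have "\<dots> = real q1 * (e * \<bar>slope A1 B1 x1\<bar>) * e ^ m"
    by simp
  also have "\<dots> \<le> real q1 * (real q1 powr j * e ^ l) * e ^ m"
    using d1(6) e_pos by (intro mult_left_mono mult_right_mono) auto
  also have "\<dots> = real q1 * real q1 powr j * P"
    by (simp add: P_def)
  finally show False
    by simp
qed

lemma powr_ratio:
  assumes "x * e ^ 2 \<le> y" "0 < x" "0 < y" "0 < t" "t \<le> 1"
  shows "x powr t * y powr - t * e ^ 2 \<le> 1"
proof -
  have "e ^ 2 \<le> (e ^ 2) powr t"
    using powr_mono'[of t 1 "e ^ 2"] assms e_pow_mono[of 0 2] e_pos by simp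
  hence "x powr t * e ^ 2 \<le> x powr t * (e ^ 2) powr t"
    by (intro mult_left_mono) auto
  also have "\<dots> = (x * e ^ 2) powr t"
    using assms e_pos by (simp add: powr_mult)
  also have "\<dots> \<le> y powr t"
    using assms e_pos by (intro powr_mono2) auto
  finally show ?thesis
    using assms by (simp add: powr_minus field_simps)
qed

text \<open>The rational point of \<open>x2\<close> lies on the line of \<open>x1\<close>, because an integer of absolute value
  less than \<open>1\<close> vanishes.\<close>

lemma transversal_close:
  assumes 1: "transversal m l x1 q1 p1 t1 A1 B1 C1" and 2: "transversal m l x2 q2 p2 t2 A2 B2 C2"
    and h: "\<bar>x1 - x2\<bar> \<le> e ^ Suc m"
  shows "\<bar>x1 - x2\<bar> \<le> e ^ (m + 2)"
proof -
  note d1 = transversalD[OF 1] and d2 = transversalD[OF 2]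
  note a1 = attachedD[OF d1(1)] and a2 = attachedD[OF d2(1)]
  define \<mu> where "\<mu> = \<bar>slope A1 B1 x1\<bar>"
  have mu: "0 < \<mu>" "e ^ 4 \<le> \<mu>" "real q1 * \<mu> * e ^ Suc m < e ^ 14" "e ^ 14 \<le> real q1 * \<mu> * e ^ m"
    using d1 by (auto simp: \<mu>_def)
  have r21: "real q2 * e ^ 2 \<le> real q1" and r12: "real q1 * e ^ 2 \<le> real q2"
    using transversal_ratio 1 2 by blast+
  \<comment> \<open>After multiplication by \<mu>, \<open>|B| \<le> q\<close> and
    \<open>q \<mu> e^(m+1) < e^14\<close> leave \<open>K e^14\<close>, which is far below
    \<open>e^8 \<le> \<mu>^2\<close>.\<close>
  have hK: "K * \<bar>of_int B1\<bar> * e ^ Suc m \<le> \<mu> / 8"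
  proof -
    have "K * \<bar>of_int B1\<bar> * e ^ Suc m * \<mu> \<le> K * real q1 * e ^ Suc m * \<mu>"
      using a1(5,7) Kg mu(1) e_pos by (intro mult_right_mono mult_left_mono) auto
    also have "\<dots> = K * (real q1 * \<mu> * e ^ Suc m)"
      by simp
    also have "\<dots> \<le> K * e ^ 14"
      using mu(3) Kg by (intro mult_left_mono) auto
    also have "\<dots> = K * e * e ^ 13"
      by (simp add: power_numeral_reduce)
    also have "\<dots> \<le> 1 / 100 * e ^ 8"
      using K_e e_pow_mono[of 8 13] e_pos by (intro mult_mono) auto
    also have "\<dots> = 1 / 100 * (e ^ 4 * e ^ 4)"
      by (simp flip: power_add)
    also have "\<dots> \<le> 1 / 100 * (\<mu> * \<mu>)"
      using mu(1,2) by (intro mult_mono mult_left_mono) auto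
    also have "\<dots> \<le> \<mu> / 8 * \<mu>"
      using mu by simp
    finally show ?thesis
      using mu by (subst (asm) mult_le_cancel_right_pos) auto
  qed
  note sep = lin_separation[OF a1(1) a1(1) a2(1), of "e ^ Suc m" B1 A1 C1, folded \<mu>_def, OF _ h hK]
  have sep1: "7 / 8 * \<mu> * \<bar>x1 - x2\<bar> \<le> \<bar>lin A1 B1 C1 x1\<bar> + \<bar>lin A1 B1 C1 x2\<bar>"
    and sep2: "\<bar>lin A1 B1 C1 x1 - lin A1 B1 C1 x2\<bar> \<le> 9 / 8 * \<mu> * \<bar>x1 - x2\<bar>"
    using sep by auto
  have l2: "real q2 * \<bar>lin A1 B1 C1 x2\<bar> * e ^ 2 \<le> 2 * e ^ 24 + 9 / 8 * e ^ 14"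
  proof -
    have "\<bar>lin A1 B1 C1 x2\<bar> \<le> \<bar>lin A1 B1 C1 x1\<bar> + 9 / 8 * \<mu> * e ^ Suc m"
      using sep2 mult_left_mono[OF h, of "9 / 8 * \<mu>"] mu(1) by linarith
    hence "(real q2 * e ^ 2) * \<bar>lin A1 B1 C1 x2\<bar> \<le> real q1 * (\<bar>lin A1 B1 C1 x1\<bar> + 9 / 8 * \<mu> * e ^ Suc m)"
      using r21 by (intro mult_mono) auto
    also have "\<dots> = real q1 * \<bar>lin A1 B1 C1 x1\<bar> + 9 / 8 * (real q1 * \<mu> * e ^ Suc m)"
      by (simp add: algebra_simps)
    also have "\<dots> \<le> 2 * e ^ 24 + 9 / 8 * e ^ 14"
      using a1(9) mu(3) by linarith
    finally show ?thesis
      by (simp add: mult_ac)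
  qed
  define W where "W = A1 * p2 + B1 * t2 + C1 * int q2"
  have W: "of_int W = real q2 * lin A1 B1 C1 x2 - of_int A1 * (real q2 * x2 - of_int p2)
      - of_int B1 * (real q2 * f x2 - of_int t2)"
    by (simp add: W_def lin_def algebra_simps)
  have n2: "\<bar>real q2 * x2 - of_int p2\<bar> \<le> e ^ 24 * real q2 powr - i" "\<bar>real q2 * f x2 - of_int t2\<bar> \<le> e ^ 24 * real q2 powr - j"
    using d2(1) by (auto simp: attached_def near_def)
  have A: "\<bar>of_int A1 * (real q2 * x2 - of_int p2)\<bar> * e ^ 2 \<le> e ^ 24"
  proof -
    have "\<bar>of_int A1 * (real q2 * x2 - of_int p2)\<bar> * e ^ 2 \<le> real q1 powr i * (e ^ 24 * real q2 powr - i) * e ^ 2"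
      unfolding abs_mult using a1(4) n2 by (intro mult_mono) auto
    also have "\<dots> = e ^ 24 * (real q1 powr i * real q2 powr - i * e ^ 2)"
      by simp
    also have "\<dots> \<le> e ^ 24 * 1"
      using powr_ratio[OF r12] a1(3) a2(3) ij j_lt by (intro mult_left_mono) auto
    finally show ?thesis
      by simp
  qed
  have B: "\<bar>of_int B1 * (real q2 * f x2 - of_int t2)\<bar> * e ^ 2 \<le> e ^ 24"
  proof -
    have "\<bar>of_int B1 * (real q2 * f x2 - of_int t2)\<bar> * e ^ 2 \<le> real q1 powr j * (e ^ 24 * real q2 powr - j) * e ^ 2"
      unfolding abs_mult using a1(5) n2 by (intro mult_mono) auto
    also have "\<dots> = e ^ 24 * (real q1 powr j * real q2 powr - j * e ^ 2)"
      by simp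
    also have "\<dots> \<le> e ^ 24 * 1"
      using powr_ratio[OF r12] a1(3) a2(3) ij j_lt by (intro mult_left_mono) auto
    finally show ?thesis
      by simp
  qed
  have tri: "\<bar>real_of_int W\<bar> \<le> real q2 * \<bar>lin A1 B1 C1 x2\<bar> + \<bar>of_int A1 * (real q2 * x2 - of_int p2)\<bar>
      + \<bar>of_int B1 * (real q2 * f x2 - of_int t2)\<bar>"
  proof -
    have "real q2 * \<bar>lin A1 B1 C1 x2\<bar> = \<bar>real q2 * lin A1 B1 C1 x2\<bar>"
      by (simp add: abs_mult)
    thus ?thesis
      unfolding W by linarith
  qed
  have "\<bar>real_of_int W\<bar> * e ^ 2 \<le> (real q2 * \<bar>lin A1 B1 C1 x2\<bar> + \<bar>of_int A1 * (real q2 * x2 - of_int p2)\<bar>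
      + \<bar>of_int B1 * (real q2 * f x2 - of_int t2)\<bar>) * e ^ 2"
    by (rule mult_right_mono[OF tri]) auto
  also have "\<dots> \<le> 4 * e ^ 24 + 9 / 8 * e ^ 14"
    using l2 A B by (simp add: distrib_right)
  also have "\<dots> \<le> 6 * e ^ 3"
    using e_pow_mono[of 3 24] e_pow_mono[of 3 14] e_pow_pos[of 3] by linarith
  also have "\<dots> = 6 * e * e ^ 2"
    by (simp add: power_numeral_reduce)
  finally have "\<bar>real_of_int W\<bar> \<le> 6 * e"
    using e_pow_pos[of 2] by (subst (asm) mult_le_cancel_right_pos) auto
  hence "\<bar>real_of_int W\<bar> < 1"
    using e_le by linarith
  hence "W = 0"
    by linarith
  \<comment> \<open>Knowing \<open>W = 0\<close> improves the bound for
    \<open>q2 |lin A1 B1 C1 x2| e^2\<close> from \<open>2 e^24 + 9/8 e^14\<close> to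
    \<open>2 e^24\<close>; only this makes the distance shorter than the interval one started
    with.\<close>
  have "real q2 * \<bar>lin A1 B1 C1 x2\<bar> \<le> \<bar>of_int A1 * (real q2 * x2 - of_int p2)\<bar>
      + \<bar>of_int B1 * (real q2 * f x2 - of_int t2)\<bar>"
  proof -
    have "real q2 * \<bar>lin A1 B1 C1 x2\<bar> = \<bar>real q2 * lin A1 B1 C1 x2\<bar>"
      by (simp add: abs_mult)
    thus ?thesis
      using W \<open>W = 0\<close> by simp
  qed
  from mult_right_mono[OF this, of "e ^ 2"] A B
  have "real q2 * \<bar>lin A1 B1 C1 x2\<bar> * e ^ 2 \<le> 2 * e ^ 24"
    by (simp add: distrib_right)
  moreover have "(real q1 * e ^ 2) * \<bar>lin A1 B1 C1 x2\<bar> * e ^ 2 \<le> real q2 * \<bar>lin A1 B1 C1 x2\<bar> * e ^ 2"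
    using r12 by (intro mult_right_mono) auto
  ultimately have "real q1 * \<bar>lin A1 B1 C1 x2\<bar> * e ^ 4 \<le> 2 * e ^ 24"
    by (simp add: power_numeral_reduce mult_ac)
  moreover have "real q1 * \<bar>lin A1 B1 C1 x1\<bar> * e ^ 4 \<le> 2 * e ^ 24 * e ^ 4"
    using a1(9) by (intro mult_right_mono) auto
  moreover have "2 * e ^ 24 * e ^ 4 \<le> 2 * e ^ 24 * 1"
    using e_pow_mono[of 0 4] by (intro mult_left_mono) auto
  ultimately have "real q1 * (\<bar>lin A1 B1 C1 x1\<bar> + \<bar>lin A1 B1 C1 x2\<bar>) * e ^ 4 \<le> 4 * e ^ 24"
    by (simp add: algebra_simps)
  moreover have "real q1 * (7 / 8 * \<mu> * \<bar>x1 - x2\<bar>) * e ^ 4 \<le> real q1 * (\<bar>lin A1 B1 C1 x1\<bar> + \<bar>lin A1 B1 C1 x2\<bar>) * e ^ 4"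
    using sep1 by (intro mult_right_mono mult_left_mono) auto
  moreover have "real q1 * (7 / 8 * \<mu> * \<bar>x1 - x2\<bar>) * e ^ 4 = 7 / 8 * ((real q1 * \<mu>) * \<bar>x1 - x2\<bar> * e ^ 4)"
    by simp
  ultimately have "(real q1 * \<mu>) * \<bar>x1 - x2\<bar> * e ^ 4 \<le> 5 * e ^ 24"
    using e_pow_pos[of 24] by linarith
  hence "((real q1 * \<mu>) * \<bar>x1 - x2\<bar> * e ^ 4) * e ^ m \<le> 5 * e ^ 24 * e ^ m"
    by (intro mult_right_mono) auto
  moreover have "e ^ 14 * (\<bar>x1 - x2\<bar> * e ^ 4) \<le> (real q1 * \<mu> * e ^ m) * (\<bar>x1 - x2\<bar> * e ^ 4)"
    using mu(4) by (intro mult_right_mono) auto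
  moreover have "(real q1 * \<mu> * e ^ m) * (\<bar>x1 - x2\<bar> * e ^ 4) = ((real q1 * \<mu>) * \<bar>x1 - x2\<bar> * e ^ 4) * e ^ m"
    by simp
  ultimately have "e ^ 14 * (\<bar>x1 - x2\<bar> * e ^ 4) \<le> 5 * e ^ 24 * e ^ m"
    by linarith
  hence "e ^ 18 * \<bar>x1 - x2\<bar> \<le> e ^ 18 * (5 * e ^ 6 * e ^ m)"
    by (simp add: power_numeral_reduce mult_ac)
  hence "\<bar>x1 - x2\<bar> \<le> 5 * e ^ 6 * e ^ m"
    using e_pow_pos[of 18] by (subst (asm) mult_le_cancel_left_pos) auto
  also have "\<dots> \<le> e ^ 2 * e ^ m"
  proof (rule mult_right_mono)
    show "5 * e ^ 6 \<le> e ^ 2"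
      using e_pow_mono[of 3 6] e_pow_le[of 2] e_pow_pos[of 2] by (simp add: eval_nat_numeral)
  qed auto
  finally show ?thesis
    by (simp add: power2_eq_square mult_ac)
qed

section \<open>Tangential lines\<close>

lemma tangentialE:
  assumes "x \<in> tangential n"
  obtains q p t A B C where "attached x q p t A B C" "\<bar>slope A B x\<bar> < e ^ 4"
    "1 \<le> \<bar>of_int B\<bar> * e ^ n" "\<bar>of_int B\<bar> * e ^ Suc n < 1"
  using assms unfolding tangential_def by blast

text \<open>The lower bound on \<open>|B|\<close> forces \<open>q \<ge> R^n\<close>, so the value at
  \<open>x\<close> is tiny; the upper bound keeps the slope below
  \<open>e^4 + K e \<le> 1/50\<close> along the whole interval, so the value stays small
  too.\<close>

lemma tangential_bounds:
  assumes a: "attached x q p t A B C" and sl: "\<bar>slope A B x\<bar> < e ^ 4"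
    and B: "1 \<le> \<bar>of_int B\<bar> * e ^ n" "\<bar>of_int B\<bar> * e ^ Suc n < 1"
  shows "\<bar>lin A B C x\<bar> \<le> 2 * e ^ 24 * e ^ n"
    and "x0 \<in> I0 \<Longrightarrow> \<bar>x - x0\<bar> \<le> e ^ (n + 2) \<Longrightarrow> \<bar>slope A B x0\<bar> \<le> 1 / 50"
    and "x0 \<in> I0 \<Longrightarrow> \<bar>x - x0\<bar> \<le> e ^ (n + 2) \<Longrightarrow> \<bar>lin A B C x0\<bar> \<le> e ^ Suc n / 50"
proof -
  note d = attachedD[OF a]
  have "\<bar>real_of_int B\<bar> * e ^ n \<le> real q * e ^ n"
    using d by (intro mult_right_mono) auto
  hence "1 \<le> real q * e ^ n"
    using B by linarith
  hence "1 * \<bar>lin A B C x\<bar> \<le> (real q * e ^ n) * \<bar>lin A B C x\<bar>"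
    by (intro mult_right_mono) auto
  also have "\<dots> = (real q * \<bar>lin A B C x\<bar>) * e ^ n"
    by simp
  also have "\<dots> \<le> 2 * e ^ 24 * e ^ n"
    using d(9) by (intro mult_right_mono) auto
  finally show lx: "\<bar>lin A B C x\<bar> \<le> 2 * e ^ 24 * e ^ n"
    by simp
  have slope: "\<bar>slope A B z\<bar> \<le> 1 / 50" if z: "z \<in> I0" "\<bar>x - z\<bar> \<le> e ^ (n + 2)" for z
  proof -
    have "\<bar>slope A B x - slope A B z\<bar> \<le> K * \<bar>of_int B\<bar> * \<bar>x - z\<bar>"
      by (rule slope_diff[OF d(1) z(1)])
    also have "\<dots> \<le> K * \<bar>of_int B\<bar> * e ^ (n + 2)"
      using z Kg by (intro mult_left_mono) auto
    also have "\<dots> = (K * e) * (\<bar>of_int B\<bar> * e ^ Suc n)"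
      by simp
    also have "\<dots> \<le> 1 / 100 * 1"
      using K_e B(2) by (intro mult_mono) auto
    finally have "\<bar>slope A B x - slope A B z\<bar> \<le> 1 / 100"
      by simp
    moreover have "e ^ 4 \<le> 1 / 100"
      using e_pow_mono[of 1 4] e_le by simp
    ultimately show ?thesis
      using sl by linarith
  qed
  show "x0 \<in> I0 \<Longrightarrow> \<bar>x - x0\<bar> \<le> e ^ (n + 2) \<Longrightarrow> \<bar>slope A B x0\<bar> \<le> 1 / 50"
    by (rule slope)
  assume x0: "x0 \<in> I0" "\<bar>x - x0\<bar> \<le> e ^ (n + 2)"
  obtain z where z: "min x x0 \<le> z" "z \<le> max x x0" "z \<in> I0"
      "lin A B C x - lin A B C x0 = slope A B z * (x - x0)"
    using mean_value[OF d(1) x0(1) lin_deriv, of A B C] by metis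
  have "\<bar>x - z\<bar> \<le> e ^ (n + 2)"
    using x0 z by (auto simp: min_def max_def split: if_splits)
  hence "\<bar>lin A B C x - lin A B C x0\<bar> \<le> 1 / 50 * e ^ (n + 2)"
    unfolding z(4) abs_mult using slope[OF z(3)] x0 by (intro mult_mono) auto
  also have "\<dots> \<le> e ^ Suc n / 100"
    using e_pow_le[of "Suc n"] e_pow_pos[of "Suc n"] by simp
  finally have "\<bar>lin A B C x - lin A B C x0\<bar> \<le> e ^ Suc n / 100" .
  moreover have "2 * e ^ 24 * e ^ n \<le> e ^ Suc n / 100"
  proof -
    have "2 * e ^ 24 \<le> e / 100"
      using e_pow_mono[of "Suc 1" 24] e_pow_le[of 1] e_pos unfolding power_one_right by linarith
    from mult_right_mono[OF this, of "e ^ n"] show ?thesis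
      by simp
  qed
  ultimately show "\<bar>lin A B C x0\<bar> \<le> e ^ Suc n / 50"
    using lx by linarith
qed

text \<open>The determinant is an integer. Unimodular column operations replace \<open>A\<close> by
  the slope and \<open>C\<close> by the value at \<open>x0\<close>; the expansion then consists of
  six products of absolute value at most 1/2500.\<close>

lemma tangential_det:
  assumes x0: "x0 \<in> I0"
    and a1: "attached x1 q1 p1 t1 A1 B1 C1" "\<bar>slope A1 B1 x1\<bar> < e ^ 4" "1 \<le> \<bar>of_int B1\<bar> * e ^ n"
      "\<bar>of_int B1\<bar> * e ^ Suc n < 1" "\<bar>x1 - x0\<bar> \<le> e ^ (n + 2)"
    and a2: "attached x2 q2 p2 t2 A2 B2 C2" "\<bar>slope A2 B2 x2\<bar> < e ^ 4" "1 \<le> \<bar>of_int B2\<bar> * e ^ n"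
      "\<bar>of_int B2\<bar> * e ^ Suc n < 1" "\<bar>x2 - x0\<bar> \<le> e ^ (n + 2)"
    and a3: "attached x3 q3 p3 t3 A3 B3 C3" "\<bar>slope A3 B3 x3\<bar> < e ^ 4" "1 \<le> \<bar>of_int B3\<bar> * e ^ n"
      "\<bar>of_int B3\<bar> * e ^ Suc n < 1" "\<bar>x3 - x0\<bar> \<le> e ^ (n + 2)"
  shows "A1 * (B2 * C3 - B3 * C2) - B1 * (A2 * C3 - A3 * C2) + C1 * (A2 * B3 - A3 * B2) = 0"
proof -
  define \<alpha> where "\<alpha> A B = slope A B x0" for A B
  define \<phi> where "\<phi> A B C = lin A B C x0" for A B C
  define D where "D = A1 * (B2 * C3 - B3 * C2) - B1 * (A2 * C3 - A3 * C2) + C1 * (A2 * B3 - A3 * B2)"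
  have D: "real_of_int D = \<alpha> A1 B1 * (B2 * \<phi> A3 B3 C3) - \<alpha> A1 B1 * (B3 * \<phi> A2 B2 C2)
      - \<alpha> A2 B2 * (B1 * \<phi> A3 B3 C3) + \<alpha> A2 B2 * (B3 * \<phi> A1 B1 C1)
      + \<alpha> A3 B3 * (B1 * \<phi> A2 B2 C2) - \<alpha> A3 B3 * (B2 * \<phi> A1 B1 C1)"
    unfolding D_def \<alpha>_def \<phi>_def slope_def lin_def by (simp add: algebra_simps)
  note b1 = tangential_bounds[OF a1(1-4)] and b2 = tangential_bounds[OF a2(1-4)] and b3 = tangential_bounds[OF a3(1-4)]
  have prod: "\<bar>x * (y * z)\<bar> \<le> 1 / 50 * (1 / 50)"
    if "\<bar>x\<bar> \<le> 1 / 50" "\<bar>y\<bar> * e ^ Suc n < 1" "\<bar>z\<bar> \<le> e ^ Suc n / 50" for x y z :: real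
  proof -
    have "\<bar>y\<bar> * \<bar>z\<bar> \<le> \<bar>y\<bar> * (e ^ Suc n / 50)"
      using that by (intro mult_left_mono) auto
    also have "\<dots> \<le> 1 / 50"
      using that by simp
    finally show ?thesis
      unfolding abs_mult using that by (intro mult_mono) auto
  qed
  have \<alpha>: "\<bar>\<alpha> A1 B1\<bar> \<le> 1 / 50" "\<bar>\<alpha> A2 B2\<bar> \<le> 1 / 50" "\<bar>\<alpha> A3 B3\<bar> \<le> 1 / 50"
    unfolding \<alpha>_def using b1(2) b2(2) b3(2) x0 a1 a2 a3 by auto
  have \<phi>: "\<bar>\<phi> A1 B1 C1\<bar> \<le> e ^ Suc n / 50" "\<bar>\<phi> A2 B2 C2\<bar> \<le> e ^ Suc n / 50" "\<bar>\<phi> A3 B3 C3\<bar> \<le> e ^ Suc n / 50"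
    unfolding \<phi>_def using b1(3) b2(3) b3(3) x0 a1 a2 a3 by blast+
  have "\<bar>real_of_int D\<bar> < 1"
    unfolding D
    using prod[OF \<alpha>(1) a2(4) \<phi>(3)] prod[OF \<alpha>(1) a3(4) \<phi>(2)] prod[OF \<alpha>(2) a1(4) \<phi>(3)]
      prod[OF \<alpha>(2) a3(4) \<phi>(1)] prod[OF \<alpha>(3) a1(4) \<phi>(2)] prod[OF \<alpha>(3) a2(4) \<phi>(1)]
    by linarith
  thus ?thesis
    unfolding D_def[symmetric] by linarith
qed

text \<open>All lines occurring here pass through one point \<open>v\<close> of the projective plane, and the
  tangent of the curve at a point of \<open>X\<close> almost passes through \<open>v\<close> too. The function \<open>G\<close> measures
  this defect; its derivative vanishes only at the abscissa of \<open>v\<close>.\<close>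

lemma tangential_spots:
  assumes X: "X \<subseteq> tangential n" and dX: "\<And>x y. x \<in> X \<Longrightarrow> y \<in> X \<Longrightarrow> \<bar>x - y\<bar> \<le> e ^ (n + 2)"
  obtains E :: "nat \<Rightarrow> real set" where "X \<subseteq> (\<Union>b\<in>{..<3}. E b)"
    "\<And>b x y. x \<in> E b \<Longrightarrow> y \<in> E b \<Longrightarrow> \<bar>x - y\<bar> \<le> e ^ (n + 3)"
proof (cases "X = {}")
  case True
  thus thesis using that[of "\<lambda>_. {}"] by simp
next
  case False
  then obtain x0 where x0: "x0 \<in> X"
    by auto
  define S where "S = {(A, B, C). \<exists>x q p t. x \<in> X \<and> attached x q p t A B C \<and> \<bar>slope A B x\<bar> < e ^ 4
    \<and> 1 \<le> \<bar>of_int B\<bar> * e ^ n \<and> \<bar>of_int B\<bar> * e ^ Suc n < 1}"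
  have XI: "x \<in> I0" if "x \<in> X" for x
    using that X attachedD(1) by (meson subsetD tangentialE)
  obtain v1 v2 v3 :: real where v: "v1 \<noteq> 0 \<or> v2 \<noteq> 0 \<or> v3 \<noteq> 0"
      "\<And>A B C. (A, B, C) \<in> S \<Longrightarrow> of_int A * v1 + of_int B * v2 + of_int C * v3 = 0"
  proof (rule concurrent_lines[of S])
    fix A1 B1 C1 A2 B2 C2 A3 B3 C3 assume l: "(A1, B1, C1) \<in> S" "(A2, B2, C2) \<in> S" "(A3, B3, C3) \<in> S"
    obtain x1 q1 p1 t1 where 1: "x1 \<in> X" "attached x1 q1 p1 t1 A1 B1 C1" "\<bar>slope A1 B1 x1\<bar> < e ^ 4"
        "1 \<le> \<bar>of_int B1\<bar> * e ^ n" "\<bar>of_int B1\<bar> * e ^ Suc n < 1"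
      using l(1) unfolding S_def by blast
    obtain x2 q2 p2 t2 where 2: "x2 \<in> X" "attached x2 q2 p2 t2 A2 B2 C2" "\<bar>slope A2 B2 x2\<bar> < e ^ 4"
        "1 \<le> \<bar>of_int B2\<bar> * e ^ n" "\<bar>of_int B2\<bar> * e ^ Suc n < 1"
      using l(2) unfolding S_def by blast
    obtain x3 q3 p3 t3 where 3: "x3 \<in> X" "attached x3 q3 p3 t3 A3 B3 C3" "\<bar>slope A3 B3 x3\<bar> < e ^ 4"
        "1 \<le> \<bar>of_int B3\<bar> * e ^ n" "\<bar>of_int B3\<bar> * e ^ Suc n < 1"
      using l(3) unfolding S_def by blast
    show "A1 * (B2 * C3 - B3 * C2) - B1 * (A2 * C3 - A3 * C2) + C1 * (A2 * B3 - A3 * B2) = 0"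
      by (rule tangential_det[OF XI[OF x0] 1(2-) dX[OF 1(1) x0] 2(2-) dX[OF 2(1) x0] 3(2-) dX[OF 3(1) x0]])
  qed (auto simp: S_def)
  define G where "G x = v2 - f x * v3 - f1 x * (v1 - x * v3)" for x
  have G': "(G has_real_derivative - f2 x * (v1 - x * v3)) (at x)" if "x \<in> I0" for x
    unfolding G_def using f1[of x] f2[of x] that
    by (auto intro!: derivative_eq_intros simp: I0_eq algebra_simps)
  have Gx: "\<bar>G x\<bar> \<le> e ^ n * (e ^ 4 * \<bar>v1 - x * v3\<bar> + 2 * e ^ 24 * e ^ n * \<bar>v3\<bar>)"
    and nv: "v1 = 0 \<Longrightarrow> v3 = 0 \<Longrightarrow> False" if x: "x \<in> X" for x
  proof -
    obtain q p t A B C where a: "attached x q p t A B C" "\<bar>slope A B x\<bar> < e ^ 4"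
      "1 \<le> \<bar>of_int B\<bar> * e ^ n" "\<bar>of_int B\<bar> * e ^ Suc n < 1"
      using x X tangentialE by blast
    hence "(A, B, C) \<in> S"
      using x by (auto simp: S_def)
    hence eq: "of_int A * v1 + of_int B * v2 + of_int C * v3 = 0"
      by (rule v)
    thus "v1 = 0 \<Longrightarrow> v3 = 0 \<Longrightarrow> False"
      using v(1) a(3) by auto
    \<comment> \<open>Incidence of \<open>v\<close> with the line eliminates \<open>A\<close> and
      \<open>C\<close>, so \<open>B\<close> times the defect involves only the small slope and the
      small value.\<close>
    have "of_int B * G x = - (slope A B x * (v1 - x * v3) + lin A B C x * v3)"
      using eq unfolding G_def slope_def lin_def by (simp add: algebra_simps)
    hence "\<bar>of_int B\<bar> * \<bar>G x\<bar> = \<bar>slope A B x * (v1 - x * v3) + lin A B C x * v3\<bar>"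
      by (metis abs_minus_cancel abs_mult)
    also have "\<dots> \<le> \<bar>slope A B x\<bar> * \<bar>v1 - x * v3\<bar> + \<bar>lin A B C x\<bar> * \<bar>v3\<bar>"
      by (metis abs_mult abs_triangle_ineq)
    also have "\<dots> \<le> e ^ 4 * \<bar>v1 - x * v3\<bar> + 2 * e ^ 24 * e ^ n * \<bar>v3\<bar>"
      using a(2) tangential_bounds(1)[OF a] by (intro add_mono mult_right_mono) auto
    finally have le: "\<bar>of_int B\<bar> * \<bar>G x\<bar> \<le> e ^ 4 * \<bar>v1 - x * v3\<bar> + 2 * e ^ 24 * e ^ n * \<bar>v3\<bar>" .
    have "1 * \<bar>G x\<bar> \<le> (\<bar>of_int B\<bar> * e ^ n) * \<bar>G x\<bar>"
      using a(3) by (intro mult_right_mono) auto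
    also have "\<dots> = e ^ n * (\<bar>of_int B\<bar> * \<bar>G x\<bar>)"
      by simp
    also have "\<dots> \<le> e ^ n * (e ^ 4 * \<bar>v1 - x * v3\<bar> + 2 * e ^ 24 * e ^ n * \<bar>v3\<bar>)"
      using le by (intro mult_left_mono) auto
    finally show "\<bar>G x\<bar> \<le> e ^ n * (e ^ 4 * \<bar>v1 - x * v3\<bar> + 2 * e ^ 24 * e ^ n * \<bar>v3\<bar>)"
      by simp
  qed
  have fin: "d \<le> e ^ (n + 3)" if "g * d \<le> 10 * e ^ (n + 4)" "0 \<le> d" for d
  proof -
    have "100 * e * d \<le> g * d"
      using g_e that by (intro mult_right_mono) auto
    also have "\<dots> \<le> 10 * e ^ (n + 4)"
      by (rule that)
    also have "\<dots> \<le> 100 * e ^ (n + 4)"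
      by simp
    also have "\<dots> = 100 * e * e ^ (n + 3)"
      by (simp add: eval_nat_numeral)
    finally show ?thesis
      using e_pos by (subst (asm) mult_le_cancel_left_pos) auto
  qed
  show thesis
  \<comment> \<open>If \<open>v\<close> is at infinity, the derivative of \<open>G\<close> never
    vanishes and \<open>X\<close> is a single spot. Otherwise the three spots are a neighbourhood of
    the abscissa \<open>c\<close> of \<open>v\<close> and the two sides of it.\<close>
  proof (cases "v3 = 0")
    case True
    have close: "\<bar>x - y\<bar> \<le> e ^ (n + 3)" if xy: "x \<in> X" "y \<in> X" for x y
    proof (rule fin)
      have v1: "\<bar>v1\<bar> > 0"
        using nv[OF xy(1)] True by auto
      obtain z where z: "z \<in> I0" "G x - G y = - f2 z * (v1 - z * v3) * (x - y)"
        using mean_value[OF XI[OF xy(1)] XI[OF xy(2)] G'] by metis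
      have "g * \<bar>v1\<bar> * \<bar>x - y\<bar> \<le> \<bar>f2 z\<bar> * \<bar>v1\<bar> * \<bar>x - y\<bar>"
        using f2_bounds[of z] z(1) by (intro mult_right_mono) (auto simp: I0_eq)
      also have "\<dots> = \<bar>G x - G y\<bar>"
        using z(2) True by (simp add: abs_mult)
      also have "\<dots> \<le> 2 * (e ^ n * (e ^ 4 * \<bar>v1\<bar>))"
        using Gx[OF xy(1)] Gx[OF xy(2)] True by (simp add: abs_le_iff)
      finally have "(g * \<bar>x - y\<bar>) * \<bar>v1\<bar> \<le> (2 * e ^ (n + 4)) * \<bar>v1\<bar>"
        by (simp add: power_add mult_ac)
      hence "g * \<bar>x - y\<bar> \<le> 2 * e ^ (n + 4)"
        using v1 by (subst (asm) mult_le_cancel_right_pos) auto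
      also have "\<dots> \<le> 10 * e ^ (n + 4)"
        by simp
      finally show "g * \<bar>x - y\<bar> \<le> 10 * e ^ (n + 4)" .
    qed auto
    show thesis
      by (rule that[of "\<lambda>_. X"]) (use close in \<open>auto simp: lessThan_empty_iff\<close>)
  next
    case v3: False
    define c where "c = v1 / v3"
    define \<eta> where "\<eta> = e ^ (n + 3) / 2"
    have eta: "\<eta> > 0" "2 * \<eta> = e ^ (n + 3)"
      by (simp_all add: \<eta>_def)
    have u: "v1 - x * v3 = v3 * (c - x)" for x
      using v3 by (simp add: c_def algebra_simps)
    have close: "\<bar>x - y\<bar> \<le> e ^ (n + 3)"
      if xy: "x \<in> X" "y \<in> X" and side: "(c + \<eta> < x \<and> c + \<eta> < y) \<or> (x < c - \<eta> \<and> y < c - \<eta>)" for x y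
    proof (rule fin)
      define T where "T = \<bar>x - c\<bar> + \<bar>y - c\<bar>"
      have T: "T \<ge> e ^ (n + 3)" "T = \<bar>x + y - 2 * c\<bar>"
        using side eta by (auto simp: T_def)
      \<comment> \<open>Cauchy's mean value theorem for \<open>G\<close> and
        \<open>(z - c)^2\<close>. The ordinary one would give the factor \<open>|z - c|\<close> at
        an unknown \<open>z\<close>; this one gives \<open>T\<close>, which also occurs in the
        bounds for \<open>G x\<close> and \<open>G y\<close> and cancels.\<close>
      define P where "P z = (G x - G y) * (z - c) ^ 2 - ((x - c) ^ 2 - (y - c) ^ 2) * G z" for z
      define P' where "P' z = (G x - G y) * (2 * (z - c)) - ((x - c) ^ 2 - (y - c) ^ 2) * (- f2 z * (v1 - z * v3))" for z
      have P': "(P has_real_derivative P' z) (at z)" if "z \<in> I0" for z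
        unfolding P_def P'_def by (auto intro!: derivative_eq_intros G' that)
      obtain z where z: "min x y \<le> z" "z \<le> max x y" "z \<in> I0" "P x - P y = P' z * (x - y)"
        using mean_value[OF XI[OF xy(1)] XI[OF xy(2)] P'] by metis
      have zc: "z \<noteq> c"
        using z(1,2) side eta by (auto simp: min_def max_def split: if_splits)
      have "P x - P y = 0"
        by (simp add: P_def algebra_simps)
      show "g * \<bar>x - y\<bar> \<le> 10 * e ^ (n + 4)"
      proof (cases "x = y")
        case True
        thus ?thesis by simp
      next
        case False
        hence "P' z = 0"
          using z(4) \<open>P x - P y = 0\<close> by simp
        hence "(z - c) * (2 * (G x - G y) - (x - y) * (x + y - 2 * c) * f2 z * v3) = 0"
          unfolding P'_def u by (simp add: algebra_simps power2_eq_square)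
        hence eq: "2 * (G x - G y) = (x - y) * (x + y - 2 * c) * f2 z * v3"
          using zc by simp
        have "(g * \<bar>x - y\<bar>) * T * \<bar>v3\<bar> \<le> \<bar>f2 z\<bar> * \<bar>x - y\<bar> * T * \<bar>v3\<bar>"
          using f2_bounds[of z] z(3) by (intro mult_right_mono) (auto simp: I0_eq T_def)
        also have "\<dots> = \<bar>2 * (G x - G y)\<bar>"
          unfolding eq T(2) by (simp add: abs_mult)
        also have "\<dots> \<le> 2 * (\<bar>G x\<bar> + \<bar>G y\<bar>)"
          using abs_triangle_ineq4[of "G x" "G y"] by (simp add: abs_mult)
        also have "\<dots> \<le> 2 * (e ^ n * (e ^ 4 * \<bar>v1 - x * v3\<bar> + 2 * e ^ 24 * e ^ n * \<bar>v3\<bar>)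
            + e ^ n * (e ^ 4 * \<bar>v1 - y * v3\<bar> + 2 * e ^ 24 * e ^ n * \<bar>v3\<bar>))"
          by (intro mult_left_mono add_mono Gx xy) auto
        also have "\<dots> = (2 * e ^ n * e ^ 4 * T + 8 * (e ^ 24 * e ^ n * e ^ n)) * \<bar>v3\<bar>"
          unfolding u abs_mult T_def by (simp add: algebra_simps abs_minus_commute)
        finally have "(g * \<bar>x - y\<bar>) * T \<le> 2 * e ^ n * e ^ 4 * T + 8 * (e ^ 24 * e ^ n * e ^ n)"
          using v3 by (subst (asm) mult_le_cancel_right_pos) auto
        \<comment> \<open>The term without \<open>T\<close> is absorbed, because both points keep
          the distance \<eta> from \<open>c\<close> and so \<open>T \<ge> e^(n+3)\<close>.\<close>
        also have "e ^ 24 * e ^ n * e ^ n = e ^ (n + 21) * e ^ (n + 3)"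
          by (simp add: power_add eval_nat_numeral)
        also have "e ^ (n + 21) * e ^ (n + 3) \<le> e ^ (n + 4) * T"
          using T e_pow_mono[of "n + 4" "n + 21"] by (intro mult_mono) auto
        also have "2 * e ^ n * e ^ 4 * T = 2 * (e ^ (n + 4) * T)"
          by (simp add: power_add)
        finally have "(g * \<bar>x - y\<bar>) * T \<le> (10 * e ^ (n + 4)) * T"
          by (simp add: mult_ac)
        thus ?thesis
          using T(1) e_pow_pos[of "n + 3"] by (subst (asm) mult_le_cancel_right_pos) linarith+
      qed
    qed auto
    define E where "E b = (if b = (0::nat) then {x \<in> X. \<bar>x - c\<bar> \<le> \<eta>}
      else if b = 1 then {x \<in> X. c + \<eta> < x} else {x \<in> X. x < c - \<eta>})" for b
    show thesis
    proof (rule that)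
      show "X \<subseteq> (\<Union>b\<in>{..<3}. E b)"
      proof
        fix x assume "x \<in> X"
        hence "x \<in> E 0 \<or> x \<in> E 1 \<or> x \<in> E 2"
          by (auto simp: E_def)
        thus "x \<in> (\<Union>b\<in>{..<3}. E b)"
          by force
      qed
      show "\<bar>x - y\<bar> \<le> e ^ (n + 3)" if "x \<in> E b" "y \<in> E b" for b x y
        using that close[of x y] eta unfolding E_def by (auto split: if_splits)
    qed
  qed
qed

section \<open>Counting transversal lines on a surviving interval\<close>

lemma e_powr: "e ^ n = real R powr - real n"
  using R512 by (simp add: e_def powr_minus_divide powr_realpow power_one_over)

text \<open>Here the history of the construction enters: \<open>x0\<close> has not come close to any rational point of small
  denominator, so by transference there is no short line at \<open>x0\<close>.\<close>

lemma no_short_line: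
  assumes Q: "0 < Q" "Q * Q powr j = Y" and Y: "e ^ 14 \<le> Y" and x0: "x0 \<in> I0"
    and hist: "\<And>q p t. near x0 q p t \<Longrightarrow> Y \<le> real q * real q powr j"
    and A: "\<bar>of_int A\<bar> < e ^ (M + 20) * Q powr i" and S: "\<bar>slope A B x0\<bar> < e ^ (M + 20) * Q powr j"
    and L: "\<bar>lin A B C x0\<bar> < e ^ (M + 20) / Q"
  shows "A = 0 \<and> B = 0 \<and> C = 0"
proof (rule ccontr)
  assume nz0: "\<not> ?thesis"
  \<comment> \<open>One factor \<open>e\<close> is held back: bounds on the slope and on
    \<open>A\<close> give one on \<open>B\<close> only after division by \<open>f1\<close>, and
    \<open>g \<ge> 100 e\<close>.\<close>
  define \<kappa> where "\<kappa> = e ^ (M + 19)"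
  have kap: "0 < \<kappa>" "\<kappa> \<le> 1" "e ^ (M + 20) = e * \<kappa>"
    using e_pow_mono[of 0 "M + 19"] power_Suc[of e "M + 19"] by (simp_all add: \<kappa>_def add.commute del: power_Suc)
  note A = A[unfolded kap(3)] and S = S[unfolded kap(3)] and L = L[unfolded kap(3)]
  have ek: "e * \<kappa> \<le> \<kappa>"
    using kap e_le by (intro mult_left_le_one_le) auto
  have "\<bar>real_of_int A\<bar> \<le> e * \<kappa> * Q powr j"
  proof (cases "Q \<ge> 1")
    case True
    hence "Q powr i \<le> Q powr j"
      using ij by (intro powr_mono) auto
    hence "e * \<kappa> * Q powr i \<le> e * \<kappa> * Q powr j"
      using kap by (intro mult_left_mono) auto
    thus ?thesis
      using A kap by linarith
  next
    case False
    hence "Q powr i \<le> 1"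
      using Q ij by (simp add: powr_le1)
    hence "e * \<kappa> * Q powr i \<le> 1 * 1"
      using kap order_trans[OF ek kap(2)] by (intro mult_mono) auto
    hence "\<bar>real_of_int A\<bar> < 1"
      using A kap by linarith
    hence "A = 0"
      by linarith
    thus ?thesis
      using kap by simp
  qed
  moreover have "g * \<bar>of_int B\<bar> \<le> \<bar>f1 x0\<bar> * \<bar>of_int B\<bar>"
    using f1_bounds[of x0] x0 by (intro mult_right_mono) (auto simp: I0_eq)
  moreover have "\<bar>f1 x0\<bar> * \<bar>of_int B\<bar> = \<bar>slope A B x0 - of_int A\<bar>"
    by (simp add: slope_def abs_mult)
  ultimately have "g * \<bar>of_int B\<bar> \<le> 2 * (e * \<kappa> * Q powr j)"
    using S kap abs_triangle_ineq4[of "slope A B x0" "of_int A"] by linarith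
  moreover have "(100 * e) * \<bar>of_int B\<bar> \<le> g * \<bar>of_int B\<bar>"
    using g_e by (intro mult_right_mono) auto
  ultimately have "(100 * e) * \<bar>of_int B\<bar> \<le> 2 * (e * \<kappa> * Q powr j)"
    by linarith
  hence "e * (100 * \<bar>of_int B\<bar>) \<le> e * (2 * (\<kappa> * Q powr j))"
    by (simp only: mult_ac)
  hence "100 * \<bar>real_of_int B\<bar> \<le> 2 * (\<kappa> * Q powr j)"
    using e_pos by (subst (asm) mult_le_cancel_left_pos) auto
  moreover have "0 \<le> \<kappa> * Q powr j"
    using kap by simp
  ultimately have B: "\<bar>of_int B\<bar> \<le> \<kappa> * Q powr j"
    by linarith
  have A': "\<bar>of_int A\<bar> \<le> \<kappa> * Q powr i"
    using A mult_right_mono[OF ek, of "Q powr i", OF powr_ge_zero] by linarith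
  have L': "\<bar>of_int A * x0 + of_int B * f x0 + of_int C\<bar> \<le> \<kappa> / Q"
    using L kap divide_right_mono[OF ek, of Q] Q by (simp add: lin_def)
  \<comment> \<open>With \<open>A = B = 0\<close> only the integer \<open>C\<close> remains, and
    \<open>Q \<ge> e^14\<close> makes it smaller than 1.\<close>
  have nz: "A \<noteq> 0 \<or> B \<noteq> 0"
  proof (rule ccontr)
    assume "\<not> ?thesis"
    hence AB: "A = 0" "B = 0"
      by auto
    have Qge: "e ^ 14 \<le> Q"
    proof (cases "Q \<ge> 1")
      case True
      thus ?thesis
        using e_pow_mono[of 0 14] by simp
    next
      case False
      hence "Q * Q powr j \<le> Q * 1"
        using Q j_lt by (intro mult_left_mono powr_le1) auto
      thus ?thesis
        using Q Y by simp
    qed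
    have "\<kappa> \<le> e ^ 14"
      unfolding \<kappa>_def by (intro e_pow_mono) auto
    hence "\<kappa> / Q \<le> 1"
      using Qge Q by simp
    moreover have "\<bar>real_of_int C\<bar> < e * \<kappa> / Q"
      using L kap AB by (simp add: lin_def)
    moreover have "e * \<kappa> / Q \<le> \<kappa> / Q"
      using divide_right_mono[OF ek, of Q] Q by simp
    ultimately have "\<bar>real_of_int C\<bar> < 1"
      by linarith
    hence "C = 0"
      by linarith
    with AB nz0 show False
      by simp
  qed
  have r1: "1 \<le> real R"
    using R512 by simp
  \<comment> \<open>Transference is applied with \<open>R^M\<close> for its \<open>K\<close> and
    \<open>e^24\<close> for its \<open>c\<close>; \<open>25 \<le> i M\<close> provides the powers it
    asks for, with one factor \<open>e \<le> 1/2\<close> to spare.\<close>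
  have pw: "(real R ^ M) powr - t \<le> e ^ 24 / 2" if "i \<le> t" for t
  proof -
    have "i * real M \<le> t * real M"
      using that by (intro mult_right_mono) auto
    hence tM: "25 \<le> real M * t"
      using M by (simp add: mult.commute)
    have "(real R ^ M) powr - t = real R powr - (real M * t)"
      using r1 by (simp add: powr_powr flip: powr_realpow)
    also have "\<dots> \<le> real R powr - real (Suc 24)"
      using tM r1 by (intro powr_mono) auto
    also have "\<dots> = e ^ Suc 24"
      by (simp only: e_powr)
    also have "\<dots> \<le> e ^ 24 / 2"
      using e_pow_le[of 24] e_pow_pos[of 24] by linarith
    finally show ?thesis .
  qed
  have RMe: "real R ^ M * e ^ M = 1"
    using e_R by (simp flip: power_mult_distrib)
  have k1: "2 * real R ^ M * \<kappa> < 1"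
  proof -
    have "2 * real R ^ M * \<kappa> = 2 * (real R ^ M * e ^ M) * e ^ 19"
      by (simp add: \<kappa>_def power_add)
    also have "\<dots> = 2 * e ^ 19"
      using RMe by simp
    also have "\<dots> < 1"
      using e_pow_mono[of 1 19] e_le by simp
    finally show ?thesis .
  qed
  have k2: "\<kappa>\<^sup>2 \<le> e ^ 24 / (8 * (real R ^ M)\<^sup>2)"
  proof -
    have "\<kappa>\<^sup>2 * (8 * (real R ^ M)\<^sup>2) = 8 * (real R ^ M * e ^ M)\<^sup>2 * e ^ 38"
      by (simp add: \<kappa>_def power_add power_mult_distrib eval_nat_numeral)
    also have "\<dots> = 8 * e ^ 38"
      using RMe by simp
    also have "\<dots> \<le> e ^ 24"
      using e_pow_mono[of "Suc 24" 38] e_pow_le[of 24] e_pow_pos[of 24] by linarith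
    finally show ?thesis
      using R512 by (simp add: field_simps)
  qed
  obtain q p t where q: "1 \<le> q" "real q < Q" "\<bar>real q * x0 - of_int p\<bar> \<le> e ^ 24 * real q powr - i"
      "\<bar>real q * f x0 - of_int t\<bar> \<le> e ^ 24 * real q powr - j"
  proof (rule transference[of i j "real R ^ M" "e ^ 24" \<kappa> Q A B x0 "f x0" C])
    show "1 \<le> real R ^ M"
      using r1 by (simp add: one_le_power)
    show "(real R ^ M) powr - i \<le> e ^ 24 / 2" "(real R ^ M) powr - j \<le> e ^ 24 / 2"
      using pw ij by auto
  qed (use ij j_lt kap k1 k2 Q nz A' B L' in auto)
  have "near x0 q p t"
    using q x0 by (simp add: near_def)
  hence "Y \<le> real q * real q powr j"
    by (rule hist)
  also have "\<dots> < Q * Q powr j"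
    using q j_lt by (intro mult_strict_mono powr_less_mono2) auto
  finally show False
    using Q by simp
qed

text \<open>On this longer interval the slope is comparable for a new reason: the hypotheses give
  \<open>e^n q^i \<mu>^2 \<le> e^12 \<le> \<mu>^3\<close>, hence \<open>e^n q^i \<le> \<mu>\<close>,
  and \<open>g |B| \<le> \<mu> + q^i\<close> controls its variation. The second claim bounds
  \<open>q\<close> from above for the count of lines.\<close>

lemma transversal_scale:
  assumes 1: "transversal (n + l) l x q p t A B C"
  shows "K * \<bar>of_int B\<bar> * e ^ (n + 2) \<le> \<bar>slope A B x\<bar> / 8"
    and "real q * real q powr j * e ^ n * e ^ Suc (2 * l) < e ^ 14"
proof -
  note d = transversalD[OF 1]
  note a = attachedD[OF d(1)]
  define \<mu> where "\<mu> = \<bar>slope A B x\<bar>"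
  have mu: "0 < \<mu>" "e ^ 4 \<le> \<mu>" "real q * \<mu> * e ^ Suc (n + l) < e ^ 14" "e * \<mu> \<le> real q powr j * e ^ l"
    "real q powr j * e ^ l < \<mu>"
    using d by (auto simp: \<mu>_def)
  have qj: "0 < real q powr j"
    using a by simp
  have "real q powr j * (e ^ 2 * (e ^ n * real q powr i * \<mu>\<^sup>2)) =
      e * \<mu> * ((real q powr i * real q powr j) * \<mu> * e ^ Suc n)"
    by (simp add: power2_eq_square)
  also have "\<dots> = e * \<mu> * (real q * \<mu> * e ^ Suc n)"
    by (simp only: a(8))
  also have "\<dots> \<le> real q powr j * e ^ l * (real q * \<mu> * e ^ Suc n)"
    using mu by (intro mult_right_mono) auto
  also have "\<dots> = real q powr j * (real q * \<mu> * e ^ Suc (n + l))"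
    by (simp add: power_add)
  also have "\<dots> \<le> real q powr j * (e ^ 2 * e ^ 12)"
    using mu(3) qj by (intro mult_left_mono) (auto simp flip: power_add)
  finally have "e ^ 2 * (e ^ n * real q powr i * \<mu>\<^sup>2) \<le> e ^ 2 * e ^ 12"
    using qj by (subst (asm) mult_le_cancel_left_pos) auto
  hence "e ^ n * real q powr i * \<mu>\<^sup>2 \<le> e ^ 12"
    using e_pow_pos[of 2] by (subst (asm) mult_le_cancel_left_pos) auto
  also have "\<dots> = (e ^ 4) ^ 3"
    by (simp flip: power_mult)
  also have "\<dots> \<le> \<mu> ^ 3"
    using mu by (intro power_mono) auto
  also have "\<dots> = \<mu> * \<mu>\<^sup>2"
    by (simp add: power3_eq_cube power2_eq_square)
  finally have qi: "e ^ n * real q powr i \<le> \<mu>"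
    using mu by (subst (asm) mult_le_cancel_right_pos) auto
  have "g * \<bar>of_int B\<bar> \<le> \<bar>f1 x\<bar> * \<bar>of_int B\<bar>"
    using f1_bounds[of x] a(1) by (intro mult_right_mono) (auto simp: I0_eq)
  also have "\<dots> = \<bar>slope A B x - of_int A\<bar>"
    by (simp add: slope_def abs_mult)
  also have "\<dots> \<le> \<mu> + real q powr i"
    using a(4) unfolding \<mu>_def by linarith
  finally have gB: "g * \<bar>of_int B\<bar> \<le> \<mu> + real q powr i" .
  have "(K * \<bar>of_int B\<bar> * e ^ (n + 2)) = (K * e) * (\<bar>of_int B\<bar> * e ^ Suc n)"
    by simp
  also have "\<dots> \<le> g / 100 * (\<bar>of_int B\<bar> * e ^ Suc n)"
    using K_e(1) by (intro mult_right_mono) auto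
  also have "\<dots> = (g * \<bar>of_int B\<bar>) * e ^ Suc n / 100"
    by simp
  also have "\<dots> \<le> (\<mu> + real q powr i) * e ^ Suc n / 100"
    using gB by (intro divide_right_mono mult_right_mono) auto
  also have "\<dots> = e * (\<mu> * e ^ n + e ^ n * real q powr i) / 100"
    by (simp add: algebra_simps)
  also have "\<dots> \<le> 1 * (\<mu> * 1 + \<mu>) / 100"
    using mu e_le e_pow_mono[of 0 n] qi by (intro divide_right_mono mult_mono add_mono mult_left_mono) auto
  also have "\<dots> \<le> \<mu> / 8"
    using mu by simp
  finally show "K * \<bar>of_int B\<bar> * e ^ (n + 2) \<le> \<bar>slope A B x\<bar> / 8"
    by (simp add: \<mu>_def)
  have "real q * real q powr j * e ^ n * e ^ Suc (2 * l) = real q * (real q powr j * e ^ l) * e ^ Suc (n + l)"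
    by (simp add: power_add mult_2)
  also have "\<dots> \<le> real q * \<mu> * e ^ Suc (n + l)"
    using mu by (intro mult_right_mono mult_left_mono) auto
  also have "\<dots> < e ^ 14"
    by (rule mu)
  finally show "real q * real q powr j * e ^ n * e ^ Suc (2 * l) < e ^ 14" .
qed

text \<open>For one fixed line the separation estimate suffices: both values are of order
  \<open>e^24 / q\<close> up to a factor \<open>R^2\<close>, and one divides by \<mu>, where
  \<open>q \<mu> \<ge> e^14 R^(n+l)\<close>.\<close>

lemma transversal_line_close:
  assumes 1: "transversal (n + l) l x1 q1 p1 t1 A B C" and 2: "transversal (n + l) l x2 q2 p2 t2 A B C"
    and h: "\<bar>x1 - x2\<bar> \<le> e ^ (n + 2)"
  shows "\<bar>x1 - x2\<bar> \<le> e ^ (n + l + 2)"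
proof -
  note d1 = transversalD[OF 1] and d2 = transversalD[OF 2]
  note a1 = attachedD[OF d1(1)] and a2 = attachedD[OF d2(1)]
  define \<mu> where "\<mu> = \<bar>slope A B x1\<bar>"
  have mu: "0 < \<mu>" "e ^ 14 \<le> real q1 * \<mu> * e ^ (n + l)"
    using d1 by (auto simp: \<mu>_def)
  have r12: "real q1 * e ^ 2 \<le> real q2"
    using transversal_ratio[OF 2 1] .
  have sep: "7 / 8 * \<mu> * \<bar>x1 - x2\<bar> \<le> \<bar>lin A B C x1\<bar> + \<bar>lin A B C x2\<bar>"
    unfolding \<mu>_def
    by (rule lin_separation[OF a1(1) a1(1) a2(1), of "e ^ (n + 2)"]) (use h transversal_scale[OF 1] in auto)
  have "real q1 * e ^ 2 * \<bar>lin A B C x2\<bar> \<le> real q2 * \<bar>lin A B C x2\<bar>"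
    using r12 by (intro mult_right_mono) auto
  hence "real q1 * e ^ 2 * \<bar>lin A B C x2\<bar> \<le> 2 * e ^ 24"
    using a2(9) by linarith
  moreover have "e ^ 2 * (real q1 * \<bar>lin A B C x1\<bar>) \<le> 1 * (2 * e ^ 24)"
    by (rule mult_mono) (use a1(9) e_pow_mono[of 0 2] in auto)
  moreover have "real q1 * e ^ 2 * (7 / 8 * \<mu> * \<bar>x1 - x2\<bar>) \<le> real q1 * e ^ 2 * (\<bar>lin A B C x1\<bar> + \<bar>lin A B C x2\<bar>)"
    using sep by (intro mult_left_mono) auto
  moreover have "real q1 * e ^ 2 * (\<bar>lin A B C x1\<bar> + \<bar>lin A B C x2\<bar>) =
      e ^ 2 * (real q1 * \<bar>lin A B C x1\<bar>) + real q1 * e ^ 2 * \<bar>lin A B C x2\<bar>"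
    by (simp add: algebra_simps)
  moreover have "real q1 * e ^ 2 * (7 / 8 * \<mu> * \<bar>x1 - x2\<bar>) = 7 / 8 * (real q1 * \<mu> * (e ^ 2 * \<bar>x1 - x2\<bar>))"
    by simp
  ultimately have le: "real q1 * \<mu> * (e ^ 2 * \<bar>x1 - x2\<bar>) \<le> 5 * e ^ 24"
    using e_pow_pos[of 24] by linarith
  have "e ^ 14 * (e ^ 2 * \<bar>x1 - x2\<bar>) \<le> real q1 * \<mu> * e ^ (n + l) * (e ^ 2 * \<bar>x1 - x2\<bar>)"
    using mu by (intro mult_right_mono) auto
  also have "\<dots> = (real q1 * \<mu> * (e ^ 2 * \<bar>x1 - x2\<bar>)) * e ^ (n + l)"
    by simp
  also have "\<dots> \<le> 5 * e ^ 24 * e ^ (n + l)"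
    using le by (intro mult_right_mono) auto
  also have "\<dots> = e ^ 14 * (e ^ 2 * (5 * e ^ 8 * e ^ (n + l)))"
    by (simp add: eval_nat_numeral)
  finally have "e ^ 2 * \<bar>x1 - x2\<bar> \<le> e ^ 2 * (5 * e ^ 8 * e ^ (n + l))"
    using e_pow_pos[of 14] by (subst (asm) mult_le_cancel_left_pos) auto
  hence "\<bar>x1 - x2\<bar> \<le> 5 * e ^ 8 * e ^ (n + l)"
    using e_pow_pos[of 2] by (subst (asm) mult_le_cancel_left_pos) auto
  also have "\<dots> \<le> e ^ 2 * e ^ (n + l)"
  proof (rule mult_right_mono)
    show "5 * e ^ 8 \<le> e ^ 2"
      using e_pow_mono[of "Suc 2" 8] e_pow_le[of 2] e_pow_pos[of 2] by linarith
  qed simp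
  finally show ?thesis
    by (simp add: power_add power2_eq_square mult_ac)
qed

text \<open>Two distinct lines with equal values of \<open>cell3\<close> would differ by a short line.\<close>

lemma transversal_count:
  assumes x0: "x0 \<in> I0"
    and X: "\<And>x. x \<in> X \<Longrightarrow> \<bar>x - x0\<bar> \<le> e ^ (n + 2)" "\<And>x y. x \<in> X \<Longrightarrow> y \<in> X \<Longrightarrow> \<bar>x - y\<bar> \<le> e ^ (n + 2)"
    and hist: "\<And>x q p t. x \<in> insert x0 X \<Longrightarrow> near x q p t \<Longrightarrow> e ^ 14 \<le> real q * real q powr j * e ^ n"
    and tr: "\<And>x. x \<in> X \<Longrightarrow> \<exists>q p t A B C. transversal (n + l) l x q p t A B C"
  obtains W :: "(int \<times> int \<times> int) set" and E where "finite W" "X \<subseteq> (\<Union>w\<in>W. E w)"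
    "real (card W) \<le> real R powr (2 / 3 * real l + 3 * real M + 64)"
    "\<And>w x y. x \<in> E w \<Longrightarrow> y \<in> E w \<Longrightarrow> \<bar>x - y\<bar> \<le> e ^ (n + l + 2)"
proof -
  define r where "r = real R"
  have r: "512 \<le> r" "1 \<le> r" "0 < r"
    using R512 by (auto simp: r_def)
  \<comment> \<open>\<open>Q\<close> solves \<open>Q^(1+j) = e^14 R^n\<close>, so
    \<open>hist\<close> says exactly that every denominator near a point of
    \<open>insert x0 X\<close> is at least \<open>Q\<close>.\<close>
  define Y where "Y = e ^ 14 / e ^ n"
  define Q where "Q = Y powr (1 / (1 + j))"
  have Y: "0 < Y" "e ^ 14 \<le> Y"
    using e_pow_mono[of 0 n] e_pos by (simp_all add: Y_def pos_le_divide_eq mult_left_le)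
  have Q: "0 < Q" "Q * Q powr j = Y"
  proof -
    show "0 < Q"
      using Y by (simp add: Q_def)
    have "Q * Q powr j = Q powr (1 + j)"
      using \<open>0 < Q\<close> by (simp add: powr_add)
    also have "\<dots> = Y"
      using Y j_lt by (simp add: Q_def powr_powr)
    finally show "Q * Q powr j = Y" .
  qed
  have hist': "Y \<le> real q * real q powr j" if "x \<in> insert x0 X" "near x q p t" for x q p t
    using hist[OF that] by (simp add: Y_def pos_divide_le_eq)
  define W where "W = {(A, B, C). \<exists>x q p t. x \<in> X \<and> transversal (n + l) l x q p t A B C}"
  define E where "E = (\<lambda>(A, B, C). {x \<in> X. \<exists>q p t. transversal (n + l) l x q p t A B C})"
  define \<kappa> where "\<kappa> = e ^ (M + 20)"
  have kap: "0 < \<kappa>" "\<kappa> \<le> 1"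
    using e_pow_mono[of 0 "M + 20"] by (simp_all add: \<kappa>_def)
  \<comment> \<open>The grid cells are boxes whose differences \<open>no_short_line\<close> at
    \<open>x0\<close> forces to be zero; \<open>Y1\<close>, \<open>Y2\<close>, \<open>Y3\<close>
    bound the three coordinates in these units.\<close>
  define cell3 where "cell3 = (\<lambda>(A, B, C). (\<lfloor>of_int A / (\<kappa> * Q powr i)\<rfloor>,
      \<lfloor>slope A B x0 / (\<kappa> * Q powr j)\<rfloor>, \<lfloor>lin A B C x0 * Q / \<kappa>\<rfloor>))"
  define Y1 where "Y1 = r powr (real (2 * l + 1) / 3) / \<kappa>"
  define Y2 where "Y2 = 2 * r\<^sup>2 / \<kappa>"
  define Y3 where "Y3 = 1 / \<kappa>"
  have er: "e = 1 / r" "r * e = 1"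
    using r by (simp_all add: e_def r_def)
  have Y123: "1 \<le> Y1" "1 \<le> Y2" "1 \<le> Y3"
  proof -
    show "1 \<le> Y3"
      using kap by (simp add: Y3_def)
    have "1 \<le> r powr (real (2 * l + 1) / 3)"
      using r by (intro ge_one_powr_ge_zero) auto
    thus "1 \<le> Y1"
      using kap by (simp add: Y1_def)
    have "1 \<le> r\<^sup>2"
      using r by simp
    thus "1 \<le> Y2"
      using kap by (simp add: Y2_def)
  qed
  have inj: "inj_on cell3 W"
  proof (rule inj_onI)
    fix w w' assume "w \<in> W" "w' \<in> W" and eq: "cell3 w = cell3 w'"
    obtain A B C A' B' C' where w: "w = (A, B, C)" "w' = (A', B', C')"
      by (metis prod_cases3)
    have fl: "\<bar>x - y\<bar> < z" if "\<lfloor>x / z\<rfloor> = \<lfloor>y / z\<rfloor>" "0 < z" for x y z :: real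
    proof -
      have "\<bar>x / z - y / z\<bar> < 1"
        using that(1) by linarith
      moreover have "\<bar>x / z - y / z\<bar> = \<bar>x - y\<bar> / z"
        using that(2) by (simp flip: diff_divide_distrib)
      ultimately show ?thesis
        using that(2) by simp
    qed
    have fl3: "\<bar>x - y\<bar> < \<kappa> / Q" if "\<lfloor>x * Q / \<kappa>\<rfloor> = \<lfloor>y * Q / \<kappa>\<rfloor>" for x y :: real
      using fl[of x "\<kappa> / Q" y] that kap Q by simp
    have "A - A' = 0 \<and> B - B' = 0 \<and> C - C' = 0"
    proof (rule no_short_line[OF Q Y(2) x0])
      show "Y \<le> real q * real q powr j" if "near x0 q p t" for q p t
        using hist' that by blast
      have s: "slope (A - A') (B - B') x0 = slope A B x0 - slope A' B' x0"
        "lin (A - A') (B - B') (C - C') x0 = lin A B C x0 - lin A' B' C' x0"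
        by (simp_all add: slope_def lin_def algebra_simps)
      show "\<bar>real_of_int (A - A')\<bar> < e ^ (M + 20) * Q powr i"
        "\<bar>slope (A - A') (B - B') x0\<bar> < e ^ (M + 20) * Q powr j"
        "\<bar>lin (A - A') (B - B') (C - C') x0\<bar> < e ^ (M + 20) / Q"
        unfolding s of_int_diff \<kappa>_def[symmetric]
        using eq kap Q by (auto simp: w cell3_def intro!: fl fl3)
    qed
    thus "w = w'"
      by (simp add: w)
  qed
  have img: "cell3 ` W \<subseteq> {\<lfloor>- Y1\<rfloor>..\<lfloor>Y1\<rfloor>} \<times> {\<lfloor>- Y2\<rfloor>..\<lfloor>Y2\<rfloor>} \<times> {\<lfloor>- Y3\<rfloor>..\<lfloor>Y3\<rfloor>}"
  proof
    fix z assume "z \<in> cell3 ` W"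
    then obtain A B C x q p t where z: "z = cell3 (A, B, C)" and x: "x \<in> X" and 1: "transversal (n + l) l x q p t A B C"
      by (auto simp: W_def)
    note d = transversalD[OF 1]
    note a = attachedD[OF d(1)]
    define \<mu> where "\<mu> = \<bar>slope A B x\<bar>"
    have mu: "0 < \<mu>" "e * \<mu> \<le> real q powr j * e ^ l"
      using d by (auto simp: \<mu>_def)
    have qq: "real q powr (1 + j) \<le> Y * r powr real (2 * l + 1)"
    proof -
      have "real q powr (1 + j) * e ^ n * e ^ Suc (2 * l) < e ^ 14"
        using transversal_scale(2)[OF 1] a by (simp add: powr_add)
      hence "real q powr (1 + j) < Y / e ^ Suc (2 * l)"
        unfolding Y_def using e_pow_pos[of n] e_pow_pos[of "Suc (2 * l)"] by (simp only: pos_less_divide_eq mult_ac)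
      also have "\<dots> = Y * r powr real (2 * l + 1)"
        unfolding powr_realpow[OF r(3)] er(1) using r by (simp add: power_one_over)
      finally show ?thesis
        by simp
    qed
    have qt: "real q powr u \<le> Q powr u * r powr (real (2 * l + 1) * v)" if u: "0 \<le> u" "u / (1 + j) \<le> v" for u v
    proof -
      have "real q powr u = (real q powr (1 + j)) powr (u / (1 + j))"
        using j_lt by (simp add: powr_powr)
      also have "\<dots> \<le> (Y * r powr real (2 * l + 1)) powr (u / (1 + j))"
        using u j_lt qq by (intro powr_mono2) auto
      also have "\<dots> = Q powr u * r powr (real (2 * l + 1) * (u / (1 + j)))"
        using Y r by (simp add: powr_mult powr_powr Q_def)
      also have "\<dots> \<le> Q powr u * r powr (real (2 * l + 1) * v)"
        using u r by (intro mult_left_mono powr_mono) auto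
      finally show ?thesis .
    qed
    \<comment> \<open>This rests on \<open>i \<le> j\<close> and is the source of the exponent
      \<open>2 l/3\<close>: \<open>q\<close> may exceed \<open>Q\<close> by
      \<open>R^((2 l + 1)/(1 + j))\<close>, and only the range of \<open>A\<close> grows with
      it.\<close>
    have "i / (1 + j) \<le> 1 / 3"
      using ij j_lt by (simp add: field_simps)
    from qt[OF _ this] have qi: "real q powr i \<le> Q powr i * r powr (real (2 * l + 1) / 3)"
      using ij by simp
    have "j / (1 + j) \<le> 1 / 2"
      using j_lt by (simp add: field_simps)
    from qt[OF _ this] have qj: "real q powr j \<le> Q powr j * r powr (real (2 * l + 1) / 2)"
      using j_lt by simp
    \<comment> \<open>The growth \<open>R^l\<close> of \<open>q^j\<close> is offset by the factor
      \<open>e^l\<close> in \<mu>, so the range of slopes does not depend on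
      \<open>l\<close>.\<close>
    have mu2: "\<mu> \<le> r\<^sup>2 * Q powr j"
    proof -
      have "\<mu> = r * (e * \<mu>)"
        using er(2) by (simp flip: mult.assoc)
      also have "\<dots> \<le> r * (Q powr j * r powr (real (2 * l + 1) / 2) * e ^ l)"
        using mu(2) r order_trans[OF mu(2) mult_right_mono[OF qj, of "e ^ l"]] by (intro mult_left_mono) auto
      also have "\<dots> = Q powr j * (r powr 1 * r powr (real (2 * l + 1) / 2) * r powr - real l)"
        using r e_powr[of l] by (simp add: r_def [symmetric])
      also have "r powr 1 * r powr (real (2 * l + 1) / 2) * r powr - real l =
          r powr (1 + real (2 * l + 1) / 2 + - real l)"
        by (simp only: powr_add)
      also have "1 + real (2 * l + 1) / 2 + - real l = 3 / 2"
        by (simp add: field_simps)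
      finally have "\<mu> \<le> Q powr j * r powr (3 / 2)" .
      also have "\<dots> \<le> Q powr j * r powr 2"
        using r by (intro mult_left_mono powr_mono) auto
      finally show ?thesis
        using r by (simp add: mult.commute)
    qed
    have n0: "near x q p t"
      using d(1) by (simp add: attached_def)
    have Qq: "Q \<le> real q"
    proof (rule ccontr)
      assume "\<not> ?thesis"
      hence "real q * real q powr j < Q * Q powr j"
        using a(3) j_lt by (intro mult_strict_mono powr_less_mono2) auto
      thus False
        using hist'[of x q p t] x n0 Q by simp
    qed
    have h: "K * \<bar>of_int B\<bar> * e ^ (n + 2) \<le> \<bar>slope A B x\<bar> / 8"
      by (rule transversal_scale(1)[OF 1])
    have sl: "\<bar>slope A B x0\<bar> \<le> 2 * r\<^sup>2 * Q powr j"
      using slope_comparable(2)[OF a(1) x0 X(1)[OF x] h] mu2 mu(1) unfolding \<mu>_def by linarith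
    have ln: "\<bar>lin A B C x0\<bar> * Q \<le> 1"
    proof -
      have "\<bar>lin A B C x - lin A B C x0\<bar> \<le> 9 / 8 * \<mu> * \<bar>x - x0\<bar>"
        unfolding \<mu>_def by (rule lin_separation(2)[OF a(1) a(1) x0 _ X(1)[OF x] h]) simp
      also have "\<dots> \<le> 9 / 8 * (r\<^sup>2 * Q powr j) * e ^ (n + 2)"
        using mu mu2 X(1)[OF x] by (intro mult_mono) auto
      also have "\<dots> = 9 / 8 * ((r * e)\<^sup>2 * (Q powr j * e ^ n))"
        by (simp add: power2_eq_square)
      finally have "\<bar>lin A B C x - lin A B C x0\<bar> \<le> 9 / 8 * (Q powr j * e ^ n)"
        by (simp only: er(2)) simp
      hence "\<bar>lin A B C x - lin A B C x0\<bar> * Q \<le> 9 / 8 * (Q powr j * e ^ n) * Q"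
        using Q by (intro mult_right_mono) auto
      also have "\<dots> = 9 / 8 * (Y * e ^ n)"
        by (simp flip: Q(2))
      also have "\<dots> = 9 / 8 * e ^ 14"
        using e_pos by (simp add: Y_def)
      finally have 1: "\<bar>lin A B C x - lin A B C x0\<bar> * Q \<le> 9 / 8 * e ^ 14" .
      have "\<bar>lin A B C x\<bar> * Q \<le> \<bar>lin A B C x\<bar> * real q"
        using Qq by (intro mult_left_mono) auto
      hence 2: "\<bar>lin A B C x\<bar> * Q \<le> 2 * e ^ 24"
        using a(9) by (simp add: mult.commute)
      have "\<bar>lin A B C x0\<bar> * Q \<le> (\<bar>lin A B C x\<bar> + \<bar>lin A B C x - lin A B C x0\<bar>) * Q"
        using Q by (intro mult_right_mono) auto
      also have "\<dots> \<le> 2 * e ^ 24 + 9 / 8 * e ^ 14"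
        using 1 2 by (simp add: distrib_right)
      also have "\<dots> \<le> 1"
        using e_pow_mono[of 1 24] e_pow_mono[of 1 14] e_le by simp
      finally show ?thesis .
    qed
    have b1: "\<bar>of_int A / (\<kappa> * Q powr i)\<bar> \<le> Y1"
      using order_trans[OF a(4) qi] kap Q by (simp add: Y1_def abs_mult field_simps)
    have b2: "\<bar>slope A B x0 / (\<kappa> * Q powr j)\<bar> \<le> Y2"
      using sl kap Q by (simp add: Y2_def abs_mult field_simps)
    have b3: "\<bar>lin A B C x0 * Q / \<kappa>\<bar> \<le> Y3"
      using ln kap Q by (simp add: Y3_def abs_mult divide_right_mono)
    have "\<lfloor>- y\<rfloor> \<le> \<lfloor>u\<rfloor> \<and> \<lfloor>u\<rfloor> \<le> \<lfloor>y\<rfloor>" if "\<bar>u\<bar> \<le> y" for u y :: real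
      using that by (auto intro!: floor_mono)
    from this[OF b1] this[OF b2] this[OF b3]
    show "z \<in> {\<lfloor>- Y1\<rfloor>..\<lfloor>Y1\<rfloor>} \<times> {\<lfloor>- Y2\<rfloor>..\<lfloor>Y2\<rfloor>} \<times> {\<lfloor>- Y3\<rfloor>..\<lfloor>Y3\<rfloor>}"
      by (simp add: z cell3_def)
  qed
  have finW: "finite W"
    using finite_subset[OF img] inj by (simp add: finite_image_iff)
  have "card W \<le> card ({\<lfloor>- Y1\<rfloor>..\<lfloor>Y1\<rfloor>} \<times> {\<lfloor>- Y2\<rfloor>..\<lfloor>Y2\<rfloor>} \<times> {\<lfloor>- Y3\<rfloor>..\<lfloor>Y3\<rfloor>})"
    using card_mono[OF _ img] card_image[OF inj] by simp
  hence "real (card W) \<le> real (card {\<lfloor>- Y1\<rfloor>..\<lfloor>Y1\<rfloor>}) * (real (card {\<lfloor>- Y2\<rfloor>..\<lfloor>Y2\<rfloor>}) * real (card {\<lfloor>- Y3\<rfloor>..\<lfloor>Y3\<rfloor>}))"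
    unfolding card_cartesian_product of_nat_mult[symmetric] by (simp only: of_nat_le_iff)
  also have "\<dots> \<le> (4 * Y1) * ((4 * Y2) * (4 * Y3))"
    using Y123 by (intro mult_mono card_floor_range) auto
  also have "\<dots> = 128 * (r powr (real (2 * l + 1) / 3) * r\<^sup>2 * (1 / \<kappa>) ^ 3)"
    by (simp add: Y1_def Y2_def Y3_def power3_eq_cube)
  \<comment> \<open>\<open>128 \<le> R\<close> adds 1 to the exponent, and
    \<open>1 + (2 l + 1)/3 + 2 + 3 (M + 20)\<close> is at most
    \<open>2/3 l + 3 M + 64\<close>.\<close>
  also have "\<dots> \<le> r * (r powr (real (2 * l + 1) / 3) * r\<^sup>2 * (1 / \<kappa>) ^ 3)"
    using r kap by (intro mult_right_mono) auto
  also have "(1 / \<kappa>) ^ 3 = r powr (3 * (real M + 20))"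
  proof -
    have "1 / \<kappa> = r ^ (M + 20)"
      using r by (simp add: \<kappa>_def er power_one_over)
    hence "(1 / \<kappa>) ^ 3 = r ^ (3 * (M + 20))"
      by (simp only: power_mult [symmetric] mult.commute)
    also have "\<dots> = r powr real (3 * (M + 20))"
      using r by (simp only: powr_realpow)
    finally show ?thesis
      by simp
  qed
  also have "r * (r powr (real (2 * l + 1) / 3) * r\<^sup>2 * r powr (3 * (real M + 20))) =
      r powr 1 * (r powr (real (2 * l + 1) / 3) * r powr 2 * r powr (3 * (real M + 20)))"
    using r by simp
  also have "\<dots> = r powr (1 + (real (2 * l + 1) / 3 + 2 + 3 * (real M + 20)))"
    by (simp only: powr_add)
  also have "\<dots> \<le> r powr (2 / 3 * real l + 3 * real M + 64)"
    using r by (intro powr_mono) auto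
  finally have cardW: "real (card W) \<le> r powr (2 / 3 * real l + 3 * real M + 64)" .
  show thesis
  proof (rule that)
    show "X \<subseteq> (\<Union>w\<in>W. E w)"
    proof
      fix x assume x: "x \<in> X"
      then obtain q p t A B C where "transversal (n + l) l x q p t A B C"
        using tr by blast
      hence "(A, B, C) \<in> W" "x \<in> E (A, B, C)"
        using x by (auto simp: W_def E_def)
      thus "x \<in> (\<Union>w\<in>W. E w)"
        by blast
    qed
    show "\<bar>x - y\<bar> \<le> e ^ (n + l + 2)" if xy: "x \<in> E w" "y \<in> E w" for w x y
    proof -
      obtain A B C where w: "w = (A, B, C)"
        by (metis prod_cases3)
      obtain q p t where 1: "transversal (n + l) l x q p t A B C"
        using xy(1) by (auto simp: E_def w)
      obtain q' p' t' where 2: "transversal (n + l) l y q' p' t' A B C"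
        using xy(2) by (auto simp: E_def w)
      have "x \<in> X" "y \<in> X"
        using xy by (auto simp: E_def w)
      thus ?thesis
        using transversal_line_close[OF 1 2 X(2)] by blast
    qed
  qed (use finW cardW in \<open>auto simp: r_def\<close>)
qed

section \<open>Removed nodes and their weight\<close>

definition transversal_set :: "nat \<Rightarrow> nat \<Rightarrow> real set" where
  "transversal_set m l = {x. \<exists>q p t A B C. transversal m l x q p t A B C}"

text \<open>The set \<open>dangerous n m\<close> is charged to the cells of level \<open>n\<close> and removed at level \<open>m\<close>. Transversal
  lines of small slope (large \<open>l\<close>) are charged \<open>l\<close> levels in advance, since only there are they few.\<close>

definition dangerous :: "nat \<Rightarrow> nat \<Rightarrow> real set" where
  "dangerous n m = (if m = Suc n then tangential n \<union> (\<Union>l\<le>18 * M + 390. transversal_set m l) else {})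
     \<union> (if n + (18 * M + 390) < m then transversal_set m (m - n) else {})"

definition removed :: "nat \<Rightarrow> nat \<Rightarrow> (nat \<times> nat) set" where
  "removed n k = {(m, v). n < m \<and> v div R ^ (m - n) = k \<and> k < R ^ n \<and> cell a (e ^ 2) R m v \<inter> dangerous n m \<noteq> {}}"

lemma e_bracket:
  assumes "1 \<le> y"
  obtains m where "1 \<le> y * e ^ m" "y * e ^ Suc m < 1"
proof -
  obtain k where "e ^ k < 1 / y"
    using real_arch_pow_inv[of "1 / y" e] assms e_le by auto
  hence "y * e ^ k < 1"
    using assms by (simp add: field_simps)
  hence ex: "\<exists>k. y * e ^ k < 1"
    by blast
  define k0 where "k0 = (LEAST k. y * e ^ k < 1)"
  have k0: "y * e ^ k0 < 1"
    unfolding k0_def using ex by (rule LeastI_ex)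
  then obtain m where m: "k0 = Suc m"
    using assms by (cases k0) auto
  have "\<not> y * e ^ m < 1"
    using not_less_Least[of m "\<lambda>k. y * e ^ k < 1"] m unfolding k0_def by simp
  thus thesis
    using that[of m] k0 m by simp
qed

text \<open>The last conclusion supplies the history: if all removals up to level \<open>n\<close>
  were avoided, a rational point still near has \<open>m > n\<close>, so
  \<open>q^(1+j) \<ge> e^14 R^n\<close> as \<open>cost_far\<close> requires.\<close>

lemma near_dangerous:
  assumes near: "near x q p t"
  obtains n m where "n < m" "x \<in> dangerous n m" "e ^ 14 \<le> real q * real q powr j * e ^ (m - 1)"
proof -
  have "1 \<le> q"
    using near by (simp add: near_def)
  then obtain A B C where l: "A \<noteq> 0 \<or> B \<noteq> 0" "\<bar>of_int A\<bar> \<le> real q powr i" "\<bar>of_int B\<bar> \<le> real q powr j"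
      "A * p + B * t + C * int q = 0"
    using attached_line[of q i j p t] ij j_lt by metis
  hence att: "attached x q p t A B C"
    using near by (simp add: attached_def)
  note a = attachedD[OF att]
  define \<mu> where "\<mu> = \<bar>slope A B x\<bar>"
  show thesis
  proof (cases "\<mu> < e ^ 4")
    case True
    \<comment> \<open>A vertical line would have slope \<open>A\<close>, a nonzero integer.\<close>
    have "B \<noteq> 0"
    proof
      assume "B = 0"
      hence "\<mu> = \<bar>real_of_int A\<bar>" "A \<noteq> 0"
        using l(1) by (auto simp: \<mu>_def slope_def)
      hence "1 \<le> \<mu>"
        by linarith
      thus False
        using True e_pow_mono[of 0 4] by simp
    qed
    hence "1 \<le> \<bar>real_of_int B\<bar>"
      by linarith
    then obtain n where n: "1 \<le> \<bar>real_of_int B\<bar> * e ^ n" "\<bar>real_of_int B\<bar> * e ^ Suc n < 1"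
      by (rule e_bracket)
    have "x \<in> tangential n"
      unfolding tangential_def using att True n \<mu>_def by blast
    moreover have "\<bar>real_of_int B\<bar> * e ^ n \<le> real q * real q powr j * e ^ n"
      using a(5) a(2) mult_mono[of 1 "real q" "\<bar>real_of_int B\<bar>" "real q powr j"] by (intro mult_right_mono) auto
    hence "e ^ 14 \<le> real q * real q powr j * e ^ n"
      using n(1) e_pow_mono[of 0 14] unfolding power_0 by linarith
    ultimately show thesis
      using that[of n "Suc n"] by (auto simp: dangerous_def)
  next
    case False
    hence mu: "e ^ 4 \<le> \<mu>" "0 < \<mu>"
      using e_pow_pos[of 4] by linarith+
    have qmu: "e ^ 4 \<le> real q * \<mu>"
      using mult_mono[of 1 "real q" "e ^ 4" \<mu>] mu a(2) by simp
    have "1 \<le> real q * \<mu> / e ^ 14"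
      using qmu e_pow_mono[of 4 14] e_pos by (simp add: le_divide_eq)
    then obtain m where "1 \<le> real q * \<mu> / e ^ 14 * e ^ m" "real q * \<mu> / e ^ 14 * e ^ Suc m < 1"
      by (rule e_bracket)
    hence m: "e ^ 14 \<le> real q * \<mu> * e ^ m" "real q * \<mu> * e ^ Suc m < e ^ 14"
      using e_pos by (simp_all add: field_simps del: power_Suc)
    have "\<mu> \<le> real q powr i + K * real q powr j"
    proof -
      have "\<mu> \<le> \<bar>of_int A\<bar> + \<bar>of_int B\<bar> * \<bar>f1 x\<bar>"
        unfolding \<mu>_def slope_def abs_mult[symmetric] by (rule abs_triangle_ineq)
      also have "\<dots> \<le> real q powr i + real q powr j * K"
        using a f1_bounds[of x] by (intro add_mono mult_mono) (auto simp: I0_eq)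
      finally show ?thesis
        by (simp add: mult.commute)
    qed
    also have "\<dots> \<le> K * real q powr j + K * real q powr j"
      using a(6) Kg mult_mono[of 1 K "real q powr i" "real q powr j"] by simp
    finally have "e * \<mu> \<le> e * (2 * K * real q powr j)"
      by (intro mult_left_mono) auto
    also have "\<dots> = 2 * (K * e) * real q powr j"
      by simp
    also have "\<dots> \<le> 1 * real q powr j"
      using K_e by (intro mult_right_mono) auto
    finally have "1 \<le> real q powr j / (e * \<mu>)"
      using mu e_pos by (simp add: le_divide_eq)
    then obtain l where "1 \<le> real q powr j / (e * \<mu>) * e ^ l" "real q powr j / (e * \<mu>) * e ^ Suc l < 1"
      by (rule e_bracket)
    hence l: "e * \<mu> \<le> real q powr j * e ^ l" "real q powr j * e ^ l < \<mu>"
      using e_pos mu by (simp_all add: field_simps)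
    have tr: "x \<in> transversal_set m l"
      unfolding transversal_set_def transversal_def using att mu m l \<mu>_def by blast
    \<comment> \<open>Nodes are charged to a strictly earlier level, so level 0 must be
      excluded.\<close>
    have m0: "m \<noteq> 0"
    proof
      assume "m = 0"
      hence "e ^ 4 * e < e ^ 14"
        using m(2) mult_right_mono[OF qmu, of e] by simp
      thus False
        using e_pow_mono[of 5 14] by (simp add: eval_nat_numeral)
    qed
    have hist: "e ^ 14 \<le> real q * real q powr j * e ^ (m - 1)"
    proof -
      have em: "e ^ m = e * e ^ (m - 1)"
        using m0 by (cases m) auto
      have "e ^ 14 \<le> real q * (e * \<mu>) * e ^ (m - 1)"
        using m(1) by (simp add: em mult_ac)
      also have "\<dots> \<le> real q * (real q powr j * e ^ l) * e ^ (m - 1)"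
        using l(1) by (intro mult_right_mono mult_left_mono) auto
      also have "\<dots> \<le> real q * (real q powr j * 1) * e ^ (m - 1)"
        using e_pow_mono[of 0 l] by (intro mult_right_mono mult_left_mono) auto
      finally show ?thesis
        by simp
    qed
    show thesis
    proof (cases "l \<le> 18 * M + 390")
      case True
      thus thesis
        using that[of "m - 1" m] m0 tr hist by (auto simp: dangerous_def)
    next
      case big: False
      \<comment> \<open>The charging level is \<open>m - l\<close>; for \<open>l > m\<close> the
        bounds on \<mu> and \<open>q^j \<le> q\<close> would give \<open>e \<mu>^2 < e^14\<close>,
        against \<open>\<mu> \<ge> e^4\<close>.\<close>
      have "l \<le> m"
      proof (rule ccontr)
        assume "\<not> l \<le> m"
        hence "e ^ l \<le> e ^ Suc m"
          by (intro e_pow_mono) auto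
        hence "e * \<mu> \<le> real q powr j * e ^ Suc m"
          using l(1) mult_left_mono[of "e ^ l" "e ^ Suc m" "real q powr j"] by simp
        hence "e * \<mu> * (real q * \<mu>) \<le> real q powr j * e ^ Suc m * (real q * \<mu>)"
          using mu by (intro mult_right_mono) auto
        also have "\<dots> = real q powr j * (real q * \<mu> * e ^ Suc m)"
          by simp
        also have "\<dots> < real q powr j * e ^ 14"
          using m(2) a(3) by (intro mult_strict_left_mono) auto
        also have "\<dots> \<le> real q * e ^ 14"
          using a(7) by (intro mult_right_mono) auto
        finally have "real q * (e * (\<mu> * \<mu>)) < real q * e ^ 14"
          by (simp add: mult_ac)
        hence "e * (\<mu> * \<mu>) < e ^ 14"
          using a(3) by (subst (asm) mult_less_cancel_left_pos) auto
        moreover have "e * (e ^ 4 * e ^ 4) \<le> e * (\<mu> * \<mu>)"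
          using mu by (intro mult_left_mono mult_mono) auto
        moreover have "e ^ 14 \<le> e * (e ^ 4 * e ^ 4)"
          using e_pow_mono[of 9 14] by (simp add: eval_nat_numeral)
        ultimately show False
          by linarith
      qed
      thus thesis
        using that[of "m - l" m] big tr hist by (auto simp: dangerous_def)
    qed
  qed
qed

lemma cell_scale: "e ^ 2 / real R ^ m = e ^ (m + 2)"
  by (simp add: e_def power_add power_one_over power2_eq_square)

lemma cell_sub: "n \<le> m \<Longrightarrow> v div R ^ (m - n) = k \<Longrightarrow> cell a (e ^ 2) R m v \<subseteq> cell a (e ^ 2) R n k"
  using R512 by (intro cell_subset) auto

lemma cell_I0:
  assumes "k < R ^ n"
  shows "cell a (e ^ 2) R n k \<subseteq> I0"
proof -
  have "cell a (e ^ 2) R n k \<subseteq> cell a (e ^ 2) R 0 0"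
    using assms by (intro cell_sub) auto
  also have "\<dots> = I0"
    by (simp add: cell_def I0_def)
  finally show ?thesis .
qed

lemma cell_diam: "x \<in> cell a (e ^ 2) R n k \<Longrightarrow> y \<in> cell a (e ^ 2) R n k \<Longrightarrow> \<bar>x - y\<bar> \<le> e ^ (n + 2)"
proof -
  assume "x \<in> cell a (e ^ 2) R n k" "y \<in> cell a (e ^ 2) R n k"
  moreover have "cell a (e ^ 2) R n k = {a + e ^ (n + 2) * real k .. a + e ^ (n + 2) * (real k + 1)}"
  proof -
    have "e ^ 2 * y / real R ^ n = (e ^ 2 / real R ^ n) * y" for y
      by simp
    thus ?thesis
      unfolding cell_def cell_scale by (simp only:)
  qed
  ultimately show ?thesis
    by (simp add: algebra_simps abs_le_iff del: power_add power_Suc add_2_eq_Suc')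
qed

lemma left_end_cell: "a + e ^ 2 * real k / real R ^ n \<in> cell a (e ^ 2) R n k"
  by (simp add: cell_def divide_right_mono mult_left_mono)

text \<open>Within a cell of level \<open>n\<close>, the points in question form three tangential
  spots and one transversal spot for each of the \<open>18 M + 391\<close> small values of
  \<open>l\<close>.\<close>

lemma cost_near:
  assumes k: "k < R ^ n"
  shows "emeasure (node_measure R s) ({Suc n} \<times> {v. cell a (e ^ 2) R (Suc n) v \<inter>
      (cell a (e ^ 2) R n k \<inter> (tangential n \<union> (\<Union>l\<le>18 * M + 390. transversal_set (Suc n) l))) \<noteq> {}})
    \<le> ennreal (3 * (3 + real (18 * M + 391)) * real R powr (- (s * real (Suc n))))"
proof -
  let ?J = "cell a (e ^ 2) R n k"
  obtain E :: "nat \<Rightarrow> real set" where E: "?J \<inter> tangential n \<subseteq> (\<Union>b\<in>{..<3}. E b)"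
    "\<And>b x y. x \<in> E b \<Longrightarrow> y \<in> E b \<Longrightarrow> \<bar>x - y\<bar> \<le> e ^ (n + 3)"
    using tangential_spots[of "?J \<inter> tangential n" n] cell_diam by (metis IntD1 IntD2 subsetI)
  define W where "W = Inl ` {..<3::nat} \<union> Inr ` {..18 * M + 390}"
  define F where "F = (\<lambda>w. case w of Inl b \<Rightarrow> E b | Inr l \<Rightarrow> ?J \<inter> transversal_set (Suc n) l)"
  show ?thesis
  proof (rule emeasure_cells_meeting[of "e ^ 2" R W F "Suc n" _ a])
    show "\<bar>x - y\<bar> \<le> e ^ 2 / real R ^ Suc n" if w: "w \<in> W" "x \<in> F w" "y \<in> F w" for w x y
    proof (cases w)
      case (Inl b)
      thus ?thesis
        using w E(2)[of x b y] unfolding cell_scale by (simp add: F_def eval_nat_numeral)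
    next
      case (Inr l)
      obtain q1 p1 t1 A1 B1 C1 where 1: "transversal (Suc n) l x q1 p1 t1 A1 B1 C1"
        using w Inr by (auto simp: F_def transversal_set_def)
      obtain q2 p2 t2 A2 B2 C2 where 2: "transversal (Suc n) l y q2 p2 t2 A2 B2 C2"
        using w Inr by (auto simp: F_def transversal_set_def)
      have "\<bar>x - y\<bar> \<le> e ^ (n + 2)"
        using w Inr by (intro cell_diam) (auto simp: F_def)
      hence "\<bar>x - y\<bar> \<le> e ^ Suc (Suc n)"
        by simp
      from transversal_close[OF 1 2 this] show ?thesis
        unfolding cell_scale .
    qed
    have "card W \<le> card (Inl ` {..<3::nat} :: (nat + nat) set) + card (Inr ` {..18 * M + 390} :: (nat + nat) set)"
      unfolding W_def by (rule card_Un_le)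
    also have "\<dots> = 3 + (18 * M + 391)"
      by (simp add: card_image)
    finally show "real (card W) \<le> 3 + real (18 * M + 391)"
      by linarith
    have "?J \<inter> (tangential n \<union> (\<Union>l\<le>18 * M + 390. transversal_set (Suc n) l)) \<subseteq> (\<Union>w\<in>W. F w)"
      using E(1) by (fastforce simp: W_def F_def)
    thus "{Suc n} \<times> {v. cell a (e ^ 2) R (Suc n) v \<inter> (?J \<inter> (tangential n \<union> (\<Union>l\<le>18 * M + 390. transversal_set (Suc n) l))) \<noteq> {}}
        \<subseteq> {Suc n} \<times> {v. cell a (e ^ 2) R (Suc n) v \<inter> (\<Union>w\<in>W. F w) \<noteq> {}}"
      by blast
  qed (use R512 e_pos in \<open>auto simp: W_def\<close>)
qed

text \<open>The left end of the cell serves as base point of the count, since it shares the history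
  of the dangerous points.\<close>

lemma cost_far:
  assumes k: "k < R ^ n"
    and hist: "\<And>x q p t. x \<in> cell a (e ^ 2) R n k \<Longrightarrow> near x q p t \<Longrightarrow> e ^ 14 \<le> real q * real q powr j * e ^ n"
  shows "emeasure (node_measure R s) ({n + l} \<times> {v. cell a (e ^ 2) R (n + l) v \<inter>
      (cell a (e ^ 2) R n k \<inter> transversal_set (n + l) l) \<noteq> {}})
    \<le> ennreal (3 * real R powr (2 / 3 * real l + 3 * real M + 64) * real R powr (- (s * real (n + l))))"
proof -
  let ?J = "cell a (e ^ 2) R n k"
  let ?x0 = "a + e ^ 2 * real k / real R ^ n"
  have x0: "?x0 \<in> ?J"
    by (rule left_end_cell)
  obtain W :: "(int \<times> int \<times> int) set" and E where W: "finite W" "?J \<inter> transversal_set (n + l) l \<subseteq> (\<Union>w\<in>W. E w)"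
    "real (card W) \<le> real R powr (2 / 3 * real l + 3 * real M + 64)"
    "\<And>w x y. x \<in> E w \<Longrightarrow> y \<in> E w \<Longrightarrow> \<bar>x - y\<bar> \<le> e ^ (n + l + 2)"
  proof (rule transversal_count[of ?x0 "?J \<inter> transversal_set (n + l) l" n l])
    show "?x0 \<in> I0"
      using x0 cell_I0[OF k] by blast
    show "\<bar>x - ?x0\<bar> \<le> e ^ (n + 2)" if "x \<in> ?J \<inter> transversal_set (n + l) l" for x
      using that x0 by (intro cell_diam) auto
    show "\<bar>x - y\<bar> \<le> e ^ (n + 2)" if "x \<in> ?J \<inter> transversal_set (n + l) l" "y \<in> ?J \<inter> transversal_set (n + l) l" for x y
      using that by (intro cell_diam) auto
    show "e ^ 14 \<le> real q * real q powr j * e ^ n"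
      if "x \<in> insert ?x0 (?J \<inter> transversal_set (n + l) l)" "near x q p t" for x q p t
      using that x0 by (intro hist[of x q p t]) auto
  qed (auto simp: transversal_set_def)
  show ?thesis
  proof (rule emeasure_cells_meeting[of "e ^ 2" R W E "n + l" _ a, OF _ _ W(1) _ _ W(3)])
    show "\<bar>x - y\<bar> \<le> e ^ 2 / real R ^ (n + l)" if "x \<in> E w" "y \<in> E w" for w x y
      using W(4)[OF that] unfolding cell_scale .
    show "{n + l} \<times> {v. cell a (e ^ 2) R (n + l) v \<inter> (?J \<inter> transversal_set (n + l) l) \<noteq> {}}
        \<subseteq> {n + l} \<times> {v. cell a (e ^ 2) R (n + l) v \<inter> (\<Union>w\<in>W. E w) \<noteq> {}}"
      using W(2) by blast
  qed (use R512 e_pos in auto)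
qed

text \<open>Relative to the node, the near part costs \<open>(3 L + 12) R^(-5/6)\<close> and the far
  parts form a geometric series of sum at most \<open>6 R^(-5/6)\<close>; \<open>RM\<close> keeps
  the total below 1/4.\<close>

lemma removed_cost:
  assumes hist: "\<And>x q p t. k < R ^ n \<Longrightarrow> x \<in> cell a (e ^ 2) R n k \<Longrightarrow> near x q p t \<Longrightarrow>
      e ^ 14 \<le> real q * real q powr j * e ^ n"
  shows "emeasure (node_measure R s) (removed n k) \<le> ennreal (1 / 4 * real R powr (- (s * real n)))"
proof (cases "k < R ^ n")
  case False
  hence "removed n k = {}"
    by (auto simp: removed_def)
  thus ?thesis
    by simp
next
  case k: True
  let ?J = "cell a (e ^ 2) R n k"
  let ?M = "node_measure R s"
  define L where "L = 18 * M + 390"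
  define r where "r = real R"
  have r: "512 \<le> r" "1 \<le> r" "0 < r"
    using R512 by (auto simp: r_def)
  define Z1 where "Z1 = {Suc n} \<times> {v. cell a (e ^ 2) R (Suc n) v \<inter>
      (?J \<inter> (tangential n \<union> (\<Union>l\<le>L. transversal_set (Suc n) l))) \<noteq> {}}"
  define Z2 where "Z2 t = {n + (L + 1 + t)} \<times> {v. cell a (e ^ 2) R (n + (L + 1 + t)) v \<inter>
      (?J \<inter> transversal_set (n + (L + 1 + t)) (L + 1 + t)) \<noteq> {}}" for t
  have sub: "removed n k \<subseteq> Z1 \<union> (\<Union>t. Z2 t)"
  proof
    fix z assume z: "z \<in> removed n k"
    then obtain m v x where mv: "z = (m, v)" "n < m" "v div R ^ (m - n) = k" "x \<in> cell a (e ^ 2) R m v" "x \<in> dangerous n m"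
      by (auto simp: removed_def)
    have xJ: "x \<in> ?J"
      using cell_sub[of n m v k] mv by auto
    from mv(5) consider "m = Suc n" "x \<in> tangential n \<union> (\<Union>l\<le>L. transversal_set (Suc n) l)"
      | "n + L < m" "x \<in> transversal_set m (m - n)"
      by (auto simp: dangerous_def L_def split: if_splits)
    thus "z \<in> Z1 \<union> (\<Union>t. Z2 t)"
    proof cases
      case 1
      thus ?thesis
        using mv xJ by (auto simp: Z1_def)
    next
      case 2
      define t where "t = m - n - (L + 1)"
      have "m = n + (L + 1 + t)" "m - n = L + 1 + t"
        using 2(1) by (auto simp: t_def)
      hence "z \<in> Z2 t"
        using mv xJ 2(2) unfolding Z2_def by auto
      thus ?thesis
        by blast
    qed
  qed
  have Z1: "emeasure ?M Z1 \<le> ennreal ((3 * real L + 12) * r powr - (5 / 6) * r powr - (s * real n))"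
  proof -
    have "emeasure ?M Z1 \<le> ennreal (3 * (3 + real (18 * M + 391)) * real R powr (- (s * real (Suc n))))"
      unfolding Z1_def L_def by (rule cost_near[OF k])
    also have "3 * (3 + real (18 * M + 391)) * real R powr (- (s * real (Suc n))) =
        (3 * real L + 12) * (r powr - s * r powr - (s * real n))"
      by (simp add: L_def r_def algebra_simps flip: powr_add)
    also have "ennreal \<dots> \<le> ennreal ((3 * real L + 12) * (r powr - (5 / 6) * r powr - (s * real n)))"
      using r s by (intro ennreal_leI mult_left_mono mult_right_mono powr_mono) auto
    finally show ?thesis
      by (simp add: mult.assoc)
  qed
  have r6: "r powr - (1 / 6) \<le> 1 / 2"
  proof -
    have "(2::real) = 64 powr (1 / 6)"
      using powr_powr[of 2 6 "1 / 6"] by simp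
    also have "\<dots> \<le> r powr (1 / 6)"
      using r by (intro powr_mono2) auto
    finally show ?thesis
      using r by (simp add: powr_minus field_simps)
  qed
  have Z2: "emeasure ?M (Z2 t) \<le> ennreal (3 * r powr - (5 / 6) * r powr - (s * real n) * (1 / 2) ^ t)" for t
  proof -
    define l where "l = L + 1 + t"
    have "emeasure ?M (Z2 t) \<le> ennreal (3 * r powr (2 / 3 * real l + 3 * real M + 64) * r powr (- (s * real (n + l))))"
      unfolding Z2_def l_def r_def by (rule cost_far[OF k]) (use hist k in blast)
    also have "3 * r powr (2 / 3 * real l + 3 * real M + 64) * r powr (- (s * real (n + l))) =
        3 * (r powr (2 / 3 * real l + 3 * real M + 64 + - (s * real (n + l))))"
      by (simp only: powr_add mult.assoc)
    also have "ennreal \<dots> \<le> ennreal (3 * r powr (- (5 / 6) + - (s * real n) + - (1 / 6) * real t))"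
    proof (intro ennreal_leI mult_left_mono powr_mono)
      \<comment> \<open>As \<open>2/3 l - s l \<le> - l/6\<close> and
        \<open>l = 18 M + 391 + t\<close>, the constant \<open>3 M + 64\<close> is beaten with
        \<open>5/6 + t/6\<close> to spare; this is the origin of 18 and 390.\<close>
      have "5 / 6 * real l \<le> s * real l"
        using s by (intro mult_right_mono) auto
      thus "2 / 3 * real l + 3 * real M + 64 + - (s * real (n + l)) \<le> - (5 / 6) + - (s * real n) + - (1 / 6) * real t"
        by (simp add: l_def L_def algebra_simps)
    qed (use r in auto)
    also have "r powr (- (5 / 6) + - (s * real n) + - (1 / 6) * real t) =
        r powr - (5 / 6) * r powr - (s * real n) * (r powr - (1 / 6)) ^ t"
      using r by (simp only: powr_add powr_powr [symmetric] powr_realpow powr_gt_zero)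
    also have "ennreal (3 * (r powr - (5 / 6) * r powr - (s * real n) * (r powr - (1 / 6)) ^ t)) \<le>
        ennreal (3 * (r powr - (5 / 6) * r powr - (s * real n) * (1 / 2) ^ t))"
      using r6 r by (intro ennreal_leI mult_left_mono power_mono) auto
    finally show ?thesis
      by (simp add: mult.assoc)
  qed
  have "emeasure ?M (\<Union>t. Z2 t) \<le> (\<Sum>t. emeasure ?M (Z2 t))"
    by (rule emeasure_subadditive_countably) auto
  also have "\<dots> \<le> (\<Sum>t. ennreal (3 * r powr - (5 / 6) * r powr - (s * real n) * (1 / 2) ^ t))"
    by (intro suminf_le Z2) auto
  also have "\<dots> = ennreal (2 * (3 * r powr - (5 / 6) * r powr - (s * real n)))"
    by (rule geometric_ennreal) auto
  finally have Z2s: "emeasure ?M (\<Union>t. Z2 t) \<le> ennreal (2 * (3 * r powr - (5 / 6) * r powr - (s * real n)))" .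
  have "emeasure ?M (removed n k) \<le> emeasure ?M (Z1 \<union> (\<Union>t. Z2 t))"
    by (rule emeasure_mono[OF sub]) auto
  also have "\<dots> \<le> emeasure ?M Z1 + emeasure ?M (\<Union>t. Z2 t)"
    by (rule emeasure_subadditive) auto
  also have "\<dots> \<le> ennreal ((3 * real L + 12) * r powr - (5 / 6) * r powr - (s * real n)) +
      ennreal (2 * (3 * r powr - (5 / 6) * r powr - (s * real n)))"
    by (intro add_mono Z1 Z2s)
  also have "\<dots> = ennreal (((3 * real L + 18) * r powr - (5 / 6)) * r powr - (s * real n))"
    by (subst ennreal_plus [symmetric]) (auto simp: algebra_simps)
  also have "\<dots> \<le> ennreal (1 / 4 * r powr - (s * real n))"
  proof (intro ennreal_leI mult_right_mono)
    have "4 * (3 * real L + 18) \<le> r powr (5 / 6)"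
      using RM by (simp add: L_def r_def)
    thus "(3 * real L + 18) * r powr - (5 / 6) \<le> 1 / 4"
      using r by (simp add: powr_minus field_simps)
  qed auto
  finally show ?thesis
    by (simp add: r_def)
qed

section \<open>A point avoiding everything removed\<close>

text \<open>The prescribed nodes \<open>V\<close> are charged to the root together with its own
  removals; each of the two takes a quarter of the node weight, hence \<open>d = 1/2\<close> in
  \<open>radic_path\<close>.\<close>

lemma good_point:
  assumes V: "emeasure (node_measure R s) V \<le> ennreal (1 / 4)"
  obtains x where "x \<in> I0" "\<And>q p t. \<not> near x q p t" "\<And>m. 0 < m \<Longrightarrow> \<exists>v. x \<in> cell a (e ^ 2) R m v \<and> (m, v) \<notin> V"
proof -
  define Rem where "Rem n k = removed n k \<union> (if n = 0 then V else {})" for n k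
  have bound: "emeasure (node_measure R s) (Rem n k) \<le> ennreal (1 / 2 * real R powr (- (s * real n)))"
    if legal: "\<And>n' m. n' < m \<Longrightarrow> m \<le> n \<Longrightarrow> (m, k div R ^ (n - m)) \<notin> Rem n' (k div R ^ (n - n'))" for n k
  proof -
    have rem: "emeasure (node_measure R s) (removed n k) \<le> ennreal (1 / 4 * real R powr (- (s * real n)))"
    proof (rule removed_cost)
      fix x q p t assume k: "k < R ^ n" and x: "x \<in> cell a (e ^ 2) R n k" and near: "near x q p t"
      obtain n' m where nm: "n' < m" "x \<in> dangerous n' m" "e ^ 14 \<le> real q * real q powr j * e ^ (m - 1)"
        using near_dangerous[OF near] .
      \<comment> \<open>Otherwise the ancestor of level \<open>m\<close> would contain
        \<open>x\<close> and be removed, against \<open>legal\<close>.\<close>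
      have "n < m"
      proof (rule ccontr)
        assume "\<not> n < m"
        hence mn: "m \<le> n"
          by simp
        have "x \<in> cell a (e ^ 2) R m (k div R ^ (n - m))"
          using cell_sub[OF mn refl] x by blast
        moreover have "k div R ^ (n - n') < R ^ n'"
        proof -
          have "R ^ (n - n') * R ^ n' = R ^ n"
            using nm mn by (simp flip: power_add)
          thus ?thesis
            using k by (simp add: less_mult_imp_div_less mult.commute)
        qed
        ultimately have "(m, k div R ^ (n - m)) \<in> removed n' (k div R ^ (n - n'))"
          using nm mn div_pow_div_pow[of n' m n k] by (auto simp: removed_def)
        thus False
          using legal[OF nm(1) mn] by (simp add: Rem_def)
      qed
      hence "real q * real q powr j * e ^ (m - 1) \<le> real q * real q powr j * e ^ n"
        by (intro mult_left_mono e_pow_mono) auto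
      thus "e ^ 14 \<le> real q * real q powr j * e ^ n"
        using nm by linarith
    qed
    have V': "emeasure (node_measure R s) (if n = 0 then V else {}) \<le> ennreal (1 / 4 * real R powr (- (s * real n)))"
      using V R512 by simp
    have "emeasure (node_measure R s) (Rem n k) \<le> emeasure (node_measure R s) (removed n k)
        + emeasure (node_measure R s) (if n = 0 then V else {})"
      unfolding Rem_def by (rule emeasure_subadditive) auto
    also have "\<dots> \<le> ennreal (1 / 4 * real R powr (- (s * real n))) + ennreal (1 / 4 * real R powr (- (s * real n)))"
      by (intro add_mono rem V')
    also have "\<dots> = ennreal (1 / 2 * real R powr (- (s * real n)))"
      by (subst ennreal_plus [symmetric]) auto
    finally show ?thesis .
  qed
  obtain k where k: "k 0 = 0" "\<And>n. k (Suc n) div R = k n" "\<And>n m. n < m \<Longrightarrow> (m, k m) \<notin> Rem n (k n)"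
    using radic_path[of R "1 / 2" s Rem] bound Rs R512 by auto
  note anc = ancestor_div[of k R, OF k(2)]
  have kR: "k n < R ^ n" for n
    using anc[of 0 n] k(1) R512 by (simp add: div_eq_0_iff)
  have "(\<Inter>n. cell a (e ^ 2) R n (k n)) \<noteq> {}"
  proof (rule compact_nest)
    show "compact (cell a (e ^ 2) R n (k n))" for n
      by (simp add: cell_def)
    show "cell a (e ^ 2) R n (k n) \<noteq> {}" for n
      using left_end_cell by blast
    show "cell a (e ^ 2) R n (k n) \<subseteq> cell a (e ^ 2) R m (k m)" if "m \<le> n" for m n
      using cell_sub[OF that anc[OF that]] .
  qed
  then obtain x where x: "\<And>n. x \<in> cell a (e ^ 2) R n (k n)"
    by auto
  show thesis
  proof (rule that)
    show "x \<in> I0"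
      using x[of 0] cell_I0[OF kR] by blast
    show "\<not> near x q p t" for q p t
    proof
      assume "near x q p t"
      then obtain n m where nm: "n < m" "x \<in> dangerous n m"
        using near_dangerous by blast
      hence "(m, k m) \<in> removed n (k n)"
        using x[of m] anc[of n m] kR[of n] by (auto simp: removed_def)
      thus False
        using k(3)[OF nm(1)] by (simp add: Rem_def)
    qed
    \<comment> \<open>\<open>radic_path\<close> avoids only levels strictly after the charging
      level, so nothing is claimed at level 0.\<close>
    show "\<exists>v. x \<in> cell a (e ^ 2) R m v \<and> (m, v) \<notin> V" if "0 < m" for m
      using x[of m] k(3)[OF that] by (auto simp: Rem_def)
  qed
qed

section \<open>Hausdorff measure\<close>

text \<open>A piece of diameter about \<open>e^(m+2)\<close> is paid for at level \<open>m\<close>;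
  the factor \<open>R^3\<close> comes from rounding to an R-adic scale and from the arc length
  \<open>e^2\<close>. The bound \<open>d \<le> e^3\<close> keeps \<open>m\<close> positive, as
  \<open>good_point\<close> requires.\<close>

lemma scale_for_diameter:
  assumes d: "0 \<le> d" "d \<le> e ^ 3" and s0: "0 \<le> s0" "s0 \<le> s" "s \<le> 1" and \<eta>: "0 < \<eta>"
  obtains m where "0 < m" "d \<le> e ^ (m + 2)"
    "real R powr - (s * real m) \<le> real R ^ 3 * d powr s0 + \<eta>"
proof (cases "d = 0")
  \<comment> \<open>A piece of diameter zero is free in \<open>hausdorff_content\<close>, as
    \<open>0 powr s0 = 0\<close> even for \<open>s0 = 0\<close>; here it is given a level deep
    enough for a node to weigh at most \<eta>.\<close>
  case True
  have "real R powr - s < 1"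
    using R512 s by (simp add: powr_minus field_simps gr_one_powr)
  then obtain m where m: "(real R powr - s) ^ m < \<eta>"
    using real_arch_pow_inv[OF \<eta>] by blast
  have "(real R powr - s) ^ Suc m \<le> (real R powr - s) ^ m"
    using \<open>real R powr - s < 1\<close> by (intro power_decreasing) auto
  hence "(real R powr - s) ^ Suc m \<le> \<eta>"
    using m by linarith
  moreover have "real R powr - (s * real (Suc m)) = (real R powr - s) ^ Suc m"
    using R512 by (simp only: powr_powr [symmetric] powr_realpow powr_gt_zero mult_minus_left [symmetric])
  ultimately have "real R powr - (s * real (Suc m)) \<le> \<eta>"
    by simp
  thus thesis
    using that[of "Suc m"] True by simp
next
  case False
  hence d0: "0 < d"
    using d by simp
  have "e ^ 3 \<le> e ^ 2"
    by (rule e_pow_mono) simp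
  hence "1 \<le> e ^ 2 / d"
    using d d0 by (simp add: le_divide_eq)
  then obtain m where m: "1 \<le> e ^ 2 / d * e ^ m" "e ^ 2 / d * e ^ Suc m < 1"
    by (rule e_bracket)
  have m1: "d \<le> e ^ (m + 2)" "e ^ (m + 3) < d"
    using m d0 by (simp_all add: field_simps eval_nat_numeral)
  have m0: "0 < m"
  proof (rule ccontr)
    assume "\<not> 0 < m"
    thus False
      using m1(2) d by simp
  qed
  have d1: "d \<le> 1"
    using d e_pow_mono[of 0 3] by simp
  have "real R ^ 3 * e ^ (m + 3) = (real R * e) ^ 3 * e ^ m"
    by (simp only: power_add power_mult_distrib mult_ac)
  hence em: "e ^ m = real R ^ 3 * e ^ (m + 3)"
    by (simp only: e_R) simp
  have "real R powr - (s * real m) = (e ^ m) powr s"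
    using R512 by (simp add: e_powr powr_powr mult.commute)
  also have "\<dots> \<le> (real R ^ 3 * d) powr s"
    using m1 s R512 em by (intro powr_mono2) auto
  also have "\<dots> = (real R ^ 3) powr s * d powr s"
    using d R512 by (intro powr_mult)
  also have "\<dots> \<le> (real R ^ 3) powr 1 * d powr s0"
    using R512 d0 d1 s0 by (intro mult_mono powr_mono powr_mono') (auto simp: one_le_power)
  finally have "real R powr - (s * real m) \<le> real R ^ 3 * d powr s0"
    using R512 by simp
  thus thesis
    using that[of m] m0 m1 \<eta> by simp
qed

text \<open>The cells meeting a given cover are removed along with the dangerous ones; the surviving point
  contradicts the cover.\<close>

lemma hausdorff_measure_pos:
  assumes A: "\<And>x. x \<in> I0 \<Longrightarrow> (\<And>q p t. \<not> near x q p t) \<Longrightarrow> (x, f x) \<in> A"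
    and s0: "0 \<le> s0" "s0 \<le> s" "s \<le> 1"
  shows "hausdorff_measure s0 A \<noteq> 0"
proof
  assume "hausdorff_measure s0 A = 0"
  \<comment> \<open>The budget 1/4 of \<open>good_point\<close> is split: with three nodes per piece
    and the factor \<open>R^3\<close>, the diameters take 3/24 = 1/8, and three times the surcharges
    \<open>1/48 (1/2)^k\<close> add up to another 1/8.\<close>
  moreover have "0 < 1 / (24 * real R ^ 3)"
    using R512 by simp
  ultimately obtain U :: "nat \<Rightarrow> (real \<times> real) set" where U: "A \<subseteq> (\<Union>k. U k)" "\<And>k. bounded (U k)"
    "\<And>k. diameter (U k) \<le> e ^ 3" "(\<Sum>k. ennreal (diameter (U k) powr s0)) < ennreal (1 / (24 * real R ^ 3))"
    using hausdorff_measure_zero_cover[OF _ e_pow_pos[of 3]] by metis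
  define d where "d k = diameter (U k)" for k
  have d0: "0 \<le> d k" for k
    unfolding d_def by (rule diameter_ge_0[OF U(2)])
  have "\<exists>m. 0 < m \<and> d k \<le> e ^ (m + 2) \<and>
      real R powr - (s * real m) \<le> real R ^ 3 * d k powr s0 + 1 / 48 * (1 / 2) ^ k" for k
    by (rule scale_for_diameter[of "d k" s0 "1 / 48 * (1 / 2) ^ k"]) (use d0 U(3) s0 in \<open>auto simp: d_def\<close>)
  then obtain m where m: "\<And>k. 0 < m k" "\<And>k. d k \<le> e ^ (m k + 2)"
      "\<And>k. real R powr - (s * real (m k)) \<le> real R ^ 3 * d k powr s0 + 1 / 48 * (1 / 2) ^ k"
    by metis
  define T where "T k = {x. (x, f x) \<in> U k}" for k
  define Vk where "Vk k = {m k} \<times> {v. cell a (e ^ 2) R (m k) v \<inter> T k \<noteq> {}}" for k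
  have Tk: "\<bar>x - y\<bar> \<le> e ^ 2 / real R ^ m k" if "x \<in> T k" "y \<in> T k" for k x y
  proof -
    have "\<bar>x - y\<bar> = dist (fst (x, f x)) (fst (y, f y))"
      by (simp add: dist_real_def)
    also have "\<dots> \<le> dist (x, f x) (y, f y)"
      by (rule dist_fst_le)
    also have "\<dots> \<le> d k"
      unfolding d_def using that by (intro diameter_bounded_bound U) (auto simp: T_def)
    finally show ?thesis
      using m(2)[of k] unfolding cell_scale by linarith
  qed
  have Vk: "emeasure (node_measure R s) (Vk k) \<le>
      ennreal (3 * real R ^ 3) * ennreal (d k powr s0) + ennreal (1 / 16 * (1 / 2) ^ k)" for k
  proof -
    have "emeasure (node_measure R s) (Vk k) \<le> ennreal (3 * 1 * real R powr - (s * real (m k)))"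
    proof (rule emeasure_cells_meeting[of "e ^ 2" R "{()}" "\<lambda>_. T k" "m k" "Vk k" a 1 s])
      show "Vk k \<subseteq> {m k} \<times> {v. cell a (e ^ 2) R (m k) v \<inter> (\<Union>b\<in>{()}. T k) \<noteq> {}}"
        by (simp add: Vk_def)
    qed (use R512 e_pos Tk in auto)
    also have "\<dots> \<le> ennreal (3 * real R ^ 3 * d k powr s0 + 1 / 16 * (1 / 2) ^ k)"
      using m(3)[of k] by (intro ennreal_leI) simp
    also have "\<dots> = ennreal (3 * real R ^ 3) * ennreal (d k powr s0) + ennreal (1 / 16 * (1 / 2) ^ k)"
      by (subst ennreal_plus) (auto simp: ennreal_mult)
    finally show ?thesis .
  qed
  have "emeasure (node_measure R s) (\<Union>k. Vk k) \<le> (\<Sum>k. emeasure (node_measure R s) (Vk k))"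
    by (rule emeasure_subadditive_countably) auto
  also have "\<dots> \<le> (\<Sum>k. ennreal (3 * real R ^ 3) * ennreal (d k powr s0) + ennreal (1 / 16 * (1 / 2) ^ k))"
    by (intro suminf_le Vk) auto
  also have "\<dots> = (\<Sum>k. ennreal (3 * real R ^ 3) * ennreal (d k powr s0)) + (\<Sum>k. ennreal (1 / 16 * (1 / 2) ^ k))"
    by (rule suminf_add [symmetric]) (rule summableI)+
  also have "(\<Sum>k. ennreal (1 / 16 * (1 / 2) ^ k)) = ennreal (2 * (1 / 16))"
    by (rule geometric_ennreal) simp
  also have "(\<Sum>k. ennreal (3 * real R ^ 3) * ennreal (d k powr s0)) = ennreal (3 * real R ^ 3) * (\<Sum>k. ennreal (d k powr s0))"
    by (rule ennreal_suminf_cmult)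
  also have "ennreal (3 * real R ^ 3) * (\<Sum>k. ennreal (d k powr s0)) + ennreal (2 * (1 / 16))
      \<le> ennreal (3 * real R ^ 3) * ennreal (1 / (24 * real R ^ 3)) + ennreal (2 * (1 / 16))"
    using U(4) by (intro add_mono mult_left_mono) (simp_all add: d_def)
  also have "ennreal (3 * real R ^ 3) * ennreal (1 / (24 * real R ^ 3)) = ennreal (3 * real R ^ 3 * (1 / (24 * real R ^ 3)))"
    by (rule ennreal_mult [symmetric]) auto
  also have "3 * real R ^ 3 * (1 / (24 * real R ^ 3)) = (1 / 8 :: real)"
    using R512 by simp
  also have "ennreal (1 / 8) + ennreal (2 * (1 / 16)) = ennreal (1 / 4)"
    by (subst ennreal_plus [symmetric]) auto
  finally have V: "emeasure (node_measure R s) (\<Union>k. Vk k) \<le> ennreal (1 / 4)" .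
  obtain x where x: "x \<in> I0" "\<And>q p t. \<not> near x q p t"
      "\<And>m. 0 < m \<Longrightarrow> \<exists>v. x \<in> cell a (e ^ 2) R m v \<and> (m, v) \<notin> (\<Union>k. Vk k)"
    using good_point[OF V] by metis
  have "(x, f x) \<in> A"
    by (rule A) (use x in auto)
  then obtain k where "x \<in> T k"
    using U(1) by (auto simp: T_def)
  moreover obtain v where "x \<in> cell a (e ^ 2) R (m k) v" "(m k, v) \<notin> Vk k"
    using x(3)[OF m(1)[of k]] by blast
  ultimately show False
    by (auto simp: Vk_def)
qed

text \<open>Rounding provides the candidates \<open>p\<close>, \<open>t\<close>. One constant must
  serve both coordinates; \<open>(e^24)^(1/i)\<close> is the smaller root because
  \<open>i \<le> j\<close>.\<close>

lemma not_near_Bad: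
  assumes x: "x \<in> I0" and nn: "\<And>q p t. \<not> near x q p t"
  shows "(x, f x) \<in> Bad i j"
proof -
  define c where "c = (e ^ 24) powr (1 / i)"
  have cj: "c \<le> (e ^ 24) powr (1 / j)"
    unfolding c_def using ij j_lt e_pow_mono[of 0 24]
    by (intro powr_mono') (auto simp: frac_le)
  have "c / real q < max (wpow (dist_int (real q * x)) i) (wpow (dist_int (real q * f x)) j)" if q: "1 \<le> q" for q
  proof -
    have root: "(e ^ 24) powr (1 / u) / real q < wpow y u" if "e ^ 24 * real q powr - u < y" "0 < u" for u y
    proof -
      have "(e ^ 24) powr (1 / u) / real q = (e ^ 24 * real q powr - u) powr (1 / u)"
        using that q by (simp add: powr_mult powr_powr powr_minus_divide powr_divide)
      also have "\<dots> < y powr (1 / u)"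
        using that by (intro powr_less_mono2) auto
      finally show ?thesis
        using that by (simp add: wpow_def)
    qed
    have "e ^ 24 * real q powr - i < dist_int (real q * x) \<or> e ^ 24 * real q powr - j < dist_int (real q * f x)"
      using nn[of q "round (real q * x)" "round (real q * f x)"] x q by (auto simp: near_def dist_int_def)
    thus ?thesis
    proof
      assume "e ^ 24 * real q powr - i < dist_int (real q * x)"
      from root[OF this ij(1)] show ?thesis
        by (simp add: c_def)
    next
      assume "e ^ 24 * real q powr - j < dist_int (real q * f x)"
      from root[OF this j_lt(2)] divide_right_mono[OF cj, of "real q"] show ?thesis
        by simp
    qed
  qed
  moreover have "c > 0"
    using e_pos by (simp add: c_def)
  ultimately show ?thesis
    unfolding Bad_def by auto
qed

end

section \<open>Choice of the arc and of the constants\<close>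

text \<open>The given point with \<open>f2 \<noteq> 0\<close> may be an endpoint of
  \<open>I\<close>, so one moves to a nearby interior point. On an open set around it
  \<open>f1\<close> cannot vanish identically; a zero-free \<open>f1\<close> is wanted because
  \<open>B\<close> is estimated from the slope by dividing by it. Compactness gives \<open>g\<close>
  and \<open>K\<close>.\<close>

lemma nondegenerate_subarc:
  assumes "C2_nondegenerate_curve C"
  obtains f f1 f2 :: "real \<Rightarrow> real" and a b g K where "a < b" "0 < g" "g \<le> 1" "1 \<le> K"
    "\<forall>x\<in>{a..b}. (f has_real_derivative f1 x) (at x)"
    "\<forall>x\<in>{a..b}. (f1 has_real_derivative f2 x) (at x)"
    "\<forall>x\<in>{a..b}. g \<le> \<bar>f1 x\<bar> \<and> \<bar>f1 x\<bar> \<le> K"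
    "\<forall>x\<in>{a..b}. g \<le> \<bar>f2 x\<bar> \<and> \<bar>f2 x\<bar> \<le> K"
    "\<forall>x\<in>{a..b}. (x, f x) \<in> C"
proof -
  obtain I f f1 f2 where I: "is_interval I" "interior I \<noteq> {}" "C = {(x, f x) | x. x \<in> I}"
    and D1: "\<forall>x\<in>I. (f has_real_derivative f1 x) (at x within I)"
    and D2: "\<forall>x\<in>I. (f1 has_real_derivative f2 x) (at x within I)"
    and c2: "continuous_on I f2" and nz: "\<exists>x\<in>I. f2 x \<noteq> 0"
    using assms unfolding C2_nondegenerate_curve_def by (elim exE conjE) (rule that; assumption)
  note d1 = bspec[OF D1] and d2 = bspec[OF D2]
  have at: "at x within I = at x" if "x \<in> interior I" for x
    using that by (rule at_within_interior)
  have d1': "(f has_real_derivative f1 x) (at x)" if "x \<in> interior I" for x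
    using d1[of x] at[OF that] that interior_subset by force
  have d2': "(f1 has_real_derivative f2 x) (at x)" if "x \<in> interior I" for x
    using d2[of x] at[OF that] that interior_subset by force
  obtain x0 where x0: "x0 \<in> I" "f2 x0 \<noteq> 0"
    using nz by blast
  obtain S where S: "open S" "S \<inter> I = {x \<in> I. f2 x \<noteq> 0}"
  proof -
    have "openin (top_of_set I) (I \<inter> f2 -` (- {0}))"
      by (rule continuous_openin_preimage_gen[OF c2]) auto
    then obtain S where "open S" "I \<inter> f2 -` (- {0}) = I \<inter> S"
      by (auto simp: openin_open)
    thus thesis
      using that[of S] by auto
  qed
  have "x0 \<in> closure (interior I)"
    using convex_closure_interior[of I] I x0 closure_subset by (auto simp: is_interval_convex)
  moreover have "x0 \<in> S"
    using S x0 by auto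
  ultimately obtain x1 where x1: "x1 \<in> interior I" "x1 \<in> S"
    using S(1) by (metis closure_iff_nhds_not_empty disjoint_iff subset_refl)
  define P where "P = interior I \<inter> S"
  have P: "open P" "x1 \<in> P" "P \<subseteq> interior I"
    using S x1 by (auto simp: P_def)
  have f2P: "f2 x \<noteq> 0" if "x \<in> P" for x
    using that S(2) interior_subset[of I] unfolding P_def by blast
  have "\<exists>x\<in>P. f1 x \<noteq> 0"
  proof (rule ccontr)
    assume "\<not> ?thesis"
    hence "((\<lambda>_. 0) has_real_derivative f2 x1) (at x1)"
      using has_field_derivative_transform_within_open[OF d2'[of x1] P(1,2)] P by (simp add: x1)
    hence "f2 x1 = 0"
      using DERIV_unique DERIV_const by blast
    thus False
      using f2P P by blast
  qed
  then obtain x2 where x2: "x2 \<in> P" "f1 x2 \<noteq> 0"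
    by blast
  have contf1: "continuous_on P f1"
    using d2' P by (intro continuous_at_imp_continuous_on ballI) (meson DERIV_isCont subsetD)
  have contf2: "continuous_on P f2"
    using c2 P interior_subset continuous_on_subset by (meson order_trans)
  have "open {x \<in> P. f1 x \<noteq> 0}"
  proof -
    have "open (P \<inter> f1 -` (- {0}))"
      by (rule continuous_open_preimage[OF contf1 P(1)]) auto
    moreover have "P \<inter> f1 -` (- {0}) = {x \<in> P. f1 x \<noteq> 0}"
      by auto
    ultimately show ?thesis
      by simp
  qed
  then obtain \<epsilon> where eps: "\<epsilon> > 0" "cball x2 \<epsilon> \<subseteq> {x \<in> P. f1 x \<noteq> 0}"
    using x2 open_contains_cball[of "{x \<in> P. f1 x \<noteq> 0}"] by blast
  define a where "a = x2"
  define b where "b = x2 + \<epsilon>"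
  have ab: "a < b" "{a..b} \<subseteq> {x \<in> P. f1 x \<noteq> 0}"
  proof -
    have "{a..b} \<subseteq> cball x2 \<epsilon>"
      by (auto simp: a_def b_def dist_real_def)
    with eps show "{a..b} \<subseteq> {x \<in> P. f1 x \<noteq> 0}"
      by blast
  qed (use eps in \<open>simp add: a_def b_def\<close>)
  have two_sided: "\<exists>m M. 0 < m \<and> (\<forall>x\<in>{a..b}. m \<le> \<bar>h x\<bar> \<and> \<bar>h x\<bar> \<le> M)"
    if h: "continuous_on {a..b} h" "\<And>x. x \<in> {a..b} \<Longrightarrow> h x \<noteq> 0" for h :: "real \<Rightarrow> real"
  proof -
    have ne: "compact {a..b}" "{a..b} \<noteq> {}"
      using ab by auto
    have ch: "continuous_on {a..b} (\<lambda>x. \<bar>h x\<bar>)"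
      using h by (intro continuous_intros)
    obtain u where "u \<in> {a..b}" "\<forall>x\<in>{a..b}. \<bar>h u\<bar> \<le> \<bar>h x\<bar>"
      using continuous_attains_inf[OF ne ch] by blast
    moreover obtain v where "v \<in> {a..b}" "\<forall>x\<in>{a..b}. \<bar>h x\<bar> \<le> \<bar>h v\<bar>"
      using continuous_attains_sup[OF ne ch] by blast
    moreover have "0 < \<bar>h u\<bar>"
      using h(2)[of u] calculation by auto
    ultimately show ?thesis
      by blast
  qed
  obtain m1 M1 where m1: "0 < m1" "\<And>x. x \<in> {a..b} \<Longrightarrow> m1 \<le> \<bar>f1 x\<bar> \<and> \<bar>f1 x\<bar> \<le> M1"
    using two_sided[of f1] continuous_on_subset[OF contf1] ab by blast
  obtain m2 M2 where m2: "0 < m2" "\<And>x. x \<in> {a..b} \<Longrightarrow> m2 \<le> \<bar>f2 x\<bar> \<and> \<bar>f2 x\<bar> \<le> M2"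
    using two_sided[of f2] continuous_on_subset[OF contf2] ab f2P by blast
  show thesis
  proof (rule that[of a b "min 1 (min m1 m2)" "max 1 (max M1 M2)" f f1 f2])
    have xI: "x \<in> interior I" if "x \<in> {a..b}" for x
      using ab P that by blast
    show "\<forall>x\<in>{a..b}. (f has_real_derivative f1 x) (at x)" "\<forall>x\<in>{a..b}. (f1 has_real_derivative f2 x) (at x)"
      using d1' d2' xI by auto
    show "\<forall>x\<in>{a..b}. (x, f x) \<in> C"
      using xI interior_subset I(3) by blast
    show "\<forall>x\<in>{a..b}. min 1 (min m1 m2) \<le> \<bar>f1 x\<bar> \<and> \<bar>f1 x\<bar> \<le> max 1 (max M1 M2)"
      "\<forall>x\<in>{a..b}. min 1 (min m1 m2) \<le> \<bar>f2 x\<bar> \<and> \<bar>f2 x\<bar> \<le> max 1 (max M1 M2)"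
      using m1(2) m2(2) by fastforce+
  qed (use ab m1 m2 in auto)
qed

lemma eventually_powr_ge:
  assumes "0 < t"
  shows "eventually (\<lambda>R::nat. X \<le> real R powr t) sequentially"
proof -
  have "filterlim (\<lambda>R::nat. real R powr t) at_top sequentially"
    using filterlim_compose[OF real_powr_at_top[OF assms] filterlim_real_sequentially] .
  thus ?thesis
    by (simp add: filterlim_at_top)
qed

theorem theorem3:
  fixes i j :: real and C :: "(real \<times> real) set"
  assumes "0 < i" and "i \<le> j" and "j < 1" and "i + j = 1"
    and "C2_nondegenerate_curve C"
  shows "hausdorff_dim (Bad i j \<inter> C) \<ge> 1"
proof -
  obtain a b g K :: real and f f1 f2 :: "real \<Rightarrow> real" where arc: "a < b" "0 < g" "g \<le> 1" "1 \<le> K"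
    "\<forall>x\<in>{a..b}. (f has_real_derivative f1 x) (at x)"
    "\<forall>x\<in>{a..b}. (f1 has_real_derivative f2 x) (at x)"
    "\<forall>x\<in>{a..b}. g \<le> \<bar>f1 x\<bar> \<and> \<bar>f1 x\<bar> \<le> K"
    "\<forall>x\<in>{a..b}. g \<le> \<bar>f2 x\<bar> \<and> \<bar>f2 x\<bar> \<le> K"
    "\<forall>x\<in>{a..b}. (x, f x) \<in> C"
    by (rule nondegenerate_subarc[OF assms(5)]) (rule that; assumption)
  have pos: "hausdorff_measure s0 (Bad i j \<inter> C) \<noteq> 0" if s0: "0 \<le> s0" "s0 < 1" for s0
  proof -
    \<comment> \<open>The cost estimates need \<open>s \<ge> 5/6\<close>; a smaller
      \<open>s0\<close> is served by this \<open>s\<close>, as \<open>hausdorff_measure_pos\<close>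
      allows.\<close>
    define s where "s = max s0 (5 / 6)"
    have s: "5 / 6 \<le> s" "s < 1" "s0 \<le> s"
      using s0 by (auto simp: s_def)
    define M where "M = nat \<lceil>25 / i\<rceil>"
    have "25 / i \<le> real M"
      by (simp add: M_def real_nat_ceiling_ge)
    hence M: "25 \<le> i * real M"
      using assms(1) by (simp add: divide_le_eq mult.commute)
    \<comment> \<open>Every condition on \<open>R\<close> is a lower bound, so all hold for large
      \<open>R\<close>. The constant \<open>e^24\<close> then depends on \<open>s0\<close>, which
      \<open>Bad\<close> permits.\<close>
    have "eventually (\<lambda>R::nat. 1 \<le> R \<and> 512 \<le> real R powr 1 \<and> 100 * K / g \<le> real R powr 1 \<and> 2 \<le> real R powr (1 - s) \<and>
        4 * (3 * (18 * real M + 390) + 18) \<le> real R powr (5 / 6) \<and> 1 / (b - a) \<le> real R powr 2) sequentially"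
      using s by (intro eventually_conj eventually_powr_ge eventually_ge_at_top) auto
    then obtain R :: nat where R: "1 \<le> R" "512 \<le> real R powr 1" "100 * K / g \<le> real R powr 1" "2 \<le> real R powr (1 - s)"
        "4 * (3 * (18 * real M + 390) + 18) \<le> real R powr (5 / 6)" "1 / (b - a) \<le> real R powr 2"
      using eventually_happens'[OF sequentially_bot] by blast
    have "1 / real R ^ 2 \<le> b - a"
      using R(1,6) arc(1) by (simp add: field_simps)
    hence sub: "{a..a + 1 / real R ^ 2} \<subseteq> {a..b}"
      by auto
    have Rs: "2 * real R powr s \<le> real R"
    proof -
      have "2 * real R powr s \<le> real R powr (1 - s) * real R powr s"
        using R(4) by (intro mult_right_mono) auto
      also have "\<dots> = real R"
        using R(1) by (simp flip: powr_add)
      finally show ?thesis .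
    qed
    note s0_s = s(2,3)
    interpret short_arc i j s K g a R M f f1 f2
      by unfold_locales (use assms arc s M R Rs sub in \<open>auto simp: divide_le_eq mult.commute subset_iff\<close>)
    show ?thesis
    proof (rule hausdorff_measure_pos)
      show "(x, f x) \<in> Bad i j \<inter> C" if "x \<in> I0" "\<And>q p t. \<not> near x q p t" for x
        using not_near_Bad[OF that] arc(9) that(1) sub unfolding I0_eq by blast
    qed (use s0 s0_s in auto)
  qed
  show ?thesis
    unfolding hausdorff_dim_def
  proof (rule Inf_greatest)
    fix y assume "y \<in> {ereal s |s. 0 \<le> s \<and> hausdorff_measure s (Bad i j \<inter> C) = 0}"
    then obtain s0 where "y = ereal s0" "0 \<le> s0" "hausdorff_measure s0 (Bad i j \<inter> C) = 0"
      by blast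
    thus "1 \<le> y"
      using pos[of s0] by (cases "s0 < 1") auto
  qed
qed

end
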